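(* Let $(a,b)\subseteq\mathbb{R}$ be an interval, let $d\nu$ be a real, locally finite signed Borel measure on $(a,b)$, singular with respect to Lebesgue measure, and let $q\in L^1_{\mathrm{loc}}(a,b)$ be nonnegative. Let $\Sigma\subset(a,b)$ be the (closed) topological support of $d\nu$ and let $(a,b)\setminus\Sigma=\bigcup_{k\in\mathbb{N}}\Delta_k$, where the $\Delta_k$ are the pairwise disjoint (infinitely many) component intervals, and let $d_k=|\Delta_k|$. If the self-adjoint operator $\mathrm{H}_{\nu,q}$ in $L^2(a,b)$ associated with $\tau=-\frac{d}{dx}\frac{d}{dP(x)}+q(x)$, $dP=dx+d\nu$, is lower semibounded and its spectrum is discrete, then $$\frac{1}{d_k^2}+\frac{1}{d_k}\int_{\Delta_k}q(x)\,dx\to\infty\qquad\text{as }k\to\infty.$$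
   Context: A function $f$ is locally absolutely continuous with respect to $dP$ if it is locally of bounded variation and its Borel measure satisfies $df=f^{[1]}\,dP$ for some $f^{[1]}\in L^1_{\mathrm{loc}}((a,b);dP)$ (the quasi-derivative). The maximal operator of $\tau$ is $f\mapsto-(f^{[1]})'+qf$ on all $f\in L^2(a,b)$ locally absolutely continuous with respect to $dP$ with $f^{[1]}\in AC_{\mathrm{loc}}(a,b)$ and $-(f^{[1]})'+qf\in L^2(a,b)$; its adjoint is the minimal operator, which is symmetric. $\mathrm{H}_{\nu,q}$ denotes a self-adjoint realization of $\tau$, i.e. a self-adjoint restriction of the maximal operator (equal to the maximal operator if the latter is self-adjoint). Discrete spectrum means that the spectrum consists of isolated eigenvalues of finite multiplicity. *)

theory Defs
  imports "HOL-Analysis.Analysis"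
begin

section \<open>Locally finite signed Borel measures\<close>

definition rc_borel :: "real set \<Rightarrow> real set set" where
  "rc_borel I = {B \<in> sets borel. \<exists>K. compact K \<and> B \<subseteq> K \<and> K \<subseteq> I}"

text \<open>A real, locally finite signed Borel measure on an open interval \<open>I\<close> is in general finite
  (and only defined) on the Borel sets that are relatively compact in \<open>I\<close>; its values on all other
  sets are irrelevant. Taking all \<open>A n\<close> empty gives \<open>\<nu> {} = 0\<close>.\<close>

definition signed_borel_measure :: "real set \<Rightarrow> (real set \<Rightarrow> real) \<Rightarrow> bool" where
  "signed_borel_measure I \<nu> \<longleftrightarrow>
     (\<forall>A :: nat \<Rightarrow> real set. range A \<subseteq> rc_borel I \<longrightarrow> disjoint_family A \<longrightarrow> (\<Union>n. A n) \<in> rc_borel I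
        \<longrightarrow> (\<lambda>n. \<nu> (A n)) sums \<nu> (\<Union>n. A n))"

definition singular_lborel :: "real set \<Rightarrow> (real set \<Rightarrow> real) \<Rightarrow> bool" where
  "singular_lborel I \<nu> \<longleftrightarrow> (\<exists>N \<in> null_sets lborel. \<forall>B \<in> rc_borel I. B \<inter> N = {} \<longrightarrow> \<nu> B = 0)"

text \<open>The complement in \<open>I\<close> of the largest open set all of whose relatively compact Borel subsets are
  \<open>\<nu>\<close>-null, i.e. the support of \<open>\<bar>\<nu>\<bar>\<close>.\<close>

definition signed_support :: "real set \<Rightarrow> (real set \<Rightarrow> real) \<Rightarrow> real set" where
  "signed_support I \<nu> =
     {x \<in> I. \<forall>U. open U \<and> x \<in> U \<longrightarrow> (\<exists>B \<in> rc_borel I. B \<subseteq> U \<and> \<nu> B \<noteq> 0)}"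

text \<open>The Jordan decomposition \<open>\<nu> = \<nu>\<^sup>+ - \<nu>\<^sup>-\<close>; note that \<^const>\<open>ennreal\<close> maps negative values to 0,
  which does not affect the supremum as \<open>B = {}\<close> is admissible.\<close>

definition pos_var :: "real set \<Rightarrow> (real set \<Rightarrow> real) \<Rightarrow> real measure" where
  "pos_var I \<nu> = measure_of UNIV (sets borel) (\<lambda>A. SUP B \<in> {B \<in> rc_borel I. B \<subseteq> A}. ennreal (\<nu> B))"

definition neg_var :: "real set \<Rightarrow> (real set \<Rightarrow> real) \<Rightarrow> real measure" where
  "neg_var I \<nu> = pos_var I (\<lambda>B. - \<nu> B)"

lemma sets_pos_var [simp]: "sets (pos_var I \<nu>) = sets borel"
  and space_pos_var [simp]: "space (pos_var I \<nu>) = UNIV"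
  and sets_neg_var [simp]: "sets (neg_var I \<nu>) = sets borel"
  and space_neg_var [simp]: "space (neg_var I \<nu>) = UNIV"
  unfolding neg_var_def pos_var_def
  using sets.sigma_sets_eq[of "borel :: real measure"] by simp_all

lemma signed_borel_measure_uminus:
  "signed_borel_measure I \<nu> \<Longrightarrow> signed_borel_measure I (\<lambda>B. - \<nu> B)"
  unfolding signed_borel_measure_def using sums_minus by blast

lemma rc_borel_empty: "{} \<in> rc_borel I"
  unfolding rc_borel_def by (auto intro!: exI[of _ "{}"])

lemma rc_borel_Un: "A \<in> rc_borel I \<Longrightarrow> B \<in> rc_borel I \<Longrightarrow> A \<union> B \<in> rc_borel I"
  unfolding rc_borel_def
  by (clarsimp, rename_tac K L, rule_tac x = "K \<union> L" in exI) auto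

lemma rc_borel_subset: "A \<in> rc_borel I \<Longrightarrow> B \<in> sets borel \<Longrightarrow> B \<subseteq> A \<Longrightarrow> B \<in> rc_borel I"
  unfolding rc_borel_def by blast

lemma signed_borel_measure_empty:
  assumes "signed_borel_measure I \<nu>" shows "\<nu> {} = 0"
proof -
  have "(\<lambda>n::nat. \<nu> {}) sums \<nu> {}"
    using assms[unfolded signed_borel_measure_def, rule_format, of "\<lambda>_. {}"]
    by (auto simp: rc_borel_empty disjoint_family_on_def)
  then have "summable (\<lambda>n::nat. \<nu> {})" by (rule sums_summable)
  then show ?thesis by (simp only: summable_const_iff)
qed

lemma signed_borel_measure_Un:
  assumes \<nu>: "signed_borel_measure I \<nu>" and A: "A \<in> rc_borel I" and B: "B \<in> rc_borel I"
    and disj: "A \<inter> B = {}"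
  shows "\<nu> (A \<union> B) = \<nu> A + \<nu> B"
proof -
  let ?f = "binaryset A B"
  have "(\<lambda>n. \<nu> (?f n)) sums \<nu> (\<Union>n. ?f n)"
  proof (rule \<nu>[unfolded signed_borel_measure_def, rule_format])
    show "range ?f \<subseteq> rc_borel I" using A B rc_borel_empty by (simp add: range_binaryset_eq)
    show "disjoint_family ?f"
      using disj by (auto simp: disjoint_family_on_def binaryset_def)
    show "(\<Union>n. ?f n) \<in> rc_borel I" using A B rc_borel_Un by (simp add: UN_binaryset_eq)
  qed
  moreover have "(\<lambda>n. \<nu> (?f n)) sums (\<nu> A + \<nu> B)"
    by (rule binaryset_sums) (rule signed_borel_measure_empty[OF \<nu>])
  ultimately show ?thesis
    by (metis UN_binaryset_eq sums_unique2)
qed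

text \<open>The supremum is countably additive, so \<^const>\<open>measure_of\<close> does not collapse to the zero measure.\<close>

lemma emeasure_pos_var:
  assumes \<nu>: "signed_borel_measure I \<nu>" and A: "A \<in> sets borel"
  shows "emeasure (pos_var I \<nu>) A = (SUP B \<in> {B \<in> rc_borel I. B \<subseteq> A}. ennreal (\<nu> B))"
proof -
  define p where "p = (\<lambda>A. SUP B \<in> {B \<in> rc_borel I. B \<subseteq> A}. ennreal (\<nu> B))"
  have le_p: "ennreal (\<nu> B) \<le> p A" if "B \<in> rc_borel I" "B \<subseteq> A" for A B
    unfolding p_def using that by (intro SUP_upper) auto
  have p0: "p {} = 0"
  proof -
    have "{B \<in> rc_borel I. B \<subseteq> {}} = {{}}" using rc_borel_empty by auto
    then show ?thesis by (simp add: p_def signed_borel_measure_empty[OF \<nu>])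
  qed
  have pmono: "p A \<le> p B" if "A \<subseteq> B" for A B
    unfolding p_def using that by (intro SUP_subset_mono) auto
  have super: "p A + p B \<le> p (A \<union> B)" if "A \<inter> B = {}" for A B
  proof -
    have ne: "{X \<in> rc_borel I. X \<subseteq> Y} \<noteq> {}" for Y using rc_borel_empty by auto
    have 1: "ennreal (\<nu> X) + ennreal (\<nu> Y) \<le> p (A \<union> B)"
      if X: "X \<in> rc_borel I" "X \<subseteq> A" and Y: "Y \<in> rc_borel I" "Y \<subseteq> B" for X Y
    proof -
      have XY: "X \<union> Y \<in> rc_borel I" "X \<inter> Y = {}"
        using X Y \<open>A \<inter> B = {}\<close> rc_borel_Un by auto
      show ?thesis
      proof (cases "\<nu> X \<ge> 0 \<and> \<nu> Y \<ge> 0")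
        case True
        then have "ennreal (\<nu> X) + ennreal (\<nu> Y) = ennreal (\<nu> (X \<union> Y))"
          using signed_borel_measure_Un[OF \<nu> X(1) Y(1) XY(2)] by (simp add: ennreal_plus)
        also have "\<dots> \<le> p (A \<union> B)" using XY X Y by (intro le_p) auto
        finally show ?thesis .
      next
        case False
        then have "ennreal (\<nu> X) = 0 \<or> ennreal (\<nu> Y) = 0" by (auto simp: ennreal_eq_0_iff)
        moreover have "ennreal (\<nu> X) \<le> p (A \<union> B)" "ennreal (\<nu> Y) \<le> p (A \<union> B)"
          using X Y by (auto intro!: le_p)
        ultimately show ?thesis by auto
      qed
    qed
    have 2: "ennreal (\<nu> X) + p B \<le> p (A \<union> B)" if X: "X \<in> rc_borel I" "X \<subseteq> A" for X
    proof -
      have "ennreal (\<nu> X) + p B = (SUP Y \<in> {Y \<in> rc_borel I. Y \<subseteq> B}. ennreal (\<nu> X) + ennreal (\<nu> Y))"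
        unfolding p_def by (rule ennreal_SUP_add_right[OF ne])
      also have "\<dots> \<le> p (A \<union> B)" using 1 X by (intro SUP_least) auto
      finally show ?thesis .
    qed
    have "p A + p B = (SUP X \<in> {X \<in> rc_borel I. X \<subseteq> A}. ennreal (\<nu> X) + p B)"
      by (subst (1) p_def) (rule ennreal_SUP_add_left[OF ne, symmetric])
    also have "\<dots> \<le> p (A \<union> B)" using 2 by (intro SUP_least) auto
    finally show ?thesis .
  qed
  have ca: "countably_additive (sets borel) p"
    unfolding countably_additive_def
  proof (intro allI impI)
    fix A :: "nat \<Rightarrow> real set"
    assume A: "range A \<subseteq> sets borel" "disjoint_family A" "(\<Union>i. A i) \<in> sets borel"
    have fin: "(\<Sum>i<n. p (A i)) \<le> p (\<Union>i<n. A i)" for n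
    proof (induction n)
      case (Suc n)
      have "(\<Union>i<n. A i) \<inter> A n = {}"
      proof -
        have "A i \<inter> A n = {}" if "i < n" for i
          using disjoint_family_onD[OF A(2), of i n] that by simp
        then show ?thesis by blast
      qed
      have "(\<Sum>i<Suc n. p (A i)) \<le> p (\<Union>i<n. A i) + p (A n)"
        using Suc by (simp add: add_mono)
      also have "\<dots> \<le> p ((\<Union>i<n. A i) \<union> A n)" by (rule super) fact
      also have "(\<Union>i<n. A i) \<union> A n = (\<Union>i<Suc n. A i)" by (simp only: lessThan_Suc) blast
      finally show ?case .
    qed (simp add: p0)
    have "(\<Sum>i. p (A i)) \<le> p (\<Union>i. A i)"
    proof (rule suminf_le_const)
      show "(\<Sum>i<n. p (A i)) \<le> p (\<Union>i. A i)" for n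
        by (rule order_trans[OF fin pmono]) auto
    qed simp
    moreover have "p (\<Union>i. A i) \<le> (\<Sum>i. p (A i))"
      unfolding p_def[THEN fun_cong, of "\<Union>i. A i"]
    proof (rule SUP_least)
      fix B assume "B \<in> {B \<in> rc_borel I. B \<subseteq> (\<Union>i. A i)}"
      then have B: "B \<in> rc_borel I" "B \<subseteq> (\<Union>i. A i)" by auto
      have BA: "B \<inter> A i \<in> rc_borel I" for i
        using B A(1) by (intro rc_borel_subset[OF B(1)]) (auto simp: rc_borel_def)
      have UB: "(\<Union>i. B \<inter> A i) = B" using B by auto
      have "(\<lambda>i. \<nu> (B \<inter> A i)) sums \<nu> (\<Union>i. B \<inter> A i)"
      proof (rule \<nu>[unfolded signed_borel_measure_def, rule_format])
        show "disjoint_family (\<lambda>i. B \<inter> A i)" using A(2) by (rule disjoint_family_on_bisimulation) auto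
        show "(\<Union>i. B \<inter> A i) \<in> rc_borel I" unfolding UB by (rule B)
      qed (use BA in blast)
      then have "(\<lambda>n. ennreal (\<Sum>i<n. \<nu> (B \<inter> A i))) \<longlonglongrightarrow> ennreal (\<nu> B)"
        unfolding UB sums_def by (rule tendsto_ennrealI)
      moreover have "ennreal (\<Sum>i<n. \<nu> (B \<inter> A i)) \<le> (\<Sum>i. p (A i))" for n
      proof -
        have "ennreal (\<Sum>i<n. \<nu> (B \<inter> A i)) \<le> ennreal (\<Sum>i<n. max 0 (\<nu> (B \<inter> A i)))"
          by (intro ennreal_leI sum_mono) auto
        also have "\<dots> = (\<Sum>i<n. ennreal (max 0 (\<nu> (B \<inter> A i))))" by (simp add: sum_ennreal)
        also have "\<dots> \<le> (\<Sum>i<n. p (A i))"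
          using BA by (intro sum_mono) (auto simp: ennreal_max_0 intro!: le_p)
        also have "\<dots> \<le> (\<Sum>i. p (A i))" by (rule sum_le_suminf) auto
        finally show ?thesis .
      qed
      ultimately show "ennreal (\<nu> B) \<le> (\<Sum>i. p (A i))"
        by (intro LIMSEQ_le_const2) auto
    qed
    ultimately show "(\<Sum>i. p (A i)) = p (\<Union>i. A i)" by (rule antisym)
  qed
  have "sigma_algebra UNIV (sets (borel :: real measure))"
    using sets.sigma_algebra_axioms[of "borel :: real measure"] by simp
  moreover have "positive (sets borel) p" by (simp add: positive_def p0)
  ultimately have "emeasure (measure_of UNIV (sets borel) p) A = p A"
    using ca A by (rule emeasure_measure_of_sigma)
  then show ?thesis by (simp only: p_def pos_var_def)
qed

definition loc_integrable :: "real measure \<Rightarrow> real set \<Rightarrow> (real \<Rightarrow> 'a::{banach, second_countable_topology}) \<Rightarrow> bool" where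
  "loc_integrable M I h \<longleftrightarrow> (\<forall>K. compact K \<and> K \<subseteq> I \<longrightarrow> set_integrable M K h)"


section \<open>Functions of bounded variation and absolute continuity\<close>

definition bounded_variation :: "real \<Rightarrow> real \<Rightarrow> (real \<Rightarrow> complex) \<Rightarrow> bool" where
  "bounded_variation c d f \<longleftrightarrow>
     (\<exists>V. \<forall>(n::nat) t. mono_on {..n} t \<and> t ` {..n} \<subseteq> {c..d} \<longrightarrow> (\<Sum>i<n. cmod (f (t (Suc i)) - f (t i))) \<le> V)"

definition loc_bounded_variation :: "real set \<Rightarrow> (real \<Rightarrow> complex) \<Rightarrow> bool" where
  "loc_bounded_variation I f \<longleftrightarrow> (\<forall>c d. {c..d} \<subseteq> I \<longrightarrow> bounded_variation c d f)"

text \<open>\<open>L\<^sup>1\<^sub>l\<^sub>o\<^sub>c(I; dP)\<close> for \<open>dP = dx + d\<nu>\<close>, \<open>\<nu>\<close> singular: then \<open>\<bar>dP\<bar> = dx + \<nu>\<^sup>+ + \<nu>\<^sup>-\<close>.\<close>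

definition dP_loc_integrable :: "real set \<Rightarrow> (real set \<Rightarrow> real) \<Rightarrow> (real \<Rightarrow> complex) \<Rightarrow> bool" where
  "dP_loc_integrable I \<nu> h \<longleftrightarrow>
     loc_integrable lborel I h \<and> loc_integrable (pos_var I \<nu>) I h \<and> loc_integrable (neg_var I \<nu>) I h"

definition dP_integral :: "real set \<Rightarrow> (real set \<Rightarrow> real) \<Rightarrow> real set \<Rightarrow> (real \<Rightarrow> complex) \<Rightarrow> complex" where
  "dP_integral I \<nu> A h =
     (LINT x:A|lborel. h x) + (LINT x:A|pos_var I \<nu>. h x) - (LINT x:A|neg_var I \<nu>. h x)"

text \<open>\<open>f\<close> is locally absolutely continuous with respect to \<open>dP\<close> with quasi-derivative \<open>f1\<close>. The Borel
  measure of a function of locally bounded variation is determined by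
  \<open>df [c, d) = f (d-) - f (c-)\<close>, whatever the values of \<open>f\<close> at its jumps.\<close>

definition dP_abs_cont :: "real set \<Rightarrow> (real set \<Rightarrow> real) \<Rightarrow> (real \<Rightarrow> complex) \<Rightarrow> (real \<Rightarrow> complex) \<Rightarrow> bool" where
  "dP_abs_cont I \<nu> f f1 \<longleftrightarrow>
     loc_bounded_variation I f \<and> dP_loc_integrable I \<nu> f1 \<and>
     (\<forall>c\<in>I. \<forall>d\<in>I. c < d \<longrightarrow> Lim (at_left d) f - Lim (at_left c) f = dP_integral I \<nu> {c..<d} f1)"

text \<open>\<open>h \<in> AC\<^sub>l\<^sub>o\<^sub>c(I)\<close> with derivative \<open>h'\<close> (unique up to null sets), i.e. absolute continuity
  \<open>dh = h' dx\<close> with respect to Lebesgue measure, for the continuous representative \<open>h\<close>.\<close>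

definition AC_loc_deriv :: "real set \<Rightarrow> (real \<Rightarrow> complex) \<Rightarrow> (real \<Rightarrow> complex) \<Rightarrow> bool" where
  "AC_loc_deriv I h h' \<longleftrightarrow>
     loc_integrable lebesgue I h' \<and>
     (\<forall>c\<in>I. \<forall>d\<in>I. c < d \<longrightarrow> h d - h c = (LINT x:{c..d}|lebesgue. h' x))"


section \<open>Unbounded operators in \<open>L\<^sup>2(I)\<close>\<close>

text \<open>Elements of \<open>L\<^sup>2(I)\<close> are represented by functions, to be read modulo equality almost everywhere
  on \<open>I\<close>; an operator is represented by its graph, the set of all pairs of representatives.\<close>

definition L2 :: "real set \<Rightarrow> (real \<Rightarrow> complex) set" where
  "L2 I = {f \<in> borel_measurable (lebesgue_on I). integrable (lebesgue_on I) (\<lambda>x. (cmod (f x))\<^sup>2)}"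

definition ae_eq :: "real set \<Rightarrow> (real \<Rightarrow> complex) \<Rightarrow> (real \<Rightarrow> complex) \<Rightarrow> bool" where
  "ae_eq I f g \<longleftrightarrow> (AE x in lebesgue_on I. f x = g x)"

definition L2_inner :: "real set \<Rightarrow> (real \<Rightarrow> complex) \<Rightarrow> (real \<Rightarrow> complex) \<Rightarrow> complex" where
  "L2_inner I f g = (LINT x|lebesgue_on I. f x * cnj (g x))"

definition L2_norm :: "real set \<Rightarrow> (real \<Rightarrow> complex) \<Rightarrow> real" where
  "L2_norm I f = sqrt (LINT x|lebesgue_on I. (cmod (f x))\<^sup>2)"

type_synonym graph = "((real \<Rightarrow> complex) \<times> (real \<Rightarrow> complex)) set"

definition linear_operator :: "real set \<Rightarrow> graph \<Rightarrow> bool" where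
  "linear_operator I T \<longleftrightarrow>
     T \<subseteq> L2 I \<times> L2 I \<and>
     ((\<lambda>_. 0), (\<lambda>_. 0)) \<in> T \<and>
     (\<forall>(f, g) \<in> T. \<forall>(f', g') \<in> T. \<forall>\<alpha> \<beta>. ((\<lambda>x. \<alpha> * f x + \<beta> * f' x), (\<lambda>x. \<alpha> * g x + \<beta> * g' x)) \<in> T) \<and>
     (\<forall>(f, g) \<in> T. \<forall>f' \<in> L2 I. \<forall>g' \<in> L2 I. ae_eq I f f' \<and> ae_eq I g g' \<longrightarrow> (f', g') \<in> T) \<and>
     (\<forall>(f, g) \<in> T. \<forall>(f', g') \<in> T. ae_eq I f f' \<longrightarrow> ae_eq I g g')"

definition densely_defined :: "real set \<Rightarrow> graph \<Rightarrow> bool" where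
  "densely_defined I T \<longleftrightarrow>
     (\<forall>h \<in> L2 I. \<forall>\<epsilon>>0. \<exists>(f, g) \<in> T. L2_norm I (\<lambda>x. h x - f x) < \<epsilon>)"

definition adjoint_graph :: "real set \<Rightarrow> graph \<Rightarrow> graph" where
  "adjoint_graph I T =
     {(u, v) \<in> L2 I \<times> L2 I. \<forall>(f, g) \<in> T. L2_inner I g u = L2_inner I f v}"

definition self_adjoint :: "real set \<Rightarrow> graph \<Rightarrow> bool" where
  "self_adjoint I T \<longleftrightarrow> linear_operator I T \<and> densely_defined I T \<and> adjoint_graph I T = T"

definition lower_semibounded :: "real set \<Rightarrow> graph \<Rightarrow> bool" where
  "lower_semibounded I T \<longleftrightarrow>
     (\<exists>\<gamma>::real. \<forall>(f, g) \<in> T. \<gamma> * (L2_norm I f)\<^sup>2 \<le> Re (L2_inner I g f))"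

text \<open>\<open>z\<close> is in the resolvent set iff \<open>T - z\<close> maps onto \<open>L\<^sup>2(I)\<close> and has a bounded inverse.\<close>

definition resolvent_set :: "real set \<Rightarrow> graph \<Rightarrow> complex set" where
  "resolvent_set I T =
     {z. (\<forall>h \<in> L2 I. \<exists>(f, g) \<in> T. ae_eq I h (\<lambda>x. g x - z * f x)) \<and>
         (\<exists>C. \<forall>(f, g) \<in> T. L2_norm I f \<le> C * L2_norm I (\<lambda>x. g x - z * f x))}"

definition spectrum :: "real set \<Rightarrow> graph \<Rightarrow> complex set" where
  "spectrum I T = - resolvent_set I T"

definition eigenfunctions :: "real set \<Rightarrow> graph \<Rightarrow> complex \<Rightarrow> (real \<Rightarrow> complex) set" where
  "eigenfunctions I T z = {f. \<exists>g. (f, g) \<in> T \<and> ae_eq I g (\<lambda>x. z * f x)}"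

definition eigenvalue :: "real set \<Rightarrow> graph \<Rightarrow> complex \<Rightarrow> bool" where
  "eigenvalue I T z \<longleftrightarrow> (\<exists>f \<in> eigenfunctions I T z. \<not> ae_eq I f (\<lambda>_. 0))"

definition finite_multiplicity :: "real set \<Rightarrow> graph \<Rightarrow> complex \<Rightarrow> bool" where
  "finite_multiplicity I T z \<longleftrightarrow>
     (\<exists>(n::nat) e. \<forall>f \<in> eigenfunctions I T z. \<exists>\<alpha> :: nat \<Rightarrow> complex. ae_eq I f (\<lambda>x. \<Sum>i<n. \<alpha> i * e i x))"

definition discrete_spectrum :: "real set \<Rightarrow> graph \<Rightarrow> bool" where
  "discrete_spectrum I T \<longleftrightarrow>
     (\<forall>z \<in> spectrum I T. z isolated_in spectrum I T \<and> eigenvalue I T z \<and> finite_multiplicity I T z)"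


section \<open>The differential expression \<open>\<tau>f = -(f\<^sup>[\<^sup>1\<^sup>])' + qf\<close>\<close>

text \<open>In the maximal operator, \<open>u\<close> is the representative of the class of \<open>f\<close> that is locally absolutely
  continuous with respect to \<open>dP\<close>.\<close>

definition maximal_operator :: "real set \<Rightarrow> (real set \<Rightarrow> real) \<Rightarrow> (real \<Rightarrow> real) \<Rightarrow> graph" where
  "maximal_operator I \<nu> q =
     {(f, g) \<in> L2 I \<times> L2 I. \<exists>u u1 u1'.
        ae_eq I f u \<and> dP_abs_cont I \<nu> u u1 \<and> AC_loc_deriv I u1 u1' \<and>
        ae_eq I g (\<lambda>x. - u1' x + complex_of_real (q x) * u x)}"

text \<open>For self-adjoint \<open>T\<close> and \<open>S\<close>, \<open>T \<subseteq> S\<close> implies \<open>S = T\<close>. Hence if the maximal operator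
  is itself self-adjoint then it is its only self-adjoint restriction.\<close>

definition self_adjoint_realization ::
    "real set \<Rightarrow> (real set \<Rightarrow> real) \<Rightarrow> (real \<Rightarrow> real) \<Rightarrow> graph \<Rightarrow> bool" where
  "self_adjoint_realization I \<nu> q H \<longleftrightarrow> self_adjoint I H \<and> H \<subseteq> maximal_operator I \<nu> q"

end

theory Submission
  imports Defs
begin

text \<open>On a component \<open>\<Delta>\<^sub>k\<close> of the complement of the support of \<open>\<nu>\<close> the expression \<open>\<tau>\<close> is the ordinary
  Schroedinger expression \<open>- u'' + q u\<close>. If the quantities in question stayed bounded along infinitely
  many \<open>k\<close>, each such \<open>\<Delta>\<^sub>k\<close> would contain an interval of one fixed length \<open>l\<close> on which \<open>\<integral> q\<close> is small.
  There one solves \<open>w'' = q w\<close> with \<open>w\<close> close to 1 and multiplies by the cutoff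
  \<open>\<eta> = ((x - c) (d - x))\<^sup>2\<close>. The function \<open>\<phi>\<^sub>k = \<eta> w\<close> satisfies \<open>\<tau> \<phi>\<^sub>k = - \<eta>'' w - 2 \<eta>' w'\<close>; integrating by
  parts against the maximal operator shows \<open>\<phi>\<^sub>k \<in> dom(H\<^sup>*) = dom(H)\<close>. Moreover
  \<open>\<parallel>H \<phi>\<^sub>k\<parallel> \<le> C \<parallel>\<phi>\<^sub>k\<parallel>\<close> with \<open>C\<close> depending only on \<open>l\<close>, and the supports are disjoint. So the bounded
  self-adjoint operator \<open>(H - \<mu>)\<^sup>-\<^sup>1\<close>, \<open>\<mu>\<close> a real resolvent point, is bounded below on an
  infinite-dimensional subspace, whereas its spectrum away from 0 consists of isolated eigenvalues of
  finite multiplicity: a contradiction.\<close>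


section \<open>Bounded symmetric operators on a real Hilbert space\<close>

text \<open>The obstacle is that \<open>q\<close> is only locally integrable: for a smooth bump
  \<open>\<eta>\<close> the product \<open>q * \<eta>\<close> need not be square integrable, so
  \<open>\<eta>\<close> itself may fail to lie in the domain of \<open>H\<close>. The factor
  \<open>w\<close> cancels \<open>q\<close> from the image. The cutoff is a square, so it vanishes
  together with its derivative at both ends; no boundary terms arise, whatever the boundary
  conditions of \<open>H\<close>. A pigeonhole choice of the subinterval makes
  \<open>(d - c) * integral {c..d} \<bar>q\<bar>\<close> at most 1/4, which keeps \<open>w\<close>
  within 1/3 of 1. The contradiction is drawn without a spectral theorem. Being bounded below takes
  the place of membership in the resolvent set, and Cauchy-Schwarz for nonnegative forms does the
  work. Outside \<open>(-\<delta>, \<delta>)\<close> the resolvent \<open>A\<close> has finitely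
  many spectral values, and a nonzero vector of the span of the sequence is orthogonal to all their
  eigenspaces. On the orthogonal complement \<open>K\<close> of these eigenspaces the norm
  \<open>N\<close> of \<open>A\<close> is thus at least \<open>\<delta>\<close>, and
  \<open>N\<close> or \<open>-N\<close> is spectral for \<open>A\<close> on \<open>K\<close>. But an
  isolated value \<open>t\<close> leaves \<open>A - t\<close> bounded below off its kernel, hence on
  \<open>K\<close>.\<close>

lemma closed_subspace_projection:
  fixes M :: "'a::{real_inner, complete_space} set"
  assumes M: "subspace M" "closed M"
  obtains y where "y \<in> M" "\<And>z. z \<in> M \<Longrightarrow> inner (x - y) z = 0"
proof -
  define d where "d = infdist x M"
  have ne: "M \<noteq> {}" using M(1) subspace_0 by blast
  have d0: "0 \<le> d" by (simp add: d_def infdist_nonneg)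
  have d_le: "d \<le> norm (x - z)" if "z \<in> M" for z
    using infdist_le[OF that, of x] by (simp add: d_def dist_norm)
  have "\<exists>z\<in>M. norm (x - z) < d + 1 / real (Suc n)" for n
  proof -
    have "(INF a\<in>M. dist x a) < d + 1 / real (Suc n)"
      using ne by (simp add: d_def infdist_notempty)
    moreover have "bdd_below (dist x ` M)" by (intro bdd_belowI[of _ 0]) auto
    ultimately show ?thesis using ne by (auto simp: cINF_less_iff dist_norm)
  qed
  then obtain y where yM: "\<And>n. y n \<in> M" and yd: "\<And>n. norm (x - y n) < d + 1 / real (Suc n)"
    by metis
  have lim0: "(\<lambda>n. (d + 1 / real (Suc n))\<^sup>2 - d\<^sup>2) \<longlonglongrightarrow> (d + 0)\<^sup>2 - d\<^sup>2"
    by (intro tendsto_intros LIMSEQ_Suc[OF lim_1_over_n])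
  \<comment> \<open>Parallelogram law for \<open>x - y m\<close> and \<open>x - y n\<close>: their
    midpoint is \<open>x\<close> minus an element of \<open>M\<close>, so half the norm of their sum
    is at least \<open>d\<close>.\<close>
  have par: "(norm (y m - y n))\<^sup>2 \<le> 2 * ((d + 1 / real (Suc m))\<^sup>2 - d\<^sup>2) + 2 * ((d + 1 / real (Suc n))\<^sup>2 - d\<^sup>2)" for m n
  proof -
    define u v where "u = x - y m" and "v = x - y n"
    have "(1/2) *\<^sub>R (y m + y n) \<in> M"
      using M(1) yM by (intro subspace_scale subspace_add)
    from d_le[OF this] have "2 * d \<le> 2 * norm ((1/2) *\<^sub>R (u + v))"
      by (simp add: u_def v_def algebra_simps scaleR_half_double flip: scaleR_add_left)
    then have "2 * d \<le> norm (u + v)" by simp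
    then have "(2 * d)\<^sup>2 \<le> (norm (u + v))\<^sup>2" using d0 by (intro power_mono) auto
    moreover have "(norm (u + v))\<^sup>2 + (norm (u - v))\<^sup>2 = 2 * (norm u)\<^sup>2 + 2 * (norm v)\<^sup>2"
      by (simp add: power2_norm_eq_inner algebra_simps inner_commute)
    moreover have "(norm u)\<^sup>2 \<le> (d + 1 / real (Suc m))\<^sup>2" "(norm v)\<^sup>2 \<le> (d + 1 / real (Suc n))\<^sup>2"
      using yd[of m] yd[of n] by (auto intro!: power_mono simp: u_def v_def less_imp_le)
    moreover have "norm (y m - y n) = norm (u - v)"
      by (simp add: u_def v_def norm_minus_commute)
    ultimately show ?thesis by (simp add: power_mult_distrib)
  qed
  have "Cauchy y"
  proof (rule CauchyI)
    fix e :: real assume e: "0 < e"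
    then have "eventually (\<lambda>n. (d + 1 / real (Suc n))\<^sup>2 - d\<^sup>2 < e\<^sup>2 / 4) sequentially"
      using lim0 by (intro order_tendstoD(2)[OF lim0]) auto
    then obtain N where N: "\<And>n. n \<ge> N \<Longrightarrow> (d + 1 / real (Suc n))\<^sup>2 - d\<^sup>2 < e\<^sup>2 / 4"
      by (auto simp: eventually_sequentially)
    have "norm (y m - y n) < e" if "m \<ge> N" "n \<ge> N" for m n
    proof -
      have "(norm (y m - y n))\<^sup>2 < e\<^sup>2"
        using par[of m n] N[OF that(1)] N[OF that(2)] by simp
      then show ?thesis using e by (simp add: power2_less_imp_less)
    qed
    then show "\<exists>N. \<forall>m\<ge>N. \<forall>n\<ge>N. norm (y m - y n) < e" by blast
  qed
  then obtain l where l: "y \<longlonglongrightarrow> l" using Cauchy_convergent convergent_def by blast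
  have lM: "l \<in> M" using closed_sequentially[OF M(2)] yM l by blast
  have "norm (x - l) \<le> d + 0"
  proof (rule LIMSEQ_le)
    show "(\<lambda>n. norm (x - y n)) \<longlonglongrightarrow> norm (x - l)" using l by (intro tendsto_intros)
    show "(\<lambda>n. d + 1 / real (Suc n)) \<longlonglongrightarrow> d + 0"
      by (intro tendsto_intros LIMSEQ_Suc[OF lim_1_over_n])
  qed (use yd less_imp_le in blast)
  then have ld: "norm (x - l) \<le> d" by simp
  have "inner (x - l) z = 0" if z: "z \<in> M" for z
  proof (cases "z = 0")
    case False
    \<comment> \<open>\<open>l + t z\<close> is the best approximation of \<open>x\<close> on the
      line through \<open>l\<close> in direction \<open>z\<close>; as \<open>l\<close> is already
      optimal, the gain \<open>t * inner (x - l) z\<close> cannot be positive.\<close>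
    define t where "t = inner (x - l) z / inner z z"
    have zz: "inner z z > 0" using False by simp
    have "l + t *\<^sub>R z \<in> M" using M(1) lM z by (intro subspace_add subspace_scale)
    from order_trans[OF ld d_le[OF this]] have "(norm (x - l))\<^sup>2 \<le> (norm ((x - l) - t *\<^sub>R z))\<^sup>2"
      by (intro power_mono) (simp_all add: algebra_simps)
    also have "\<dots> = (norm (x - l))\<^sup>2 - 2 * t * inner (x - l) z + t * t * inner z z"
      unfolding power2_norm_eq_inner
      by (simp add: inner_diff_left inner_diff_right inner_commute algebra_simps)
    also have "t * t * inner z z = t * inner (x - l) z" using zz by (simp add: t_def)
    finally have "t * inner (x - l) z \<le> 0" by simp
    moreover have "t * inner (x - l) z = (inner (x - l) z)\<^sup>2 / inner z z"
      by (simp add: t_def power2_eq_square)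
    ultimately show ?thesis using zz by (simp add: divide_le_0_iff)
  qed simp
  with lM show ?thesis by (rule that)
qed

lemma closure_of_subspace:
  fixes M :: "'a::real_normed_vector set"
  assumes "subspace M" shows "subspace (closure M)"
proof (rule subspaceI)
  show "0 \<in> closure M" using assms subspace_0 closure_subset by blast
next
  fix x y assume "x \<in> closure M" "y \<in> closure M"
  then obtain f g where "\<And>n. f n \<in> M" "f \<longlonglongrightarrow> x" "\<And>n. g n \<in> M" "g \<longlonglongrightarrow> y"
    unfolding closure_sequential by blast
  then show "x + y \<in> closure M" unfolding closure_sequential
    using assms by (intro exI[of _ "\<lambda>n. f n + g n"]) (auto intro: subspace_add tendsto_add)
next
  fix c x assume "x \<in> closure M"
  then obtain f where "\<And>n. f n \<in> M" "f \<longlonglongrightarrow> x" unfolding closure_sequential by blast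
  then show "c *\<^sub>R x \<in> closure M" unfolding closure_sequential
    using assms by (intro exI[of _ "\<lambda>n. c *\<^sub>R f n"]) (auto intro: subspace_scale tendsto_scaleR)
qed

text \<open>The quadratic \<open>a + 2 t b + t t c\<close> is nonnegative for all real
  \<open>t\<close>, hence its discriminant is not positive. Taken with \<open>y = S x\<close>, the
  inequality bounds \<open>norm (S x)\<close> by the quadratic form of \<open>S\<close>.\<close>

lemma psd_Cauchy_Schwarz:
  fixes S :: "'a::real_inner \<Rightarrow> 'a"
  assumes lin: "linear S" and sym: "\<And>x y. inner (S x) y = inner x (S y)"
    and K: "subspace K" and psd: "\<And>x. x \<in> K \<Longrightarrow> 0 \<le> inner (S x) x"
    and x: "x \<in> K" and y: "y \<in> K"
  shows "(inner (S x) y)\<^sup>2 \<le> inner (S x) x * inner (S y) y"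
proof -
  define a b c where "a = inner (S x) x" and "b = inner (S x) y" and "c = inner (S y) y"
  have b': "inner (S y) x = b" by (metis b_def sym inner_commute)
  have q: "0 \<le> a + 2 * t * b + t * t * c" for t
  proof -
    have "0 \<le> inner (S (x + t *\<^sub>R y)) (x + t *\<^sub>R y)"
      by (intro psd subspace_add[OF K] subspace_scale[OF K] x y)
    also have "\<dots> = a + 2 * t * b + t * t * c"
      by (simp add: linear_add[OF lin] linear_scale[OF lin] inner_add_left inner_add_right
          a_def b_def c_def b'[unfolded b_def] algebra_simps)
    finally show ?thesis .
  qed
  have a0: "0 \<le> a" and c0: "0 \<le> c" using psd x y by (auto simp: a_def c_def)
  have "b\<^sup>2 \<le> a * c"
  proof (cases "c = 0")
    case True
    have "b = 0"
    proof (rule ccontr)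
      assume "b \<noteq> 0"
      \<comment> \<open>For \<open>c = 0\<close> this \<open>t\<close> makes
        \<open>a + 2 t b\<close> equal to -1.\<close>
      then show False using q[of "- (a + 1) / (2 * b)"] True by (simp add: field_simps)
    qed
    then show ?thesis using a0 c0 by simp
  next
    case False
    then have "0 \<le> (a + 2 * (- b / c) * b + (- b / c) * (- b / c) * c) * c"
      using q[of "- b / c"] c0 by (intro mult_nonneg_nonneg) auto
    also have "\<dots> = a * c - b\<^sup>2" using False by (simp add: field_simps power2_eq_square)
    finally show ?thesis by simp
  qed
  then show ?thesis by (simp add: a_def b_def c_def)
qed

text \<open>For a bounded symmetric operator on a Hilbert space and real \<open>t\<close>,
  \<open>A - t\<close> is bounded below on the whole space exactly when \<open>t\<close> lies in the
  resolvent set; so this notion expresses the real spectrum without inverses. The set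
  \<open>K\<close> allows restriction to a subspace.\<close>

definition bounded_below :: "'a::real_normed_vector set \<Rightarrow> ('a \<Rightarrow> 'a) \<Rightarrow> bool" where
  "bounded_below K T \<longleftrightarrow> (\<exists>c>0. \<forall>x\<in>K. c * norm x \<le> norm (T x))"

lemma bounded_below_comp:
  assumes "bounded_below K S" "bounded_below K T" "\<And>x. x \<in> K \<Longrightarrow> T x \<in> K"
  shows "bounded_below K (\<lambda>x. S (T x))"
proof -
  obtain c d where c: "c > 0" "\<And>x. x \<in> K \<Longrightarrow> c * norm x \<le> norm (S x)"
    and d: "d > 0" "\<And>x. x \<in> K \<Longrightarrow> d * norm x \<le> norm (T x)"
    using assms(1,2) unfolding bounded_below_def by blast
  have "c * d * norm x \<le> norm (S (T x))" if "x \<in> K" for x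
    using order_trans[OF mult_left_mono[OF d(2)[OF that], of c] c(2)[OF assms(3)[OF that]]] c(1)
    by (simp add: mult.assoc)
  then show ?thesis using c(1) d(1) unfolding bounded_below_def
    by (intro exI[of _ "c * d"]) auto
qed

text \<open>Openness of the resolvent set: moving \<open>t\<close> to \<open>s\<close> costs at most
  \<open>\<bar>s - t\<bar> * norm x\<close> of the lower bound \<open>c * norm x\<close>.\<close>

lemma bounded_below_perturb:
  assumes "bounded_below UNIV (\<lambda>x. T x - t *\<^sub>R x)"
  shows "\<exists>r>0. \<forall>s. \<bar>s - t\<bar> < r \<longrightarrow> bounded_below UNIV (\<lambda>x. T x - s *\<^sub>R x)"
proof -
  obtain c where c: "c > 0" "\<And>x. c * norm x \<le> norm (T x - t *\<^sub>R x)"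
    using assms unfolding bounded_below_def by blast
  have "bounded_below UNIV (\<lambda>x. T x - s *\<^sub>R x)" if s: "\<bar>s - t\<bar> < c" for s
  proof -
    have "(c - \<bar>s - t\<bar>) * norm x \<le> norm (T x - s *\<^sub>R x)" for x
    proof -
      have "norm (T x - t *\<^sub>R x) \<le> norm (T x - s *\<^sub>R x) + norm ((s - t) *\<^sub>R x)"
        using norm_triangle_ineq[of "T x - s *\<^sub>R x" "(s - t) *\<^sub>R x"] by (simp add: algebra_simps)
      moreover have "norm ((s - t) *\<^sub>R x) = \<bar>s - t\<bar> * norm x" by simp
      ultimately show ?thesis using c(2)[of x] by (simp only: left_diff_distrib)
    qed
    then show ?thesis using s unfolding bounded_below_def by (intro exI[of _ "c - \<bar>s - t\<bar>"]) auto
  qed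
  then show ?thesis using c(1) by blast
qed

text \<open>\<open>W = (U - m)(U + m)\<close> is nonnegative because \<open>m\<close> is a lower
  bound for \<open>U\<close>, and bounded below because both factors are. Cauchy-Schwarz for the
  form of \<open>W\<close> gives \<open>norm (W x)\<close> squared at most
  \<open>B * inner (W x) x\<close>, so the form is at least \<open>c\<^sup>2 / B\<close> times
  \<open>norm x\<close> squared, which is the improvement. In spectral terms: the best lower bound
  of \<open>U\<close> is attained at a spectral value.\<close>

lemma lower_bound_improves:
  fixes U :: "'a::real_inner \<Rightarrow> 'a"
  assumes U: "bounded_linear U" and sym: "\<And>x y. inner (U x) y = inner x (U y)"
    and m: "0 \<le> m" "\<And>x. m * norm x \<le> norm (U x)"
    and bb: "bounded_below UNIV (\<lambda>x. U x - m *\<^sub>R x)" "bounded_below UNIV (\<lambda>x. U x + m *\<^sub>R x)"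
  shows "\<exists>m'>m. \<forall>x. m' * norm x \<le> norm (U x)"
proof -
  interpret U: bounded_linear U by (rule U)
  define W where "W x = U (U x) - m\<^sup>2 *\<^sub>R x" for x
  have W: "bounded_linear W"
    unfolding W_def by (intro bounded_linear_sub bounded_linear_scaleR_right bounded_linear_compose[OF U U])
  interpret W: bounded_linear W by (rule W)
  obtain B where B: "B > 0" "\<And>x. norm (W x) \<le> norm x * B"
    using W.pos_bounded by blast
  have symW: "inner (W x) y = inner x (W y)" for x y
    by (simp add: W_def inner_diff_left inner_diff_right sym)
  have Wx: "inner (W x) x = (norm (U x))\<^sup>2 - m\<^sup>2 * (norm x)\<^sup>2" for x
    by (simp add: W_def inner_diff_left sym power2_norm_eq_inner)
  have psd: "0 \<le> inner (W x) x" for x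
  proof -
    have "(m * norm x)\<^sup>2 \<le> (norm (U x))\<^sup>2" using m by (intro power_mono) auto
    then show ?thesis by (simp add: Wx power_mult_distrib)
  qed
  have "(\<lambda>x. U (U x + m *\<^sub>R x) - m *\<^sub>R (U x + m *\<^sub>R x)) = W"
    by (auto simp: W_def U.add U.scaleR algebra_simps power2_eq_square)
  with bounded_below_comp[OF bb] have "bounded_below UNIV W" by simp
  then obtain c where c: "c > 0" "\<And>x. c * norm x \<le> norm (W x)"
    unfolding bounded_below_def by blast
  have main: "(m\<^sup>2 + c\<^sup>2 / B) * (norm x)\<^sup>2 \<le> (norm (U x))\<^sup>2" for x
  proof -
    have "(norm (W x))\<^sup>2 \<le> B * inner (W x) x"
    proof (cases "W x = 0")
      case False
      have "((norm (W x))\<^sup>2)\<^sup>2 = (inner (W x) (W x))\<^sup>2" by (simp add: power2_norm_eq_inner)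
      also have "\<dots> \<le> inner (W x) x * inner (W (W x)) (W x)"
        by (rule psd_Cauchy_Schwarz[OF W.linear symW subspace_UNIV]) (auto simp: psd)
      also have "inner (W (W x)) (W x) \<le> B * (norm (W x))\<^sup>2"
        using order_trans[OF norm_cauchy_schwarz mult_right_mono[OF B(2)[of "W x"] norm_ge_zero]]
        by (simp add: power2_eq_square mult_ac)
      finally have "(norm (W x))\<^sup>2 * (norm (W x))\<^sup>2 \<le> (B * inner (W x) x) * (norm (W x))\<^sup>2"
        using mult_left_mono[OF _ psd[of x]] by (fastforce simp: power2_eq_square mult_ac)
      then show ?thesis using False by (simp only: mult_le_cancel_right) simp
    qed (use psd B in auto)
    moreover have "(c * norm x)\<^sup>2 \<le> (norm (W x))\<^sup>2" using c by (intro power_mono) auto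
    ultimately have "c\<^sup>2 * (norm x)\<^sup>2 \<le> B * ((norm (U x))\<^sup>2 - m\<^sup>2 * (norm x)\<^sup>2)"
      by (simp add: Wx power_mult_distrib)
    then show ?thesis using B(1) by (simp add: field_simps)
  qed
  have pos: "0 < c\<^sup>2 / B" using c B by simp
  have "m < sqrt (m\<^sup>2 + c\<^sup>2 / B)" using m(1) pos by (intro real_less_rsqrt) simp
  moreover have "sqrt (m\<^sup>2 + c\<^sup>2 / B) * norm x \<le> norm (U x)" for x
  proof (rule power2_le_imp_le)
    show "(sqrt (m\<^sup>2 + c\<^sup>2 / B) * norm x)\<^sup>2 \<le> (norm (U x))\<^sup>2"
      using main[of x] pos by (simp add: power_mult_distrib)
  qed simp
  ultimately show ?thesis by blast
qed

text \<open>By \<open>sharp\<close>, \<open>N\<close> is the norm of \<open>A\<close> on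
  \<open>K\<close>. If both \<open>A - N\<close> and \<open>A + N\<close> were bounded below on
  \<open>K\<close>, so would be their product \<open>A A - N\<^sup>2\<close>; expanding its squared
  norm and using \<open>norm (A (A x)) \<le> N * norm (A x)\<close> yields a bound for
  \<open>A\<close> on \<open>K\<close> strictly below \<open>N\<close>.\<close>

lemma norm_is_spectral:
  fixes A :: "'a::real_inner \<Rightarrow> 'a"
  assumes A: "linear A" and sym: "\<And>x y. inner (A x) y = inner x (A y)"
    and K: "subspace K" "\<And>x. x \<in> K \<Longrightarrow> A x \<in> K"
    and N: "0 < N" "\<And>x. x \<in> K \<Longrightarrow> norm (A x) \<le> N * norm x"
    and sharp: "\<And>N'. N' < N \<Longrightarrow> \<exists>x\<in>K. N' * norm x < norm (A x)"
  shows "\<not> bounded_below K (\<lambda>x. A x - N *\<^sub>R x) \<or> \<not> bounded_below K (\<lambda>x. A x - (- N) *\<^sub>R x)"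
proof (rule ccontr)
  assume "\<not> ?thesis"
  then have bb: "bounded_below K (\<lambda>x. A x - N *\<^sub>R x)" "bounded_below K (\<lambda>x. A x + N *\<^sub>R x)" by auto
  have "A x + N *\<^sub>R x \<in> K" if "x \<in> K" for x
    using K that by (intro subspace_add subspace_scale) auto
  from bounded_below_comp[OF bb this] obtain c where c: "c > 0"
    "\<And>x. x \<in> K \<Longrightarrow> c * norm x \<le> norm (A (A x + N *\<^sub>R x) - N *\<^sub>R (A x + N *\<^sub>R x))"
    unfolding bounded_below_def by blast
  have c2: "c * norm x \<le> norm (A (A x) - N\<^sup>2 *\<^sub>R x)" if "x \<in> K" for x
    using c(2)[OF that] by (simp add: linear_add[OF A] linear_scale[OF A] algebra_simps power2_eq_square)
  have main: "(norm (A x))\<^sup>2 \<le> (N\<^sup>2 - c\<^sup>2 / N\<^sup>2) * (norm x)\<^sup>2" if x: "x \<in> K" for x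
  proof -
    have "(c * norm x)\<^sup>2 \<le> (norm (A (A x) - N\<^sup>2 *\<^sub>R x))\<^sup>2"
      using c(1) c2[OF x] by (intro power_mono) auto
    also have "\<dots> = (norm (A (A x)))\<^sup>2 - 2 * N\<^sup>2 * (norm (A x))\<^sup>2 + (N\<^sup>2)\<^sup>2 * (norm x)\<^sup>2"
      unfolding power2_norm_eq_inner
      by (simp add: inner_diff_left inner_diff_right sym inner_commute algebra_simps power2_eq_square)
    also have "(norm (A (A x)))\<^sup>2 \<le> (N * norm (A x))\<^sup>2"
      using N(2)[OF K(2)[OF x]] by (intro power_mono) auto
    finally have "c\<^sup>2 * (norm x)\<^sup>2 + N\<^sup>2 * (norm (A x))\<^sup>2 \<le> (N\<^sup>2)\<^sup>2 * (norm x)\<^sup>2"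
      by (simp add: power_mult_distrib)
    then show ?thesis using N(1) by (simp add: field_simps power2_eq_square)
  qed
  \<comment> \<open>The sign of the difference is not known, and the square root must be nonnegative
    for the comparison of squares; hence \<open>max 0\<close>.\<close>
  define N' where "N' = sqrt (max 0 (N\<^sup>2 - c\<^sup>2 / N\<^sup>2))"
  have "N' < N" unfolding N'_def
    using N(1) c(1) by (intro real_less_lsqrt) auto
  from sharp[OF this] obtain x where x: "x \<in> K" "N' * norm x < norm (A x)" by blast
  have "(norm (A x))\<^sup>2 \<le> (N' * norm x)\<^sup>2"
    using order_trans[OF main[OF x(1)] mult_right_mono[of "N\<^sup>2 - c\<^sup>2 / N\<^sup>2" "max 0 (N\<^sup>2 - c\<^sup>2 / N\<^sup>2)"]]
    by (simp add: N'_def power_mult_distrib)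
  then have "norm (A x) \<le> N' * norm x" by (rule power2_le_imp_le) (simp add: N'_def)
  with x show False by simp
qed

text \<open>With 0 the only possible spectral value of \<open>T\<close> in \<open>(-r, r)\<close>,
  the square \<open>S = T T\<close> has the spectral gap \<open>(0, r\<^sup>2)\<close>. The gap
  gives \<open>r * norm z \<le> norm (T z)\<close> on the range of \<open>S\<close>, then on its
  closure, and the closure contains every vector orthogonal to the kernel of
  \<open>T\<close>.\<close>

lemma bounded_below_off_kernel:
  fixes T :: "'a::{real_inner, complete_space} \<Rightarrow> 'a"
  assumes T: "bounded_linear T" and sym: "\<And>x y. inner (T x) y = inner x (T y)"
    and r: "0 < r" and isol: "\<And>s. 0 < \<bar>s\<bar> \<Longrightarrow> \<bar>s\<bar> < r \<Longrightarrow> bounded_below UNIV (\<lambda>x. T x - s *\<^sub>R x)"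
  shows "bounded_below {x. \<forall>e. T e = 0 \<longrightarrow> inner x e = 0} T"
proof -
  interpret T: bounded_linear T by (rule T)
  define S where "S x = T (T x)" for x
  have S: "bounded_linear S" unfolding S_def by (intro bounded_linear_compose[OF T T])
  interpret S: bounded_linear S by (rule S)
  have symS: "inner (S x) y = inner x (S y)" for x y by (simp add: S_def sym)
  have Sx: "inner (S x) x = (norm (T x))\<^sup>2" for x by (simp add: S_def sym power2_norm_eq_inner)
  have Sbb: "bounded_below UNIV (\<lambda>x. S x - a *\<^sub>R x)" if a: "0 < a" "a < r\<^sup>2" for a
  proof -
    have s: "0 < sqrt a" "sqrt a < r"
      using a r real_sqrt_less_iff[of a "r\<^sup>2"] by (auto simp del: real_sqrt_less_iff)
    have "(\<lambda>x. T (T x - (- sqrt a) *\<^sub>R x) - sqrt a *\<^sub>R (T x - (- sqrt a) *\<^sub>R x)) = (\<lambda>x. S x - a *\<^sub>R x)"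
      using a by (auto simp: S_def T.add T.diff T.scaleR algebra_simps)
    with bounded_below_comp[OF isol[of "sqrt a"] isol[of "- sqrt a"]] s show ?thesis by simp
  qed
  \<comment> \<open>The midpoint of the gap: \<open>U = S - \<sigma>\<close> has no spectrum in
    \<open>(-\<sigma>, \<sigma>)\<close>, which is to give the lower bound \<open>\<sigma>\<close>
    for \<open>U\<close>.\<close>
  define \<sigma> where "\<sigma> = r\<^sup>2 / 2"
  have s0: "0 < \<sigma>" using r by (simp add: \<sigma>_def)
  define U where "U x = S x - \<sigma> *\<^sub>R x" for x
  have U: "bounded_linear U"
    unfolding U_def by (intro bounded_linear_sub bounded_linear_scaleR_right S)
  have symU: "inner (U x) y = inner x (U y)" for x y
    by (simp add: U_def inner_diff_left inner_diff_right symS)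
  have U_ge: "\<sigma> * norm x \<le> norm (U x)" for x
  proof -
    \<comment> \<open>Supremum argument: if the best lower bound \<open>m\<close> were below
      \<open>\<sigma>\<close>, then \<open>m\<close> and \<open>-m\<close> would both be off the
      spectrum of \<open>U\<close> and \<open>m\<close> could be improved. The cap at
      \<open>\<sigma>\<close> keeps \<open>P\<close> bounded even on the zero space.\<close>
    define P where "P = {m. 0 \<le> m \<and> m \<le> \<sigma> \<and> (\<forall>x. m * norm x \<le> norm (U x))}"
    define m where "m = Sup P"
    have P0: "0 \<in> P" using s0 by (simp add: P_def)
    have bdd: "bdd_above P" by (rule bdd_aboveI[of _ \<sigma>]) (simp add: P_def)
    have m0: "0 \<le> m" unfolding m_def using P0 bdd by (rule cSup_upper)
    have ms: "m \<le> \<sigma>" unfolding m_def using P0 by (intro cSup_least) (auto simp: P_def)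
    have mU: "m * norm x \<le> norm (U x)" for x
    proof (cases "x = 0")
      case False
      then have "m \<le> norm (U x) / norm x"
        unfolding m_def using P0 by (intro cSup_least) (auto simp: P_def field_simps)
      then show ?thesis using False by (simp add: field_simps)
    qed simp
    have "m = \<sigma>"
    proof (rule ccontr)
      assume "m \<noteq> \<sigma>"
      then have lt: "m < \<sigma>" using ms by simp
      have "bounded_below UNIV (\<lambda>x. U x - m *\<^sub>R x)"
        using Sbb[of "\<sigma> + m"] m0 lt s0 by (simp add: U_def \<sigma>_def algebra_simps)
      moreover have "bounded_below UNIV (\<lambda>x. U x + m *\<^sub>R x)"
        using Sbb[of "\<sigma> - m"] m0 lt s0 by (simp add: U_def \<sigma>_def algebra_simps)
      ultimately obtain m' where m': "m' > m" "\<And>x. m' * norm x \<le> norm (U x)"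
        using lower_bound_improves[OF U symU m0 mU] by blast
      have "min m' \<sigma> * norm x \<le> norm (U x)" for x
        using m'(2)[of x] mult_right_mono[of "min m' \<sigma>" m' "norm x"] by simp
      then have "min m' \<sigma> \<in> P" using m0 m' lt by (auto simp: P_def)
      then have "min m' \<sigma> \<le> m" unfolding m_def using bdd by (rule cSup_upper)
      then show False using m' lt by simp
    qed
    with mU show ?thesis by simp
  qed
  \<comment> \<open>Expansion of the square of
    \<open>\<sigma> * norm x \<le> norm (S x - \<sigma> x)\<close>; the terms in
    \<open>norm x\<close> cancel.\<close>
  have gap: "2 * \<sigma> * inner (S x) x \<le> (norm (S x))\<^sup>2" for x
  proof -
    have "(\<sigma> * norm x)\<^sup>2 \<le> (norm (U x))\<^sup>2" using U_ge s0 by (intro power_mono) auto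
    then show ?thesis unfolding U_def power2_norm_eq_inner power_mult_distrib
      by (simp add: inner_diff_left inner_diff_right inner_commute algebra_simps power2_eq_square)
  qed
  \<comment> \<open>Cauchy-Schwarz for the form of \<open>S\<close> at \<open>x\<close> and
    \<open>S x\<close>, where \<open>inner (S x) x\<close> is the squared norm of
    \<open>T x\<close>; \<open>gap\<close> with \<open>2 \<sigma> = r\<^sup>2\<close> then bounds
    that form by \<open>norm (S x)\<close> squared.\<close>
  have ran: "r\<^sup>2 * (norm (S x))\<^sup>2 \<le> (norm (T (S x)))\<^sup>2" for x
  proof (cases "S x = 0")
    case False
    have "((norm (S x))\<^sup>2)\<^sup>2 = (inner (S x) (S x))\<^sup>2" by (simp add: power2_norm_eq_inner)
    also have "\<dots> \<le> inner (S x) x * inner (S (S x)) (S x)"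
      by (rule psd_Cauchy_Schwarz[OF S.linear symS subspace_UNIV]) (auto simp: Sx)
    finally have "r\<^sup>2 * ((norm (S x))\<^sup>2)\<^sup>2 \<le> (2 * \<sigma> * inner (S x) x) * (norm (T (S x)))\<^sup>2"
      using mult_left_mono[of "((norm (S x))\<^sup>2)\<^sup>2" "inner (S x) x * inner (S (S x)) (S x)" "r\<^sup>2"]
      by (simp add: Sx \<sigma>_def mult_ac)
    also have "\<dots> \<le> (norm (S x))\<^sup>2 * (norm (T (S x)))\<^sup>2"
      by (intro mult_right_mono gap) simp
    finally have "(norm (S x))\<^sup>2 * (r\<^sup>2 * (norm (S x))\<^sup>2) \<le> (norm (S x))\<^sup>2 * (norm (T (S x)))\<^sup>2"
      by (simp add: power2_eq_square mult_ac)
    then show ?thesis using False by simp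
  qed (simp add: T.zero)
  have ran': "r * norm z \<le> norm (T z)" if "z \<in> closure (range S)" for z
  proof -
    have "closed {z. r * norm z \<le> norm (T z)}"
      by (intro closed_Collect_le continuous_intros T.continuous_on)
    moreover have "range S \<subseteq> {z. r * norm z \<le> norm (T z)}"
    proof clarsimp
      fix x
      have "(r * norm (S x))\<^sup>2 \<le> (norm (T (S x)))\<^sup>2" using ran[of x] by (simp add: power_mult_distrib)
      then show "r * norm (S x) \<le> norm (T (S x))" by (rule power2_le_imp_le) simp
    qed
    ultimately show ?thesis using that closure_minimal by blast
  qed
  \<comment> \<open>Project \<open>x\<close> to \<open>y\<close> in the closure. The remainder
    \<open>x - y\<close> is orthogonal to \<open>S (x - y)\<close>, so it lies in the kernel of
    \<open>T\<close>, to which \<open>x\<close> is orthogonal; hence it is orthogonal to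
    itself.\<close>
  have "x \<in> closure (range S)" if x: "\<forall>e. T e = 0 \<longrightarrow> inner x e = 0" for x
  proof -
    have sub: "subspace (closure (range S))"
      by (intro closure_of_subspace linear_subspace_image[OF S.linear] subspace_UNIV)
    obtain y where y: "y \<in> closure (range S)" "\<And>z. z \<in> closure (range S) \<Longrightarrow> inner (x - y) z = 0"
      using closed_subspace_projection[OF sub closed_closure] by blast
    have "inner (x - y) (S (x - y)) = 0"
      by (intro y(2) closure_subset[THEN subsetD]) simp
    then have T0: "T (x - y) = 0" using Sx[of "x - y"] by (simp add: inner_commute)
    have "inner (x - y) x = 0" using x T0 by (metis inner_commute)
    moreover have "inner (x - y) y = 0" using y by blast
    ultimately have "inner (x - y) (x - y) = 0" by (simp add: inner_diff_right)
    then show ?thesis using y by simp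
  qed
  with ran' r show ?thesis unfolding bounded_below_def by blast
qed

text \<open>Each condition \<open>inner v b = 0\<close> lowers the dimension by at most one: one
  vector \<open>v0\<close> violating it, added to a finite spanning set of the hyperplane section,
  spans all of \<open>V\<close>. Finitely many conditions thus leave an infinite-dimensional
  space.\<close>

lemma infinite_dim_orthogonal_vector:
  fixes V :: "'a::real_inner set"
  assumes "finite B" "subspace V" "\<And>F. finite F \<Longrightarrow> \<not> V \<subseteq> span F"
  shows "\<exists>v\<in>V. v \<noteq> 0 \<and> (\<forall>b\<in>B. inner v b = 0)"
  using assms
proof (induction B arbitrary: V rule: finite_induct)
  case empty
  then show ?case using empty.prems(2)[of "{}"] subspace_0 by fastforce
next
  case (insert b B)
  define W where "W = {v \<in> V. inner v b = 0}"
  have W: "subspace W"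
    using insert.prems(1) by (auto simp: subspace_def W_def inner_add_left)
  have "\<not> W \<subseteq> span F" if F: "finite F" for F
  proof
    assume WF: "W \<subseteq> span F"
    show False
    proof (cases "\<exists>v0\<in>V. inner v0 b \<noteq> 0")
      case True
      then obtain v0 where v0: "v0 \<in> V" "inner v0 b \<noteq> 0" by blast
      have "v \<in> span (insert v0 F)" if v: "v \<in> V" for v
      proof -
        define k where "k = inner v b / inner v0 b"
        have "v - k *\<^sub>R v0 \<in> W"
          using v v0 insert.prems(1)
          by (auto simp: W_def inner_diff_left k_def intro!: subspace_diff subspace_scale)
        then show ?thesis using WF by (auto simp: span_insert)
      qed
      then show False using insert.prems(2)[of "insert v0 F"] F by blast
    next
      case False
      then have "V = W" by (auto simp: W_def)
      then show False using WF insert.prems(2) F by blast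
    qed
  qed
  from insert.IH[OF W this] obtain v where "v \<in> W" "v \<noteq> 0" "\<forall>b\<in>B. inner v b = 0" by blast
  then show ?case by (auto simp: W_def)
qed

text \<open>A Weyl-type criterion: \<open>A\<close> is bounded below on the infinite-dimensional
  span of the \<open>h k\<close>, although only finitely many directions are associated with
  spectral values of modulus at least \<open>\<delta>\<close>. Removing these directions still
  leaves a vector that \<open>A\<close> does not contract below \<open>\<delta>\<close>, which would
  need a further spectral value.\<close>

theorem no_singular_sequence:
  fixes A :: "'a::{real_inner, complete_space} \<Rightarrow> 'a" and h :: "nat \<Rightarrow> 'a"
  assumes A: "bounded_linear A" and sym: "\<And>x y. inner (A x) y = inner x (A y)"
    and isol: "\<And>t. t \<noteq> 0 \<Longrightarrow> \<exists>r>0. \<forall>s. 0 < \<bar>s - t\<bar> \<and> \<bar>s - t\<bar> < r \<longrightarrow> bounded_below UNIV (\<lambda>x. A x - s *\<^sub>R x)"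
    and fin: "\<And>t. t \<noteq> 0 \<Longrightarrow> \<exists>F. finite F \<and> {x. A x = t *\<^sub>R x} \<subseteq> span F"
    and d: "0 < \<delta>" "\<And>k. \<delta> * norm (h k) \<le> norm (A (h k))" and h: "\<And>k. h k \<noteq> 0"
    and orth: "\<And>j k. j \<noteq> k \<Longrightarrow> inner (h j) (h k) = 0" "\<And>j k. j \<noteq> k \<Longrightarrow> inner (A (h j)) (A (h k)) = 0"
  shows False
proof -
  interpret A: bounded_linear A by (rule A)
  obtain B where B: "B > 0" "\<And>x. norm (A x) \<le> norm x * B" using A.pos_bounded by blast
  define V where "V = span (range h)"
  have inj: "inj h"
  proof (rule injI, rule ccontr)
    fix j k assume "h j = h k" "j \<noteq> k"
    then show False using orth(1)[of j k] h[of k] by simp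
  qed
  have Vinf: "\<not> V \<subseteq> span F" if F: "finite F" for F
  proof
    assume "V \<subseteq> span F"
    then have "range h \<subseteq> span F" using span_superset[of "range h"] unfolding V_def by blast
    moreover have "independent (range h)"
    proof (rule pairwise_orthogonal_independent)
      show "pairwise orthogonal (range h)"
        unfolding pairwise_def orthogonal_def using orth(1) by (metis rangeE)
    qed (use h in auto)
    ultimately have "finite (range h)" using independent_span_bound[OF F] by blast
    then show False using inj finite_imageD by blast
  qed
  have orth': "inner a b = 0" "inner (A a) (A b) = 0" if "a \<in> range h" "b \<in> range h" "a \<noteq> b" for a b
    using that orth by (metis rangeE)+
  \<comment> \<open>The estimate passes from the single \<open>h k\<close> to linear combinations
    because both \<open>h\<close> and its image under \<open>A\<close> are orthogonal families:
    Pythagoras applies to \<open>v\<close> and to \<open>A v\<close>.\<close>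
  have VA: "\<delta> * norm v \<le> norm (A v)" if v: "v \<in> V" for v
  proof -
    obtain t u where t: "finite t" "t \<subseteq> range h" and v_eq: "v = (\<Sum>a\<in>t. u a *\<^sub>R a)"
      using v unfolding V_def span_explicit by blast
    have pyth: "(norm (\<Sum>a\<in>t. f a))\<^sup>2 = (\<Sum>a\<in>t. (norm (f a))\<^sup>2)"
      if "\<And>a b. a \<in> t \<Longrightarrow> b \<in> t \<Longrightarrow> a \<noteq> b \<Longrightarrow> inner (f a) (f b) = 0" for f :: "'a \<Rightarrow> 'a"
      using t(1) that by (intro norm_sum_Pythagorean) (auto simp: pairwise_def orthogonal_def)
    have "(\<delta> * norm v)\<^sup>2 = (\<Sum>a\<in>t. (\<delta> * norm (u a *\<^sub>R a))\<^sup>2)"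
      unfolding v_eq power_mult_distrib sum_distrib_left[symmetric]
      by (subst pyth) (use subsetD[OF t(2)] in \<open>auto simp: orth'\<close>)
    also have "\<dots> \<le> (\<Sum>a\<in>t. (norm (u a *\<^sub>R A a))\<^sup>2)"
    proof (intro sum_mono power_mono)
      fix a assume "a \<in> t"
      then obtain k where "a = h k" using t(2) by blast
      then show "\<delta> * norm (u a *\<^sub>R a) \<le> norm (u a *\<^sub>R A a)"
        using mult_left_mono[OF d(2)[of k], of "\<bar>u a\<bar>"] by (simp add: mult_ac)
    qed (use d in simp)
    also have "\<dots> = (norm (A v))\<^sup>2"
      unfolding v_eq A.sum A.scaleR by (subst pyth) (use subsetD[OF t(2)] in \<open>auto simp: orth'\<close>)
    finally show ?thesis by (rule power2_le_imp_le) simp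
  qed
  \<comment> \<open>The real spectrum of \<open>A\<close> outside
    \<open>(-\<delta>, \<delta>)\<close>.\<close>
  define Z where "Z = {t. \<delta> \<le> \<bar>t\<bar> \<and> \<not> bounded_below UNIV (\<lambda>x. A x - t *\<^sub>R x)}"
  have Zb: "\<bar>t\<bar> \<le> B" if "t \<in> Z" for t
  proof (rule ccontr)
    assume c: "\<not> \<bar>t\<bar> \<le> B"
    have "(\<bar>t\<bar> - B) * norm x \<le> norm (A x - t *\<^sub>R x)" for x
      using B(2)[of x] norm_triangle_ineq2[of "t *\<^sub>R x" "A x"]
      by (simp add: algebra_simps norm_minus_commute)
    then have "bounded_below UNIV (\<lambda>x. A x - t *\<^sub>R x)"
      using c unfolding bounded_below_def by (intro exI[of _ "\<bar>t\<bar> - B"]) auto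
    with that show False by (simp add: Z_def)
  qed
  \<comment> \<open>A limit point of the bounded set \<open>Z\<close> would have modulus at least
    \<open>\<delta>\<close>, hence be nonzero, and contradict \<open>isol\<close> there.\<close>
  have "finite Z"
  proof (rule ccontr)
    assume "infinite Z"
    moreover have "bounded Z" using Zb by (auto simp: bounded_iff)
    ultimately obtain t where t: "t islimpt Z" using bounded_infinite_imp_islimpt[of Z Z] by blast
    have cl: "closed {t::real. \<delta> \<le> \<bar>t\<bar>}" by (intro closed_Collect_le continuous_intros)
    have "t islimpt {t. \<delta> \<le> \<bar>t\<bar>}" by (rule islimpt_subset[OF t]) (auto simp: Z_def)
    then have "\<delta> \<le> \<bar>t\<bar>" using cl by (auto simp: closed_limpt)
    then obtain r where r: "r > 0" "\<And>s. 0 < \<bar>s - t\<bar> \<Longrightarrow> \<bar>s - t\<bar> < r \<Longrightarrow> bounded_below UNIV (\<lambda>x. A x - s *\<^sub>R x)"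
      using isol[of t] d(1) by (metis abs_zero not_le)
    obtain s where "s \<in> Z" "s \<noteq> t" "dist s t < r"
      using t r(1) unfolding islimpt_approachable by blast
    with r(2)[of s] show False by (auto simp: Z_def dist_real_def)
  qed
  \<comment> \<open>The orthogonal complement of all eigenspaces for values in \<open>Z\<close>; it
    is invariant under \<open>A\<close> by symmetry.\<close>
  define K where "K = {x. \<forall>t\<in>Z. \<forall>e. A e = t *\<^sub>R e \<longrightarrow> inner x e = 0}"
  have K: "subspace K" by (auto simp: subspace_def K_def inner_add_left)
  have AK: "A x \<in> K" if "x \<in> K" for x using that by (auto simp: K_def sym)
  have "\<exists>F. \<forall>t\<in>Z. finite (F t) \<and> {x. A x = t *\<^sub>R x} \<subseteq> span (F t)"
    using fin d(1) by (intro bchoice ballI) (auto simp: Z_def)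
  then obtain F where F: "\<And>t. t \<in> Z \<Longrightarrow> finite (F t)" "\<And>t. t \<in> Z \<Longrightarrow> {x. A x = t *\<^sub>R x} \<subseteq> span (F t)"
    by blast
  have "finite (\<Union>t\<in>Z. F t)" using \<open>finite Z\<close> F by blast
  moreover have "subspace V" by (simp add: V_def)
  ultimately obtain v where v: "v \<in> V" "v \<noteq> 0" "\<forall>b\<in>(\<Union>t\<in>Z. F t). inner v b = 0"
    using infinite_dim_orthogonal_vector[OF _ _ Vinf] by metis
  have vK: "v \<in> K"
  proof -
    have "inner v e = 0" if "t \<in> Z" "A e = t *\<^sub>R e" for t e
    proof -
      have "e \<in> span (F t)" using F(2) that by blast
      then show ?thesis
        by (rule span_induct_alt) (use v(3) that in \<open>auto simp: inner_add_right\<close>)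
    qed
    then show ?thesis by (auto simp: K_def)
  qed
  define R where "R = {norm (A x) / norm x | x. x \<in> K \<and> x \<noteq> 0}"
  \<comment> \<open>The norm of \<open>A\<close> on \<open>K\<close>. It is at least
    \<open>\<delta>\<close> because \<open>v\<close> lies both in \<open>V\<close> and in
    \<open>K\<close>.\<close>
  define N where "N = Sup R"
  have Rne: "norm (A v) / norm v \<in> R" using vK v by (auto simp: R_def)
  have Rbdd: "bdd_above R"
    by (rule bdd_aboveI[of _ B]) (use B in \<open>auto simp: R_def field_simps\<close>)
  have "\<delta> \<le> norm (A v) / norm v" using VA[OF v(1)] v(2) by (simp add: field_simps)
  also have "\<dots> \<le> N" unfolding N_def using Rne Rbdd by (rule cSup_upper)
  finally have dN: "\<delta> \<le> N" .
  have upper: "norm (A x) \<le> N * norm x" if "x \<in> K" for x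
  proof (cases "x = 0")
    case False
    then have "norm (A x) / norm x \<le> N"
      unfolding N_def using that Rbdd by (intro cSup_upper) (auto simp: R_def)
    then show ?thesis using False by (simp add: field_simps)
  qed (simp add: A.zero)
  have sharp: "\<exists>x\<in>K. N' * norm x < norm (A x)" if "N' < N" for N'
  proof -
    obtain y where "y \<in> R" "N' < y" using less_cSupD[of R N'] Rne \<open>N' < N\<close> unfolding N_def by blast
    then show ?thesis by (auto simp: R_def field_simps)
  qed
  have "0 < N" using d(1) dN by simp
  \<comment> \<open>\<open>t\<close> is \<open>N\<close> or \<open>-N\<close>. Being spectral on
    \<open>K\<close> it is spectral on the whole space, so \<open>t\<close> belongs to
    \<open>Z\<close> and its eigenvectors are orthogonal to \<open>K\<close>.\<close>
  then obtain t where t: "\<bar>t\<bar> = N" "\<not> bounded_below K (\<lambda>x. A x - t *\<^sub>R x)"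
    using norm_is_spectral[OF A.linear sym K AK _ upper sharp] by (metis abs_minus_cancel abs_of_pos)
  have "t \<in> Z" using t dN by (auto simp: Z_def bounded_below_def)
  define T where "T x = A x - t *\<^sub>R x" for x
  have T: "bounded_linear T"
    unfolding T_def by (intro bounded_linear_sub bounded_linear_scaleR_right A)
  have symT: "inner (T x) y = inner x (T y)" for x y
    by (simp add: T_def inner_diff_left inner_diff_right sym)
  obtain r where r: "r > 0" "\<And>s. 0 < \<bar>s - t\<bar> \<Longrightarrow> \<bar>s - t\<bar> < r \<Longrightarrow> bounded_below UNIV (\<lambda>x. A x - s *\<^sub>R x)"
    using isol[of t] t(1) d(1) dN by fastforce
  have "bounded_below UNIV (\<lambda>x. T x - s *\<^sub>R x)" if "0 < \<bar>s\<bar>" "\<bar>s\<bar> < r" for s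
    using r(2)[of "t + s"] that by (simp add: T_def algebra_simps)
  from bounded_below_off_kernel[OF T symT r(1) this]
  have "bounded_below {x. \<forall>e. T e = 0 \<longrightarrow> inner x e = 0} T" .
  moreover have "K \<subseteq> {x. \<forall>e. T e = 0 \<longrightarrow> inner x e = 0}"
    using \<open>t \<in> Z\<close> by (auto simp: K_def T_def)
  ultimately have "bounded_below K T" unfolding bounded_below_def by blast
  with t(2) show False by (simp add: T_def[abs_def])
qed


section \<open>The Hilbert space of square integrable functions\<close>

lemma cmod_add_power2_le: "(cmod (z + w))\<^sup>2 \<le> 2 * (cmod z)\<^sup>2 + 2 * (cmod w)\<^sup>2"
proof -
  have "(cmod (z + w))\<^sup>2 \<le> (cmod z + cmod w)\<^sup>2"
    by (intro power_mono norm_triangle_ineq) simp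
  also have "\<dots> \<le> 2 * (cmod z)\<^sup>2 + 2 * (cmod w)\<^sup>2"
    using zero_le_power2[of "cmod z - cmod w"] by (simp add: power2_eq_square algebra_simps)
  finally show ?thesis .
qed

lemma L2_measurable: "f \<in> L2 I \<Longrightarrow> f \<in> borel_measurable (lebesgue_on I)"
  by (simp add: L2_def)

lemma L2_zero [simp]: "(\<lambda>_. 0) \<in> L2 I"
  by (simp add: L2_def)

lemma L2_scale: "f \<in> L2 I \<Longrightarrow> (\<lambda>x. c * f x) \<in> L2 I"
  by (auto simp: L2_def norm_mult power_mult_distrib)

lemma L2_add:
  assumes "f \<in> L2 I" "g \<in> L2 I" shows "(\<lambda>x. f x + g x) \<in> L2 I"
proof -
  have "integrable (lebesgue_on I) (\<lambda>x. (cmod (f x + g x))\<^sup>2)"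
  proof (rule Bochner_Integration.integrable_bound)
    show "integrable (lebesgue_on I) (\<lambda>x. 2 * (cmod (f x))\<^sup>2 + 2 * (cmod (g x))\<^sup>2)"
      using assms by (auto simp: L2_def)
    show "(\<lambda>x. (cmod (f x + g x))\<^sup>2) \<in> borel_measurable (lebesgue_on I)"
      using assms by (auto simp: L2_def)
  qed (auto intro!: AE_I2 simp: cmod_add_power2_le)
  then show ?thesis using assms by (auto simp: L2_def)
qed

lemma L2_diff: "f \<in> L2 I \<Longrightarrow> g \<in> L2 I \<Longrightarrow> (\<lambda>x. f x - g x) \<in> L2 I"
  using L2_add[of f I "\<lambda>x. (-1) * g x"] L2_scale[of g I "-1"] by simp

lemma L2_mult_measurable:
  assumes "f \<in> L2 I" "g \<in> L2 I" shows "(\<lambda>x. f x * cnj (g x)) \<in> borel_measurable (lebesgue_on I)"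
proof -
  have "(\<lambda>x. cnj (g x)) \<in> borel_measurable (lebesgue_on I)"
    using assms by (intro borel_measurable_continuous_on[of cnj] continuous_intros L2_measurable)
  then show ?thesis using L2_measurable[OF assms(1)] by simp
qed

lemma L2_integrable_mult:
  assumes "f \<in> L2 I" "g \<in> L2 I" shows "integrable (lebesgue_on I) (\<lambda>x. f x * cnj (g x))"
proof (rule Bochner_Integration.integrable_bound)
  show "integrable (lebesgue_on I) (\<lambda>x. (cmod (f x))\<^sup>2 + (cmod (g x))\<^sup>2)"
    using assms by (auto simp: L2_def)
  show "(\<lambda>x. f x * cnj (g x)) \<in> borel_measurable (lebesgue_on I)"
    by (rule L2_mult_measurable[OF assms])
  show "AE x in lebesgue_on I. norm (f x * cnj (g x)) \<le> norm ((cmod (f x))\<^sup>2 + (cmod (g x))\<^sup>2)"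
  proof (rule AE_I2)
    fix x
    have "cmod (f x) * cmod (g x) \<le> (cmod (f x))\<^sup>2 + (cmod (g x))\<^sup>2"
      using sum_squares_bound[of "cmod (f x)" "cmod (g x)"]
        mult_nonneg_nonneg[OF norm_ge_zero[of "f x"] norm_ge_zero[of "g x"]] by linarith
    then show "norm (f x * cnj (g x)) \<le> norm ((cmod (f x))\<^sup>2 + (cmod (g x))\<^sup>2)"
      by (simp add: norm_mult)
  qed
qed

lemma L2_inner_cong:
  assumes "f \<in> L2 I" "f' \<in> L2 I" "g \<in> L2 I" "g' \<in> L2 I" "ae_eq I f f'" "ae_eq I g g'"
  shows "L2_inner I f g = L2_inner I f' g'"
  unfolding L2_inner_def
  using assms by (intro integral_cong_AE L2_mult_measurable) (auto simp: ae_eq_def)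

lemma L2_inner_add_left:
  "f \<in> L2 I \<Longrightarrow> g \<in> L2 I \<Longrightarrow> h \<in> L2 I \<Longrightarrow> L2_inner I (\<lambda>x. f x + g x) h = L2_inner I f h + L2_inner I g h"
  unfolding L2_inner_def distrib_right
  by (intro Bochner_Integration.integral_add L2_integrable_mult)

lemma L2_inner_scale_left: "L2_inner I (\<lambda>x. c * f x) h = c * L2_inner I f h"
  unfolding L2_inner_def mult.assoc by simp

lemma L2_inner_commute: "L2_inner I f g = cnj (L2_inner I g f)"
  unfolding L2_inner_def by (subst Bochner_Integration.integral_cnj[symmetric]) (simp add: mult.commute)

lemma L2_inner_self: "L2_inner I f f = complex_of_real (LINT x|lebesgue_on I. (cmod (f x))\<^sup>2)"
  unfolding L2_inner_def complex_norm_square[symmetric] by (rule integral_complex_of_real)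

lemma ae_eq_refl [simp]: "ae_eq I f f"
  by (simp add: ae_eq_def)

lemma ae_eq_sym: "ae_eq I f g \<Longrightarrow> ae_eq I g f"
  unfolding ae_eq_def by (auto elim: AE_mp)

lemma ae_eq_trans: "ae_eq I f g \<Longrightarrow> ae_eq I g h \<Longrightarrow> ae_eq I f h"
  unfolding ae_eq_def by (auto elim: AE_mp)

text \<open>The real Hilbert space underlying \<open>L\<^sup>2(\<real>)\<close>: only the real part of the inner product is kept.\<close>

definition l2_rel :: "(real \<Rightarrow> complex) \<Rightarrow> (real \<Rightarrow> complex) \<Rightarrow> bool" where
  "l2_rel f g \<longleftrightarrow> f \<in> L2 UNIV \<and> g \<in> L2 UNIV \<and> ae_eq UNIV f g"

quotient_type l2 = "real \<Rightarrow> complex" / partial: l2_rel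
proof (rule part_equivpI)
  show "\<exists>f. l2_rel f f" by (rule exI[of _ "\<lambda>_. 0"]) (simp add: l2_rel_def)
  show "symp l2_rel" by (auto simp: symp_def l2_rel_def intro: ae_eq_sym)
  show "transp l2_rel" by (auto simp: transp_def l2_rel_def intro: ae_eq_trans)
qed

lemma l2_cases: obtains f where "x = abs_l2 f" "f \<in> L2 UNIV"
proof -
  have "l2_rel (rep_l2 x) (rep_l2 x)" by (metis Quotient_l2 Quotient_rep_reflp)
  moreover have "x = abs_l2 (rep_l2 x)" by (metis Quotient_l2 Quotient_abs_rep)
  ultimately show ?thesis using that unfolding l2_rel_def by blast
qed

lemma abs_l2_eq_iff: "f \<in> L2 UNIV \<Longrightarrow> g \<in> L2 UNIV \<Longrightarrow> abs_l2 f = abs_l2 g \<longleftrightarrow> ae_eq UNIV f g"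
  using Quotient_rel[OF Quotient_l2, of f g] by (auto simp: l2_rel_def)

instantiation l2 :: real_inner
begin

lift_definition zero_l2 :: l2 is "\<lambda>_. 0" by (simp add: l2_rel_def)

lift_definition plus_l2 :: "l2 \<Rightarrow> l2 \<Rightarrow> l2" is "\<lambda>f g x. f x + g x"
  by (auto simp: l2_rel_def ae_eq_def intro: L2_add elim: AE_mp)

lift_definition uminus_l2 :: "l2 \<Rightarrow> l2" is "\<lambda>f x. - f x"
  using L2_scale[of _ UNIV "-1"] by (auto simp: l2_rel_def ae_eq_def elim: AE_mp)

lift_definition minus_l2 :: "l2 \<Rightarrow> l2 \<Rightarrow> l2" is "\<lambda>f g x. f x - g x"
  by (auto simp: l2_rel_def ae_eq_def intro: L2_diff elim: AE_mp)

lift_definition scaleR_l2 :: "real \<Rightarrow> l2 \<Rightarrow> l2" is "\<lambda>c f x. complex_of_real c * f x"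
  by (auto simp: l2_rel_def ae_eq_def intro: L2_scale elim: AE_mp)

lift_definition inner_l2 :: "l2 \<Rightarrow> l2 \<Rightarrow> real" is "\<lambda>f g. Re (L2_inner UNIV f g)"
  unfolding l2_rel_def by (intro arg_cong[of _ _ Re] L2_inner_cong) blast+

definition norm_l2 :: "l2 \<Rightarrow> real" where "norm_l2 x = sqrt (inner x x)"
definition dist_l2 :: "l2 \<Rightarrow> l2 \<Rightarrow> real" where "dist_l2 x y = norm (x - y)"
definition sgn_l2 :: "l2 \<Rightarrow> l2" where "sgn_l2 x = inverse (norm x) *\<^sub>R x"
definition uniformity_l2 :: "(l2 \<times> l2) filter" where
  "uniformity_l2 = (INF e\<in>{0<..}. principal {(x, y). dist x y < e})"
definition open_l2 :: "l2 set \<Rightarrow> bool" where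
  "open_l2 U \<longleftrightarrow> (\<forall>x\<in>U. eventually (\<lambda>(x', y). x' = x \<longrightarrow> y \<in> U) uniformity)"

instance
proof
  fix x y z :: l2 and a b :: real and U :: "l2 set"
  show "x + y + z = x + (y + z)"
    by transfer (auto simp: l2_rel_def add.assoc intro: L2_add)
  show "x + y = y + x"
    by transfer (auto simp: l2_rel_def add.commute intro: L2_add)
  show "0 + x = x"
    by transfer (auto simp: l2_rel_def intro: L2_add)
  show "- x + x = 0"
    by transfer (auto simp: l2_rel_def intro: L2_add)
  show "x - y = x + - y"
    by transfer (auto simp: l2_rel_def intro: L2_diff)
  show "a *\<^sub>R (x + y) = a *\<^sub>R x + a *\<^sub>R y"
    by transfer (auto simp: l2_rel_def distrib_left intro: L2_scale L2_add)
  show "(a + b) *\<^sub>R x = a *\<^sub>R x + b *\<^sub>R x"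
    by transfer (auto simp: l2_rel_def distrib_right intro: L2_scale L2_add)
  show "a *\<^sub>R b *\<^sub>R x = (a * b) *\<^sub>R x"
    by transfer (auto simp: l2_rel_def mult.assoc intro: L2_scale)
  show "1 *\<^sub>R x = x"
    by transfer (auto simp: l2_rel_def intro: L2_scale)
  show "sgn x = inverse (norm x) *\<^sub>R x" by (rule sgn_l2_def)
  show "dist x y = norm (x - y)" by (rule dist_l2_def)
  show "uniformity = (INF e\<in>{0<..}. principal {(x :: l2, y). dist x y < e})" by (rule uniformity_l2_def)
  show "open U \<longleftrightarrow> (\<forall>x\<in>U. \<forall>\<^sub>F (x', y) in uniformity. x' = x \<longrightarrow> y \<in> U)" by (rule open_l2_def)
  show "inner x y = inner y x"
    by transfer (metis L2_inner_commute complex_cnj_cancel_iff cnj.sel(1))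
  show "inner (x + y) z = inner x z + inner y z"
    by transfer (simp add: l2_rel_def L2_inner_add_left)
  show "inner (a *\<^sub>R x) y = a * inner x y"
    by transfer (simp add: L2_inner_scale_left)
  show "0 \<le> inner x x"
    by transfer (simp add: L2_inner_self)
  show "inner x x = 0 \<longleftrightarrow> x = 0"
  proof transfer
    fix f assume f: "l2_rel f f"
    then have "Re (L2_inner UNIV f f) = 0 \<longleftrightarrow> (AE x in lebesgue_on UNIV. (cmod (f x))\<^sup>2 = 0)"
      unfolding L2_inner_self Re_complex_of_real
      by (intro integral_nonneg_eq_0_iff_AE) (auto simp: l2_rel_def L2_def)
    then show "Re (L2_inner UNIV f f) = 0 \<longleftrightarrow> l2_rel f (\<lambda>_. 0)"
      using f by (auto simp: l2_rel_def ae_eq_def)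
  qed
  show "norm x = sqrt (inner x x)" by (rule norm_l2_def)
qed

end

lemma abs_l2_add: "f \<in> L2 UNIV \<Longrightarrow> g \<in> L2 UNIV \<Longrightarrow> abs_l2 f + abs_l2 g = abs_l2 (\<lambda>x. f x + g x)"
  and abs_l2_diff: "f \<in> L2 UNIV \<Longrightarrow> g \<in> L2 UNIV \<Longrightarrow> abs_l2 f - abs_l2 g = abs_l2 (\<lambda>x. f x - g x)"
  and abs_l2_scaleR: "f \<in> L2 UNIV \<Longrightarrow> c *\<^sub>R abs_l2 f = abs_l2 (\<lambda>x. complex_of_real c * f x)"
  and inner_abs_l2: "f \<in> L2 UNIV \<Longrightarrow> g \<in> L2 UNIV \<Longrightarrow> inner (abs_l2 f) (abs_l2 g) = Re (L2_inner UNIV f g)"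
  by (simp_all add: plus_l2.abs_eq minus_l2.abs_eq scaleR_l2.abs_eq inner_l2.abs_eq l2_rel_def)

lemma norm_abs_l2: "f \<in> L2 UNIV \<Longrightarrow> norm (abs_l2 f) = L2_norm UNIV f"
  by (simp add: norm_eq_sqrt_inner inner_abs_l2 L2_inner_self L2_norm_def)

lemma nn_integral_abs_l2:
  "f \<in> L2 UNIV \<Longrightarrow> (\<integral>\<^sup>+x. ennreal ((cmod (f x))\<^sup>2) \<partial>lebesgue_on UNIV) = ennreal ((norm (abs_l2 f))\<^sup>2)"
  by (subst nn_integral_eq_integral) (auto simp: norm_abs_l2 L2_norm_def L2_def)

section \<open>Completeness of \<open>l2\<close>\<close>

lemma Cauchy_fast_subseq:
  fixes X :: "nat \<Rightarrow> 'a::metric_space"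
  assumes "Cauchy X"
  obtains r where "strict_mono r" "\<And>n. dist (X (r (Suc n))) (X (r n)) < (1 / 2) ^ n"
proof -
  have "\<exists>N. \<forall>m\<ge>N. \<forall>n\<ge>N. dist (X m) (X n) < (1 / 2) ^ k" for k
    using assms by (intro metric_CauchyD) auto
  then obtain N where N: "\<And>k m n. m \<ge> N k \<Longrightarrow> n \<ge> N k \<Longrightarrow> dist (X m) (X n) < (1 / 2) ^ k"
    by metis
  \<comment> \<open>The sum dominates \<open>N k\<close>, the summand \<open>k\<close> makes
    \<open>r\<close> strictly increasing.\<close>
  define r where "r k = k + (\<Sum>j\<le>k. N j)" for k
  have rN: "N k \<le> r k" for k
    unfolding r_def by (simp add: trans_le_add2 sum_nonneg_leq_bound member_le_sum)
  have mono: "r k < r (Suc k)" for k by (simp add: r_def)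
  show ?thesis
  proof
    show "strict_mono r" using mono by (simp add: strict_mono_Suc_iff)
    show "dist (X (r (Suc n))) (X (r n)) < (1 / 2) ^ n" for n
      using rN[of n] mono[of n] by (intro N) auto
  qed
qed

text \<open>The weight \<open>2 ^ n\<close> turns mere boundedness of the weighted squares into
  geometric decay of the increments with ratio \<open>1 / sqrt 2\<close>, so that the telescoping
  series converges absolutely.\<close>

lemma convergent_of_weighted_square_summable:
  fixes F :: "nat \<Rightarrow> complex"
  assumes "(\<Sum>n. ennreal (2 ^ n * (cmod (F (Suc n) - F n))\<^sup>2)) < \<infinity>"
  shows "convergent F"
proof -
  define D where "D n = F (Suc n) - F n" for n
  have "summable (\<lambda>n. 2 ^ n * (cmod (D n))\<^sup>2)"
    using assms by (intro summable_suminf_not_top) (auto simp: D_def)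
  then have "bounded (range (\<lambda>n. 2 ^ n * (cmod (D n))\<^sup>2))"
    using summable_LIMSEQ_zero convergent_imp_bounded by blast
  then obtain B where B: "\<And>n. 2 ^ n * (cmod (D n))\<^sup>2 \<le> B" "B > 0"
    unfolding bounded_pos by fastforce
  have "cmod (D n) \<le> sqrt B * (1 / sqrt 2) ^ n" for n
  proof (rule power2_le_imp_le)
    have "((1 / sqrt 2) ^ n)\<^sup>2 = ((1 / sqrt 2)\<^sup>2) ^ n"
      by (simp only: power_mult[symmetric] mult.commute)
    also have "\<dots> = 1 / 2 ^ n" by (simp add: power_divide)
    finally have "((1 / sqrt 2) ^ n)\<^sup>2 = 1 / 2 ^ n" .
    then show "(cmod (D n))\<^sup>2 \<le> (sqrt B * (1 / sqrt 2) ^ n)\<^sup>2"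
      using B(1)[of n] B(2) by (simp add: power_mult_distrib field_simps)
  qed (use B in auto)
  moreover have "summable (\<lambda>n. sqrt B * (1 / sqrt 2) ^ n)"
    by (intro summable_mult summable_geometric) simp
  ultimately have "summable D" by (intro summable_comparison_test'[of _ 0 D])
  then have "(\<lambda>n. F 0 + (\<Sum>k<n. D k)) \<longlonglongrightarrow> F 0 + suminf D"
    by (intro tendsto_intros summable_LIMSEQ)
  moreover have "F 0 + (\<Sum>k<n. D k) = F n" for n
    unfolding D_def by (subst sum_lessThan_telescope) simp
  ultimately show ?thesis by (auto simp: convergent_def)
qed

text \<open>Riesz-Fischer: a fast subsequence converges almost everywhere, and Fatou's lemma, with
  one index fixed, carries the Cauchy estimate over to the pointwise limit.\<close>

instance l2 :: complete_space
proof
  fix X :: "nat \<Rightarrow> l2" assume X: "Cauchy X"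
  obtain r where r: "strict_mono r" "\<And>n. dist (X (r (Suc n))) (X (r n)) < (1 / 2) ^ n"
    using Cauchy_fast_subseq[OF X] by blast
  have "\<exists>F. \<forall>n. X (r n) = abs_l2 (F n) \<and> F n \<in> L2 UNIV"
    by (intro choice allI) (metis l2_cases)
  then obtain F where F: "\<And>n. X (r n) = abs_l2 (F n)" "\<And>n. F n \<in> L2 UNIV" by blast
  let ?M = "lebesgue_on UNIV"
  have Fm [measurable]: "F n \<in> borel_measurable ?M" for n using F(2) L2_measurable by blast
  have diff: "(\<integral>\<^sup>+x. ennreal ((cmod (F m x - F n x))\<^sup>2) \<partial>?M) = ennreal ((dist (X (r m)) (X (r n)))\<^sup>2)" for m n
    using nn_integral_abs_l2[OF L2_diff[OF F(2) F(2)], of m n] by (simp add: F(1) abs_l2_diff F(2) dist_norm)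
  have "(\<integral>\<^sup>+x. (\<Sum>n. ennreal (2 ^ n * (cmod (F (Suc n) x - F n x))\<^sup>2)) \<partial>?M)
      = (\<Sum>n. \<integral>\<^sup>+x. ennreal (2 ^ n * (cmod (F (Suc n) x - F n x))\<^sup>2) \<partial>?M)"
    by (intro nn_integral_suminf) measurable
  \<comment> \<open>The squared distance is below \<open>(1 / 4) ^ n\<close>, so the weight
    \<open>2 ^ n\<close> still leaves \<open>(1 / 2) ^ n\<close>.\<close>
  also have "\<dots> \<le> (\<Sum>n. ennreal ((1 / 2) ^ n))"
  proof (intro suminf_le allI)
    fix n
    have "(\<integral>\<^sup>+x. ennreal (2 ^ n * (cmod (F (Suc n) x - F n x))\<^sup>2) \<partial>?M)
       = ennreal (2 ^ n) * ennreal ((dist (X (r (Suc n))) (X (r n)))\<^sup>2)"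
      unfolding diff[symmetric] by (subst nn_integral_cmult[symmetric]) (auto simp: ennreal_mult)
    also have "\<dots> \<le> ennreal (2 ^ n) * ennreal (((1 / 2) ^ n)\<^sup>2)"
      using r(2)[of n] by (intro mult_left_mono ennreal_leI power_mono) auto
    also have "\<dots> = ennreal ((1 / 2) ^ n)"
      by (simp add: power2_eq_square flip: ennreal_mult power_mult_distrib mult.assoc)
    finally show "(\<integral>\<^sup>+x. ennreal (2 ^ n * (cmod (F (Suc n) x - F n x))\<^sup>2) \<partial>?M) \<le> ennreal ((1 / 2) ^ n)" .
  qed auto
  also have "\<dots> < \<infinity>" by (subst suminf_ennreal2) (auto intro: summable_geometric)
  finally have "AE x in ?M. (\<Sum>n. ennreal (2 ^ n * (cmod (F (Suc n) x - F n x))\<^sup>2)) \<noteq> \<infinity>"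
    by (intro nn_integral_noteq_infinite) auto
  then have conv: "AE x in ?M. convergent (\<lambda>n. F n x)"
    by (rule AE_mp)
       (rule AE_I2, rule impI, rule convergent_of_weighted_square_summable, simp only: infinity_ennreal_def less_top)
  define f where "f = (\<lambda>x. lim (\<lambda>n. F n x))"
  have fm [measurable]: "f \<in> borel_measurable ?M"
    unfolding f_def by (rule borel_measurable_lim_metric) (rule Fm)
  have Fatou: "(\<integral>\<^sup>+x. ennreal ((cmod (f x - F m x))\<^sup>2) \<partial>?M)
      \<le> liminf (\<lambda>n. ennreal ((dist (X (r n)) (X (r m)))\<^sup>2))" for m
  proof -
    have "(\<integral>\<^sup>+x. ennreal ((cmod (f x - F m x))\<^sup>2) \<partial>?M)
        = (\<integral>\<^sup>+x. liminf (\<lambda>n. ennreal ((cmod (F n x - F m x))\<^sup>2)) \<partial>?M)"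
    proof (rule nn_integral_cong_AE, rule AE_mp[OF conv], rule AE_I2, rule impI)
      fix x assume "convergent (\<lambda>n. F n x)"
      then have "(\<lambda>n. F n x) \<longlonglongrightarrow> f x" by (simp add: f_def convergent_LIMSEQ_iff)
      then have "(\<lambda>n. ennreal ((cmod (F n x - F m x))\<^sup>2)) \<longlonglongrightarrow> ennreal ((cmod (f x - F m x))\<^sup>2)"
        by (intro tendsto_intros tendsto_ennrealI)
      then show "ennreal ((cmod (f x - F m x))\<^sup>2) = liminf (\<lambda>n. ennreal ((cmod (F n x - F m x))\<^sup>2))"
        by (rule lim_imp_Liminf[OF sequentially_bot, symmetric])
    qed
    also have "\<dots> \<le> liminf (\<lambda>n. \<integral>\<^sup>+x. ennreal ((cmod (F n x - F m x))\<^sup>2) \<partial>?M)"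
      by (intro nn_integral_liminf) measurable
    finally show ?thesis by (simp only: diff)
  qed
  have close: "\<exists>N. \<forall>m\<ge>N. (\<integral>\<^sup>+x. ennreal ((cmod (f x - F m x))\<^sup>2) \<partial>?M) \<le> ennreal (e\<^sup>2)" if e: "e > 0" for e
  proof -
    obtain N where N: "\<And>m n. m \<ge> N \<Longrightarrow> n \<ge> N \<Longrightarrow> dist (X m) (X n) < e"
      using metric_CauchyD[OF X e] by blast
    have rge: "n \<le> r n" for n by (rule strict_mono_imp_increasing[OF r(1)])
    have "(\<integral>\<^sup>+x. ennreal ((cmod (f x - F m x))\<^sup>2) \<partial>?M) \<le> ennreal (e\<^sup>2)" if "m \<ge> N" for m
    proof (rule order_trans[OF Fatou])
      have "eventually (\<lambda>n. ennreal ((dist (X (r n)) (X (r m)))\<^sup>2) \<le> ennreal (e\<^sup>2)) sequentially"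
      proof (rule eventually_sequentiallyI)
        fix n assume "N \<le> n"
        then have "dist (X (r n)) (X (r m)) \<le> e"
          using N[of "r n" "r m"] rge[of n] rge[of m] that by simp
        then show "ennreal ((dist (X (r n)) (X (r m)))\<^sup>2) \<le> ennreal (e\<^sup>2)"
          by (intro ennreal_leI power_mono) simp_all
      qed
      then show "liminf (\<lambda>n. ennreal ((dist (X (r n)) (X (r m)))\<^sup>2)) \<le> ennreal (e\<^sup>2)"
        by (rule Liminf_le[OF sequentially_bot])
    qed
    then show ?thesis by blast
  qed
  have fF: "(\<lambda>x. f x - F m x) \<in> L2 UNIV"
    if "(\<integral>\<^sup>+x. ennreal ((cmod (f x - F m x))\<^sup>2) \<partial>?M) \<le> ennreal (e\<^sup>2)" for m e
  proof -
    have "(\<integral>\<^sup>+x. ennreal ((cmod (f x - F m x))\<^sup>2) \<partial>?M) < \<infinity>"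
      using that by (rule le_less_trans) simp
    then show ?thesis unfolding L2_def by (auto simp: integrable_iff_bounded)
  qed
  obtain m where "(\<integral>\<^sup>+x. ennreal ((cmod (f x - F m x))\<^sup>2) \<partial>?M) \<le> ennreal (1\<^sup>2)"
    using close[OF zero_less_one] by blast
  from L2_add[OF fF[OF this] F(2)[of m]] have fL2: "f \<in> L2 UNIV" by simp
  have "(\<lambda>n. X (r n)) \<longlonglongrightarrow> abs_l2 f"
  proof (rule metric_LIMSEQ_I)
    fix e :: real assume e: "e > 0"
    obtain N where N: "\<And>m. m \<ge> N \<Longrightarrow> (\<integral>\<^sup>+x. ennreal ((cmod (f x - F m x))\<^sup>2) \<partial>?M) \<le> ennreal ((e/2)\<^sup>2)"
      using close[OF half_gt_zero[OF e]] by blast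
    have "dist (X (r m)) (abs_l2 f) < e" if "m \<ge> N" for m
    proof -
      have "ennreal ((norm (abs_l2 f - abs_l2 (F m)))\<^sup>2) \<le> ennreal ((e/2)\<^sup>2)"
        using N[OF that] nn_integral_abs_l2[OF L2_diff[OF fL2 F(2)[of m]]]
        by (simp add: abs_l2_diff fL2 F(2))
      then have "(norm (abs_l2 f - abs_l2 (F m)))\<^sup>2 \<le> (e/2)\<^sup>2"
        by (subst (asm) ennreal_le_iff) auto
      then have "norm (abs_l2 f - abs_l2 (F m)) \<le> e/2" by (rule power2_le_imp_le) (use e in simp)
      then show ?thesis using e by (simp add: F(1) dist_norm norm_minus_commute)
    qed
    then show "\<exists>N. \<forall>m\<ge>N. dist (X (r m)) (abs_l2 f) < e" by blast
  qed
  then have "(X \<circ> r) \<longlonglongrightarrow> abs_l2 f" by (simp add: o_def)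
  from Cauchy_converges_subseq[OF X r(1) this] show "convergent X" by (auto simp: convergent_def)
qed


section \<open>Resolvents of operators with discrete spectrum\<close>

text \<open>A type cannot depend on \<open>I\<close>; extension by zero embeds every
  \<open>L2 I\<close> isometrically into the one Hilbert space \<open>l2\<close>.\<close>

definition zero_ext :: "real set \<Rightarrow> (real \<Rightarrow> complex) \<Rightarrow> real \<Rightarrow> complex" where
  "zero_ext I f x = (if x \<in> I then f x else 0)"

lemma zero_ext_alt: "zero_ext I f = (\<lambda>x. indicator I x *\<^sub>R f x)"
  by (auto simp: zero_ext_def indicator_def)

lemma L2_zero_ext: "I \<in> sets lebesgue \<Longrightarrow> zero_ext I f \<in> L2 UNIV \<longleftrightarrow> f \<in> L2 I"
proof -
  assume I: "I \<in> sets lebesgue"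
  have "(\<lambda>x. (cmod (zero_ext I f x))\<^sup>2) = (\<lambda>x. indicator I x *\<^sub>R (cmod (f x))\<^sup>2)"
    by (auto simp: zero_ext_def indicator_def)
  then show ?thesis
    using I by (simp add: L2_def lebesgue_on_UNIV_eq integrable_restrict_space
        borel_measurable_restrict_space_iff zero_ext_alt)
qed

lemma L2_subset:
  assumes I: "I \<in> sets lebesgue" and f: "f \<in> L2 UNIV" shows "f \<in> L2 I"
proof -
  have "integrable lebesgue (\<lambda>x. indicator I x *\<^sub>R (cmod (f x))\<^sup>2)"
    using I f by (intro integrable_mult_indicator) (auto simp: L2_def lebesgue_on_UNIV_eq)
  moreover have "f \<in> borel_measurable (lebesgue_on I)"
    using f by (intro measurable_restrict_space1) (auto simp: L2_def lebesgue_on_UNIV_eq)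
  ultimately show ?thesis using I by (simp add: L2_def integrable_restrict_space)
qed

lemma L2_inner_zero_ext_left:
  "I \<in> sets lebesgue \<Longrightarrow> L2_inner UNIV (zero_ext I f) g = L2_inner I f g"
  unfolding L2_inner_def lebesgue_on_UNIV_eq
  by (subst integral_restrict_space) (auto simp: zero_ext_alt)

lemma L2_inner_zero_ext_right:
  "I \<in> sets lebesgue \<Longrightarrow> L2_inner UNIV f (zero_ext I g) = L2_inner I f g"
  by (subst (1 2) L2_inner_commute) (simp add: L2_inner_zero_ext_left)

lemma L2_inner_zero_ext_idem: "L2_inner I f (zero_ext I g) = L2_inner I f g"
  unfolding L2_inner_def
  by (intro Bochner_Integration.integral_cong) (auto simp: zero_ext_def)

lemma ae_eq_zero_ext:
  "I \<in> sets lebesgue \<Longrightarrow> ae_eq UNIV (zero_ext I f) (zero_ext I g) \<longleftrightarrow> ae_eq I f g"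
  by (auto simp: ae_eq_def lebesgue_on_UNIV_eq AE_restrict_space_iff zero_ext_def elim: AE_mp)

lemma ae_eq_subset: "I \<in> sets lebesgue \<Longrightarrow> ae_eq UNIV f g \<Longrightarrow> ae_eq I f g"
  by (auto simp: ae_eq_def lebesgue_on_UNIV_eq AE_restrict_space_iff elim: AE_mp)

lemma L2_norm_zero_ext: "I \<in> sets lebesgue \<Longrightarrow> L2_norm UNIV (zero_ext I f) = L2_norm I f"
proof -
  assume I: "I \<in> sets lebesgue"
  have "(\<lambda>x. (cmod (zero_ext I f x))\<^sup>2) = (\<lambda>x. indicator I x *\<^sub>R (cmod (f x))\<^sup>2)"
    by (auto simp: zero_ext_def indicator_def)
  then show ?thesis
    using I by (simp add: L2_norm_def lebesgue_on_UNIV_eq integral_restrict_space)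
qed

lemma L2_norm_subset_le:
  assumes I: "I \<in> sets lebesgue" and f: "f \<in> L2 UNIV" shows "L2_norm I f \<le> L2_norm UNIV f"
  unfolding L2_norm_def lebesgue_on_UNIV_eq
proof (rule real_sqrt_le_mono, subst integral_restrict_space)
  show "(LINT x|lebesgue. indicator I x *\<^sub>R (cmod (f x))\<^sup>2) \<le> (LINT x|lebesgue. (cmod (f x))\<^sup>2)"
    using I f
    by (intro integral_mono integrable_mult_indicator)
       (auto simp: L2_def lebesgue_on_UNIV_eq indicator_def)
qed (use I in auto)

lemma L2_norm_cong:
  assumes "f \<in> L2 I" "g \<in> L2 I" "ae_eq I f g" shows "L2_norm I f = L2_norm I g"
  unfolding L2_norm_def using assms
  by (intro arg_cong[of _ _ sqrt] integral_cong_AE) (auto simp: L2_def ae_eq_def)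

lemma L2_norm_nonneg: "0 \<le> L2_norm I f"
  by (simp add: L2_norm_def)

lemma L2_norm_scale: "L2_norm I (\<lambda>x. c * f x) = cmod c * L2_norm I f"
  unfolding L2_norm_def by (simp add: norm_mult power_mult_distrib real_sqrt_mult)

lemma L2_inner_diff_left:
  "f \<in> L2 I \<Longrightarrow> g \<in> L2 I \<Longrightarrow> h \<in> L2 I \<Longrightarrow> L2_inner I (\<lambda>x. f x - g x) h = L2_inner I f h - L2_inner I g h"
  unfolding L2_inner_def left_diff_distrib
  by (intro Bochner_Integration.integral_diff L2_integrable_mult)

lemma L2_inner_diff_right:
  assumes "f \<in> L2 I" "g \<in> L2 I" "h \<in> L2 I"
  shows "L2_inner I h (\<lambda>x. f x - g x) = L2_inner I h f - L2_inner I h g"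
  unfolding L2_inner_commute[of I h] L2_inner_diff_left[OF assms] by simp

lemma L2_inner_scale_right: "L2_inner I h (\<lambda>x. c * f x) = cnj c * L2_inner I h f"
  unfolding L2_inner_commute[of I h] L2_inner_scale_left by simp

text \<open>The functions \<open>E i\<close> in the definition of finite multiplicity need not be square integrable, so
  that they cannot themselves serve as the spanning set \<open>F\<close>.\<close>

lemma finite_dim_of_spanning_functions:
  fixes E :: "'i \<Rightarrow> real \<Rightarrow> complex"
  assumes "finite J" "subspace W"
    and "\<And>x. x \<in> W \<Longrightarrow> \<exists>a f. f \<in> L2 UNIV \<and> x = abs_l2 f \<and>
           ae_eq UNIV f (\<lambda>t. \<Sum>i\<in>J. complex_of_real (a i) * E i t)"
  shows "\<exists>F. finite F \<and> W \<subseteq> span F"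
  using assms
proof (induction J arbitrary: W rule: finite_induct)
  case empty
  have "x = 0" if "x \<in> W" for x
    using empty.prems(2)[OF that] by (auto simp: zero_l2.abs_eq abs_l2_eq_iff)
  then have "W \<subseteq> span {}" by auto
  then show ?case by blast
next
  case (insert j J)
  \<comment> \<open>A relation rather than a function: the \<open>E i\<close> may be linearly
    dependent, so \<open>x\<close> does not determine its coefficients.\<close>
  define rep where "rep K x a \<longleftrightarrow> (\<exists>f. f \<in> L2 UNIV \<and> x = abs_l2 f \<and>
           ae_eq UNIV f (\<lambda>t. \<Sum>i\<in>K. complex_of_real (a i) * E i t))" for K x and a :: "'i \<Rightarrow> real"
  have comb: "rep K (x + c *\<^sub>R y) (\<lambda>i. a i + c * b i)" if xy: "rep K x a" "rep K y b" for K x y a b c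
  proof -
    obtain f g where fg: "f \<in> L2 UNIV" "x = abs_l2 f" "g \<in> L2 UNIV" "y = abs_l2 g"
      and ae: "ae_eq UNIV f (\<lambda>t. \<Sum>i\<in>K. complex_of_real (a i) * E i t)"
        "ae_eq UNIV g (\<lambda>t. \<Sum>i\<in>K. complex_of_real (b i) * E i t)"
      using xy unfolding rep_def by blast
    have "ae_eq UNIV (\<lambda>t. f t + complex_of_real c * g t)
       (\<lambda>t. \<Sum>i\<in>K. complex_of_real (a i + c * b i) * E i t)"
      using ae unfolding ae_eq_def
    proof eventually_elim
      case (elim t)
      then show ?case by (simp add: sum.distrib sum_distrib_left algebra_simps)
    qed
    moreover have "x + c *\<^sub>R y = abs_l2 (\<lambda>t. f t + complex_of_real c * g t)"
      using fg by (simp add: abs_l2_scaleR abs_l2_add L2_scale)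
    ultimately show ?thesis
      using fg unfolding rep_def by (intro exI[of _ "\<lambda>t. f t + complex_of_real c * g t"]) (auto intro: L2_add L2_scale)
  qed
  have rep_smaller: "rep J x a" if "rep (insert j J) x a" "a j = 0" for x a
    using that insert.hyps by (simp add: rep_def)
  have rep0: "rep J 0 (\<lambda>_. 0)"
    unfolding rep_def by (intro exI[of _ "\<lambda>_. 0"]) (simp add: zero_l2.abs_eq)
  \<comment> \<open>The classes that can be written without \<open>E j\<close>. Modulo
    \<open>W'\<close> the space \<open>W\<close> has dimension at most one, since a multiple of a
    single \<open>x0\<close> outside \<open>W'\<close> cancels the coefficient of \<open>E j\<close>
    in any other element.\<close>
  define W' where "W' = {x \<in> W. \<exists>a. rep J x a}"
  have W': "subspace W'"
  proof (rule subspaceI)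
    show "0 \<in> W'" using rep0 insert.prems(1) subspace_0 by (auto simp: W'_def)
  next
    fix x y assume "x \<in> W'" "y \<in> W'"
    then show "x + y \<in> W'" using comb[of J x _ y _ 1] insert.prems(1) subspace_add
      by (fastforce simp: W'_def)
  next
    fix c x assume "x \<in> W'"
    then show "c *\<^sub>R x \<in> W'" using comb[OF rep0, of x _ c] insert.prems(1) subspace_scale
      by (fastforce simp: W'_def)
  qed
  have "\<exists>F. finite F \<and> W' \<subseteq> span F"
    by (rule insert.IH[OF W']) (auto simp: W'_def rep_def)
  then obtain F where F: "finite F" "W' \<subseteq> span F" by blast
  have repW: "\<exists>a. rep (insert j J) x a" if "x \<in> W" for x
    using insert.prems(2)[OF that] by (simp add: rep_def)
  show ?case
  proof (cases "W \<subseteq> W'")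
    case False
    then obtain x0 where x0: "x0 \<in> W" "x0 \<notin> W'" by blast
    obtain b where b: "rep (insert j J) x0 b" using repW x0 by blast
    have bj: "b j \<noteq> 0" using rep_smaller[OF b] x0 by (auto simp: W'_def)
    have "x \<in> span (insert x0 F)" if x: "x \<in> W" for x
    proof -
      obtain a where a: "rep (insert j J) x a" using repW x by blast
      have "rep J (x + (- (a j / b j)) *\<^sub>R x0) (\<lambda>i. a i + (- (a j / b j)) * b i)"
        by (rule rep_smaller[OF comb[OF a b]]) (use bj in simp)
      moreover have "x + (- (a j / b j)) *\<^sub>R x0 \<in> W"
        using x x0 insert.prems(1) by (intro subspace_add subspace_scale)
      ultimately have "x - (a j / b j) *\<^sub>R x0 \<in> span F" using F(2) by (auto simp: W'_def)
      then show ?thesis by (auto simp: span_insert)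
    qed
    then show ?thesis using F(1) by (intro exI[of _ "insert x0 F"]) auto
  qed (use F in blast)
qed

text \<open>Either 0 is a resolvent point or it is isolated in the spectrum, and then a small
  positive number is one. The point has to be real for the resolvent to be symmetric.\<close>

lemma discrete_spectrum_real_resolvent_point:
  assumes "discrete_spectrum I H"
  shows "\<exists>\<mu>::real. complex_of_real \<mu> \<in> resolvent_set I H"
proof (cases "0 \<in> resolvent_set I H")
  case True
  then show ?thesis by (intro exI[of _ 0]) simp
next
  case False
  then have "0 isolated_in spectrum I H"
    using assms by (auto simp: discrete_spectrum_def spectrum_def)
  then obtain T where T: "open T" "T \<inter> spectrum I H = {0}" by (auto simp: isolated_in_def)
  then have "0 \<in> T" by blast
  then obtain e where e: "e > 0" "\<And>y. dist y 0 < e \<Longrightarrow> y \<in> T"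
    using T(1) unfolding open_dist by blast
  have "complex_of_real (e / 2) \<in> T" using e by (intro e(2)) (simp add: dist_norm)
  moreover have "complex_of_real (e / 2) \<noteq> 0" using e(1) by simp
  ultimately have "complex_of_real (e / 2) \<notin> spectrum I H" using T(2) by blast
  then have "complex_of_real (e / 2) \<in> resolvent_set I H" unfolding spectrum_def by blast
  then show ?thesis by blast
qed

text \<open>The criterion for bounded operators is applied to the resolvent \<open>A\<close> at a
  real point \<open>\<mu>\<close> and to \<open>h k = \<psi> k - \<mu> \<phi> k\<close>, so that
  \<open>A\<close> maps \<open>h k\<close> to \<open>\<phi> k\<close>. The three orthogonality
  assumptions make both families orthogonal, and the bound on \<open>\<psi> k\<close> becomes a
  lower bound for \<open>A\<close>. Spectral values correspond under
  \<open>t \<mapsto> \<mu> + 1 / t\<close>.\<close>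

theorem no_orthogonal_graph_sequence:
  assumes I: "I \<in> sets lebesgue" and sa: "self_adjoint I H" and ds: "discrete_spectrum I H"
    and \<phi>: "\<And>k. (\<phi> k, \<psi> k) \<in> H"
    and orth: "\<And>j k. j \<noteq> k \<Longrightarrow> L2_inner I (\<phi> j) (\<phi> k) = 0" "\<And>j k. j \<noteq> k \<Longrightarrow> L2_inner I (\<phi> j) (\<psi> k) = 0"
      "\<And>j k. j \<noteq> k \<Longrightarrow> L2_inner I (\<psi> j) (\<psi> k) = 0"
    and c: "0 < c" "\<And>k. c \<le> L2_norm I (\<phi> k)" and C: "\<And>k::nat. L2_norm I (\<psi> k) \<le> C * L2_norm I (\<phi> k)"
  shows False
proof -
  obtain \<mu> :: real where mu: "complex_of_real \<mu> \<in> resolvent_set I H"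
    using discrete_spectrum_real_resolvent_point[OF ds] by blast
  have lin: "linear_operator I H" and adj: "adjoint_graph I H = H"
    using sa by (auto simp: self_adjoint_def)
  have HL2: "f \<in> L2 I" "g \<in> L2 I" if "(f, g) \<in> H" for f g
    using lin that by (auto simp: linear_operator_def)
  have Hcomb: "((\<lambda>x. a * f x + b * f' x), (\<lambda>x. a * g x + b * g' x)) \<in> H" if "(f, g) \<in> H" "(f', g') \<in> H"
    for f g f' g' a b
  proof -
    have "\<forall>(f, g) \<in> H. \<forall>(f', g') \<in> H. \<forall>a b. ((\<lambda>x. a * f x + b * f' x), (\<lambda>x. a * g x + b * g' x)) \<in> H"
      using lin unfolding linear_operator_def by (elim conjE)
    from bspec[OF this that(1)]
    have "\<forall>(f', g') \<in> H. \<forall>a b. ((\<lambda>x. a * f x + b * f' x), (\<lambda>x. a * g x + b * g' x)) \<in> H" by simp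
    from bspec[OF this that(2)] show ?thesis by simp
  qed
  have Hsym: "L2_inner I g f' = L2_inner I f g'" if "(f, g) \<in> H" "(f', g') \<in> H" for f g f' g'
  proof -
    have "(f', g') \<in> adjoint_graph I H" using that(2) adj by simp
    then have "\<forall>(f, g) \<in> H. L2_inner I g f' = L2_inner I f g'" by (simp add: adjoint_graph_def)
    from bspec[OF this that(1)] show ?thesis by simp
  qed
  have hL2: "(\<lambda>x. g x - z * f x) \<in> L2 I" if "(f, g) \<in> H" for f g z
    using HL2[OF that] by (intro L2_diff L2_scale)
  obtain C\<mu> where surj: "\<And>h. h \<in> L2 I \<Longrightarrow> \<exists>(f, g) \<in> H. ae_eq I h (\<lambda>x. g x - complex_of_real \<mu> * f x)"
    and C\<mu>: "\<And>f g. (f, g) \<in> H \<Longrightarrow> L2_norm I f \<le> C\<mu> * L2_norm I (\<lambda>x. g x - complex_of_real \<mu> * f x)"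
    using mu unfolding resolvent_set_def by blast
  have surj: "\<exists>f g. (f, g) \<in> H \<and> ae_eq I h (\<lambda>x. g x - complex_of_real \<mu> * f x)" if "h \<in> L2 I" for h
    using surj[OF that] by blast
  \<comment> \<open>The sign of the constant in the definition of the resolvent set is unknown; the
    absolute value makes the bound usable with monotonicity.\<close>
  have HC: "L2_norm I f \<le> \<bar>C\<mu>\<bar> * L2_norm I (\<lambda>x. g x - complex_of_real \<mu> * f x)" if "(f, g) \<in> H" for f g
    by (rule order_trans[OF C\<mu>[OF that] mult_right_mono]) (simp_all only: abs_ge_self L2_norm_nonneg)
  define cls where "cls f = abs_l2 (zero_ext I f)" for f
  have ext: "zero_ext I f \<in> L2 UNIV" if "f \<in> L2 I" for f using L2_zero_ext[OF I] that by blast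
  have norm_cls: "norm (cls f) = L2_norm I f" if "f \<in> L2 I" for f
    by (simp add: cls_def norm_abs_l2 ext that L2_norm_zero_ext I)
  have inner_cls: "inner (cls f) (abs_l2 h) = Re (L2_inner I f h)"
    "inner (abs_l2 h) (cls f) = Re (L2_inner I h f)" if "f \<in> L2 I" "h \<in> L2 UNIV" for f h
    by (simp_all add: cls_def inner_abs_l2 ext that L2_inner_zero_ext_left L2_inner_zero_ext_right I)
  have inner_cls2: "inner (cls f) (cls h) = Re (L2_inner I f h)" if "f \<in> L2 I" "h \<in> L2 I" for f h
    by (simp add: cls_def inner_abs_l2 ext that L2_inner_zero_ext_left L2_inner_zero_ext_idem I)
  have cls_lin: "a *\<^sub>R cls f + b *\<^sub>R cls g = cls (\<lambda>x. complex_of_real a * f x + complex_of_real b * g x)"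
    if "f \<in> L2 I" "g \<in> L2 I" for a b f g
  proof -
    have "zero_ext I (\<lambda>x. complex_of_real a * f x + complex_of_real b * g x)
      = (\<lambda>x. complex_of_real a * zero_ext I f x + complex_of_real b * zero_ext I g x)"
      by (auto simp: zero_ext_def)
    then show ?thesis by (simp add: cls_def abs_l2_scaleR abs_l2_add ext that L2_scale)
  qed
  \<comment> \<open>The graph of the resolvent on \<open>l2\<close>: restrict \<open>h\<close> to
    \<open>I\<close>, solve \<open>(H - \<mu>) f = h\<close>, extend \<open>f\<close> by zero.
    Representatives are determined only almost everywhere, so single-valuedness is derived from the
    norm bound before \<open>A\<close> is defined.\<close>
  define R where "R x y \<longleftrightarrow> (\<exists>f g h. (f, g) \<in> H \<and> y = cls f \<and> h \<in> L2 UNIV \<and> x = abs_l2 h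
      \<and> ae_eq I h (\<lambda>x. g x - complex_of_real \<mu> * f x))" for x y
  have R_ex: "\<exists>y. R x y" for x
  proof -
    obtain h where h: "x = abs_l2 h" "h \<in> L2 UNIV" by (rule l2_cases)
    with surj[OF L2_subset[OF I h(2)]] show ?thesis unfolding R_def by blast
  qed
  have R_lin: "R (a *\<^sub>R x + b *\<^sub>R x') (a *\<^sub>R y + b *\<^sub>R y')" if xy: "R x y" "R x' y'" for a b x x' y y'
  proof -
    obtain f g h f' g' h' where H: "(f, g) \<in> H" "(f', g') \<in> H"
      and yy: "y = cls f" "y' = cls f'" "h \<in> L2 UNIV" "h' \<in> L2 UNIV" "x = abs_l2 h" "x' = abs_l2 h'"
      and ae: "ae_eq I h (\<lambda>x. g x - complex_of_real \<mu> * f x)" "ae_eq I h' (\<lambda>x. g' x - complex_of_real \<mu> * f' x)"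
      using xy unfolding R_def by blast
    let ?c = "\<lambda>f f' x. complex_of_real a * f x + complex_of_real b * f' x"
    have "(?c f f', ?c g g') \<in> H" by (rule Hcomb[OF H])
    moreover have "a *\<^sub>R y + b *\<^sub>R y' = cls (?c f f')" using cls_lin HL2 H yy by simp
    moreover have "?c h h' \<in> L2 UNIV" using yy by (intro L2_add L2_scale)
    moreover have "a *\<^sub>R x + b *\<^sub>R x' = abs_l2 (?c h h')"
      using yy by (simp add: abs_l2_scaleR abs_l2_add L2_scale)
    moreover have "ae_eq I (?c h h') (\<lambda>x. ?c g g' x - complex_of_real \<mu> * ?c f f' x)"
      using ae unfolding ae_eq_def
    proof eventually_elim
      case (elim x)
      show ?case unfolding elim by (simp add: algebra_simps)
    qed
    ultimately show ?thesis unfolding R_def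
      by (intro exI[of _ "?c f f'"] exI[of _ "?c g g'"] exI[of _ "?c h h'"] conjI)
  qed
  have R_bound: "norm y \<le> \<bar>C\<mu>\<bar> * norm x" if "R x y" for x y
  proof -
    obtain f g h where H: "(f, g) \<in> H" and y: "y = cls f" "h \<in> L2 UNIV" "x = abs_l2 h"
      and ae: "ae_eq I h (\<lambda>x. g x - complex_of_real \<mu> * f x)"
      using \<open>R x y\<close> unfolding R_def by blast
    have "norm y \<le> \<bar>C\<mu>\<bar> * L2_norm I (\<lambda>x. g x - complex_of_real \<mu> * f x)"
      using HC[OF H] HL2[OF H] by (simp add: y norm_cls)
    also have "L2_norm I (\<lambda>x. g x - complex_of_real \<mu> * f x) = L2_norm I h"
      using hL2[OF H] L2_subset[OF I y(2)] ae by (intro L2_norm_cong[symmetric])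
    also have "\<dots> \<le> norm x" using L2_norm_subset_le[OF I y(2)] y by (simp add: norm_abs_l2)
    finally show ?thesis by (simp add: mult_left_mono)
  qed
  have R_unique: "y = y'" if "R x y" "R x y'" for x y y'
    using R_bound[OF R_lin[OF that, of 1 "-1"]] by simp
  define A where "A x = (THE y. R x y)" for x
  have RA: "R x (A x)" for x
    unfolding A_def using R_ex R_unique by (metis theI)
  have A_eq: "A x = y" if "R x y" for x y
    using R_unique[OF RA that] .
  have A: "bounded_linear A"
  proof (rule bounded_linear_intro)
    show "A (x + y) = A x + A y" for x y
      using A_eq[OF R_lin[OF RA RA, of 1 x 1 y]] by simp
    show "A (r *\<^sub>R x) = r *\<^sub>R A x" for r x
      using A_eq[OF R_lin[OF RA RA, of r x 0 x]] by simp
    show "norm (A x) \<le> norm x * \<bar>C\<mu>\<bar>" for x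
      using R_bound[OF RA] by (simp add: mult.commute)
  qed
  \<comment> \<open>Symmetry of \<open>H\<close> together with \<open>\<mu>\<close> being
    real.\<close>
  have A_sym: "inner (A x) x' = inner x (A x')" for x x'
  proof -
    obtain f g h where H: "(f, g) \<in> H" and y: "A x = cls f" "h \<in> L2 UNIV" "x = abs_l2 h"
      and ae: "ae_eq I h (\<lambda>x. g x - complex_of_real \<mu> * f x)"
      using RA[of x] unfolding R_def by blast
    obtain f' g' h' where H': "(f', g') \<in> H" and y': "A x' = cls f'" "h' \<in> L2 UNIV" "x' = abs_l2 h'"
      and ae': "ae_eq I h' (\<lambda>x. g' x - complex_of_real \<mu> * f' x)"
      using RA[of x'] unfolding R_def by blast
    have "inner (A x) x' = Re (L2_inner I f h')" 
      by (simp only: y(1) y'(3) inner_cls(1)[OF HL2(1)[OF H] y'(2)])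
    also have "L2_inner I f h' = L2_inner I f (\<lambda>x. g' x - complex_of_real \<mu> * f' x)"
      by (intro L2_inner_cong HL2(1)[OF H] L2_subset[OF I y'(2)] hL2[OF H'] ae' ae_eq_refl)
    also have "\<dots> = L2_inner I f g' - complex_of_real \<mu> * L2_inner I f f'"
      using HL2[OF H] HL2[OF H'] by (simp add: L2_inner_diff_right L2_scale L2_inner_scale_right)
    also have "\<dots> = L2_inner I (\<lambda>x. g x - complex_of_real \<mu> * f x) f'"
      using HL2[OF H] HL2[OF H'] by (simp add: L2_inner_diff_left L2_scale L2_inner_scale_left Hsym[OF H H'])
    also have "\<dots> = L2_inner I h f'"
      by (intro L2_inner_cong HL2(1)[OF H'] L2_subset[OF I y(2)] hL2[OF H] ae_eq_sym[OF ae] ae_eq_refl)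
    also have "Re \<dots> = inner x (A x')"
      by (simp only: y(3) y'(1) inner_cls(2)[OF HL2(1)[OF H'] y(2)])
    finally show ?thesis .
  qed
  \<comment> \<open>Since \<open>h = g - \<mu> f\<close> on \<open>I\<close>, there
    \<open>f - t h = - t (g - (\<mu> + 1 / t) f)\<close>: the point \<open>t\<close> for
    \<open>A\<close> becomes the point \<open>\<mu> + 1 / t\<close> for \<open>H\<close>.\<close>
  have shift: "\<exists>f g h. (f, g) \<in> H \<and> A x = cls f \<and> h \<in> L2 UNIV \<and> x = abs_l2 h \<and> A x - t *\<^sub>R x = abs_l2 (\<lambda>x. zero_ext I f x - complex_of_real t * h x)
      \<and> ae_eq I (\<lambda>x. zero_ext I f x - complex_of_real t * h x) (\<lambda>x. (- complex_of_real t) * (g x - complex_of_real (\<mu> + 1 / t) * f x))"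
    if t: "t \<noteq> 0" for x t
  proof -
    obtain f g h where H: "(f, g) \<in> H" and y: "A x = cls f" "h \<in> L2 UNIV" "x = abs_l2 h"
      and ae: "ae_eq I h (\<lambda>x. g x - complex_of_real \<mu> * f x)"
      using RA[of x] unfolding R_def by blast
    have "A x - t *\<^sub>R x = abs_l2 (\<lambda>x. zero_ext I f x - complex_of_real t * h x)"
      using HL2[OF H] y by (simp add: cls_def abs_l2_scaleR abs_l2_diff ext L2_scale)
    moreover have "AE x in lebesgue_on I. x \<in> I" using I by (auto simp: AE_restrict_space_iff)
    then have "ae_eq I (\<lambda>x. zero_ext I f x - complex_of_real t * h x)
        (\<lambda>x. (- complex_of_real t) * (g x - complex_of_real (\<mu> + 1 / t) * f x))"
      using ae unfolding ae_eq_def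
    proof eventually_elim
      case (elim x)
      show ?case using elim(1) t unfolding elim(2) by (simp add: zero_ext_def field_simps)
    qed
    ultimately show ?thesis using H y by (intro exI[of _ f] exI[of _ g] exI[of _ h] conjI)
  qed
  \<comment> \<open>The resolvent estimate for \<open>H\<close> controls only the part on
    \<open>I\<close>. It is used to bound \<open>A x\<close>, which vanishes off \<open>I\<close>;
    then \<open>t x = A x - (A x - t x)\<close> bounds all of \<open>x\<close>.\<close>
  have bb: "bounded_below UNIV (\<lambda>x. A x - t *\<^sub>R x)"
    if t: "t \<noteq> 0" and z: "complex_of_real (\<mu> + 1 / t) \<in> resolvent_set I H" for t
  proof -
    obtain Cz where Cz: "\<And>f g. (f, g) \<in> H \<Longrightarrow> L2_norm I f \<le> Cz * L2_norm I (\<lambda>x. g x - complex_of_real (\<mu> + 1 / t) * f x)"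
      using z unfolding resolvent_set_def by blast
    have "\<bar>t\<bar> * norm x \<le> (1 + \<bar>Cz\<bar> / \<bar>t\<bar>) * norm (A x - t *\<^sub>R x)" for x
    proof -
      obtain f g h where H: "(f, g) \<in> H" and y: "A x = cls f" "h \<in> L2 UNIV" "x = abs_l2 h"
        and w: "A x - t *\<^sub>R x = abs_l2 (\<lambda>x. zero_ext I f x - complex_of_real t * h x)"
        and ae: "ae_eq I (\<lambda>x. zero_ext I f x - complex_of_real t * h x) (\<lambda>x. (- complex_of_real t) * (g x - complex_of_real (\<mu> + 1 / t) * f x))"
        using shift[OF t, of x] by blast
      have wL2: "(\<lambda>x. zero_ext I f x - complex_of_real t * h x) \<in> L2 UNIV"
        using HL2[OF H] y by (intro L2_diff L2_scale ext)
      have "\<bar>t\<bar> * L2_norm I (\<lambda>x. g x - complex_of_real (\<mu> + 1 / t) * f x)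
          = L2_norm I (\<lambda>x. (- complex_of_real t) * (g x - complex_of_real (\<mu> + 1 / t) * f x))"
        unfolding L2_norm_scale by simp
      also have "\<dots> = L2_norm I (\<lambda>x. zero_ext I f x - complex_of_real t * h x)"
        by (intro L2_norm_cong L2_scale hL2[OF H] L2_subset[OF I wL2] ae_eq_sym[OF ae])
      also have "\<dots> \<le> norm (A x - t *\<^sub>R x)"
        unfolding w using L2_norm_subset_le[OF I wL2] by (simp add: norm_abs_l2 wL2)
      finally have 1: "L2_norm I (\<lambda>x. g x - complex_of_real (\<mu> + 1 / t) * f x) \<le> norm (A x - t *\<^sub>R x) / \<bar>t\<bar>"
        using t by (simp add: field_simps)
      have "norm (A x) = L2_norm I f" using HL2[OF H] by (simp add: y(1) norm_cls)
      also have "\<dots> \<le> \<bar>Cz\<bar> * L2_norm I (\<lambda>x. g x - complex_of_real (\<mu> + 1 / t) * f x)"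
        by (rule order_trans[OF Cz[OF H] mult_right_mono]) (simp_all only: abs_ge_self L2_norm_nonneg)
      also have "\<dots> \<le> \<bar>Cz\<bar> * (norm (A x - t *\<^sub>R x) / \<bar>t\<bar>)" by (intro mult_left_mono 1) simp
      finally have 2: "norm (A x) \<le> \<bar>Cz\<bar> / \<bar>t\<bar> * norm (A x - t *\<^sub>R x)" by simp
      have "\<bar>t\<bar> * norm x = norm (A x - (A x - t *\<^sub>R x))" by simp
      also have "\<dots> \<le> norm (A x) + norm (A x - t *\<^sub>R x)" by (rule norm_triangle_ineq4)
      finally show ?thesis using 2 by (simp add: distrib_right)
    qed
    moreover have p: "0 < 1 + \<bar>Cz\<bar> / \<bar>t\<bar>" by (simp add: add_pos_nonneg)
    ultimately have "\<bar>t\<bar> / (1 + \<bar>Cz\<bar> / \<bar>t\<bar>) * norm x \<le> norm (A x - t *\<^sub>R x)" for x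
      by (simp add: pos_divide_le_eq mult.commute)
    then show ?thesis using t p unfolding bounded_below_def
      by (intro exI[of _ "\<bar>t\<bar> / (1 + \<bar>Cz\<bar> / \<bar>t\<bar>)"]) auto
  qed
  \<comment> \<open>At a resolvent point this is openness; at a spectral point, continuity of
    \<open>s \<mapsto> \<mu> + 1 / s\<close> at \<open>t\<close> pulls back a neighbourhood
    containing no other spectral value.\<close>
  have isol: "\<exists>r>0. \<forall>s. 0 < \<bar>s - t\<bar> \<and> \<bar>s - t\<bar> < r \<longrightarrow> bounded_below UNIV (\<lambda>x. A x - s *\<^sub>R x)"
    if t: "t \<noteq> 0" for t
  proof (cases "complex_of_real (\<mu> + 1 / t) \<in> resolvent_set I H")
    case True
    then show ?thesis using bounded_below_perturb[OF bb[OF t]] by blast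
  next
    case False
    then have "complex_of_real (\<mu> + 1 / t) isolated_in spectrum I H"
      using ds by (auto simp: discrete_spectrum_def spectrum_def)
    then obtain T where T: "open T" "T \<inter> spectrum I H = {complex_of_real (\<mu> + 1 / t)}"
      by (auto simp: isolated_in_def)
    have "((\<lambda>s. complex_of_real (\<mu> + 1 / s)) \<longlongrightarrow> complex_of_real (\<mu> + 1 / t)) (at t)"
      using t by (intro tendsto_intros)
    then have "eventually (\<lambda>s. complex_of_real (\<mu> + 1 / s) \<in> T) (at t)"
      using T by (intro topological_tendstoD) auto
    moreover have "eventually (\<lambda>s. s \<noteq> 0) (at t)"
      by (rule eventually_neq_at_within)
    ultimately have "eventually (\<lambda>s. s \<noteq> 0 \<and> complex_of_real (\<mu> + 1 / s) \<in> T) (at t)"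
      by eventually_elim simp
    then obtain r where r: "r > 0"
      "\<forall>s\<in>UNIV. s \<noteq> t \<and> dist s t < r \<longrightarrow> s \<noteq> 0 \<and> complex_of_real (\<mu> + 1 / s) \<in> T"
      unfolding eventually_at by blast
    have "bounded_below UNIV (\<lambda>x. A x - s *\<^sub>R x)" if s: "0 < \<bar>s - t\<bar>" "\<bar>s - t\<bar> < r" for s
    proof (rule bb)
      have s': "s \<noteq> 0" "complex_of_real (\<mu> + 1 / s) \<in> T" using r(2) s by (auto simp: dist_real_def)
      then show "s \<noteq> 0" by simp
      have "complex_of_real (\<mu> + 1 / s) \<noteq> complex_of_real (\<mu> + 1 / t)"
        unfolding of_real_eq_iff using s s'(1) t by simp
      then show "complex_of_real (\<mu> + 1 / s) \<in> resolvent_set I H"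
        using T(2) s'(2) unfolding spectrum_def by blast
    qed
    then show ?thesis using r(1) by blast
  qed
  have fin: "\<exists>F. finite F \<and> {x. A x = t *\<^sub>R x} \<subseteq> span F" if t: "t \<noteq> 0" for t
  proof (cases "complex_of_real (\<mu> + 1 / t) \<in> resolvent_set I H")
    case True
    then obtain c where "c > 0" "\<And>x. c * norm x \<le> norm (A x - t *\<^sub>R x)"
      using bb[OF t] unfolding bounded_below_def by blast
    then have "x = 0" if "A x = t *\<^sub>R x" for x
      using that by (metis diff_self mult_le_0_iff norm_le_zero_iff norm_zero not_le)
    then show ?thesis by (intro exI[of _ "{}"]) auto
  next
    case False
    then have "finite_multiplicity I H (complex_of_real (\<mu> + 1 / t))"
      using ds by (auto simp: discrete_spectrum_def spectrum_def)
    then obtain n e where e: "\<And>f. f \<in> eigenfunctions I H (complex_of_real (\<mu> + 1 / t)) \<Longrightarrow>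
        \<exists>\<alpha> :: nat \<Rightarrow> complex. ae_eq I f (\<lambda>x. \<Sum>i<n. \<alpha> i * e i x)"
      unfolding finite_multiplicity_def by blast
    interpret A: bounded_linear A by (rule A)
    \<comment> \<open>Scalars in \<open>l2\<close> are real, so the complex span of the
      \<open>e i\<close> is generated by the \<open>e i\<close> together with their multiples by
      \<open>\<i>\<close>.\<close>
    define E where "E = (\<lambda>(i, u) x. u * zero_ext I (e i) x)"
    show ?thesis
    proof (rule finite_dim_of_spanning_functions[where J = "{..<n} \<times> {1, \<i>}" and E = E])
      show "subspace {x. A x = t *\<^sub>R x}"
        by (auto simp: subspace_def A.zero A.add A.scaleR scaleR_add_right)
    next
      fix x assume "x \<in> {x. A x = t *\<^sub>R x}"
      then have Ax: "A x = t *\<^sub>R x" by simp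
      obtain f g h where H: "(f, g) \<in> H" and y: "A x = cls f" "h \<in> L2 UNIV" "x = abs_l2 h"
        and w: "A x - t *\<^sub>R x = abs_l2 (\<lambda>x. zero_ext I f x - complex_of_real t * h x)"
        and ae: "ae_eq I (\<lambda>x. zero_ext I f x - complex_of_real t * h x) (\<lambda>x. (- complex_of_real t) * (g x - complex_of_real (\<mu> + 1 / t) * f x))"
        using shift[OF t, of x] by blast
      have wL2: "(\<lambda>x. zero_ext I f x - complex_of_real t * h x) \<in> L2 UNIV"
        using HL2[OF H] y by (intro L2_diff L2_scale ext)
      have "ae_eq UNIV (\<lambda>x. zero_ext I f x - complex_of_real t * h x) (\<lambda>_. 0)"
        using w Ax wL2 by (simp add: zero_l2.abs_eq flip: abs_l2_eq_iff)
      then have fh: "ae_eq UNIV (zero_ext I f) (\<lambda>x. complex_of_real t * h x)"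
        and 0: "ae_eq I (\<lambda>x. zero_ext I f x - complex_of_real t * h x) (\<lambda>_. 0)"
        using ae_eq_subset[OF I] by (auto simp: ae_eq_def)
      from ae_eq_trans[OF ae_eq_sym[OF 0] ae]
      have "ae_eq I g (\<lambda>x. complex_of_real (\<mu> + 1 / t) * f x)"
        unfolding ae_eq_def by eventually_elim (use t in simp)
      then have "f \<in> eigenfunctions I H (complex_of_real (\<mu> + 1 / t))"
        using H unfolding eigenfunctions_def by blast
      from e[OF this] obtain \<alpha> where "ae_eq I f (\<lambda>x. \<Sum>i<n. \<alpha> i * e i x)" by blast
      then have "ae_eq UNIV (zero_ext I f) (zero_ext I (\<lambda>x. \<Sum>i<n. \<alpha> i * e i x))"
        using ae_eq_zero_ext[OF I] by blast
      with fh have ae2: "ae_eq UNIV (\<lambda>x. complex_of_real t * h x) (zero_ext I (\<lambda>x. \<Sum>i<n. \<alpha> i * e i x))"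
        using ae_eq_trans ae_eq_sym by blast
      \<comment> \<open>Real and imaginary parts of the coefficients of the eigenfunction
        \<open>f\<close>; the division by \<open>t\<close> arises because \<open>f\<close> equals
        \<open>t h\<close> and it is \<open>h\<close> that has to be expanded.\<close>
      define a where "a = (\<lambda>(i, u :: complex). (if u = 1 then Re (\<alpha> i) else Im (\<alpha> i)) / t)"
      have E_sum: "(\<Sum>i\<in>{..<n} \<times> {1, \<i>}. complex_of_real (a i) * E i s)
          = zero_ext I (\<lambda>x. \<Sum>i<n. \<alpha> i * e i x) s / complex_of_real t" for s
      proof -
        have split: "complex_of_real (Re z / t) * w + complex_of_real (Im z / t) * (\<i> * w) = z * w / complex_of_real t"
          for z w
        proof -
          have "complex_of_real (Re z / t) * w + complex_of_real (Im z / t) * (\<i> * w)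
              = (complex_of_real (Re z) + \<i> * complex_of_real (Im z)) * w / complex_of_real t"
            by (simp add: add_divide_distrib algebra_simps)
          then show ?thesis by (simp only: complex_eq[symmetric])
        qed
        have "(\<Sum>i\<in>{..<n} \<times> {1, \<i>}. complex_of_real (a i) * E i s)
            = (\<Sum>i<n. \<Sum>u\<in>{1, \<i>}. complex_of_real (a (i, u)) * E (i, u) s)"
          unfolding sum.cartesian_product by (intro sum.cong) auto
        also have "\<dots> = (\<Sum>i<n. \<alpha> i * zero_ext I (e i) s / complex_of_real t)"
        proof (rule sum.cong[OF refl])
          fix i
          have "(\<Sum>u\<in>{1, \<i>}. complex_of_real (a (i, u)) * E (i, u) s)
              = complex_of_real (a (i, 1)) * E (i, 1) s + complex_of_real (a (i, \<i>)) * E (i, \<i>) s"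
            by simp
          also have "\<dots> = \<alpha> i * zero_ext I (e i) s / complex_of_real t"
            unfolding split[symmetric] a_def E_def by simp
          finally show "(\<Sum>u\<in>{1, \<i>}. complex_of_real (a (i, u)) * E (i, u) s)
              = \<alpha> i * zero_ext I (e i) s / complex_of_real t" .
        qed
        also have "\<dots> = zero_ext I (\<lambda>x. \<Sum>i<n. \<alpha> i * e i x) s / complex_of_real t"
          by (simp add: zero_ext_def sum_divide_distrib)
        finally show ?thesis .
      qed
      have "ae_eq UNIV h (\<lambda>s. \<Sum>i\<in>{..<n} \<times> {1, \<i>}. complex_of_real (a i) * E i s)"
        using ae2 unfolding ae_eq_def E_sum
      proof eventually_elim
        case (elim s)
        show ?case using t unfolding elim[symmetric] by simp
      qed
      then show "\<exists>a f. f \<in> L2 UNIV \<and> x = abs_l2 f \<and> ae_eq UNIV f (\<lambda>s. \<Sum>i\<in>{..<n} \<times> {1, \<i>}.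
          complex_of_real (a i) * E i s)"
        using y(2,3) by (intro exI[of _ a] exI[of _ h] conjI)
    qed simp
  qed
  define h where "h k = (\<lambda>x. \<psi> k x - complex_of_real \<mu> * \<phi> k x)" for k
  have h: "h k \<in> L2 I" for k unfolding h_def by (rule hL2[OF \<phi>])
  have Ah: "A (cls (h k)) = cls (\<phi> k)" for k
  proof (rule A_eq)
    have "ae_eq I (zero_ext I (h k)) (h k)"
      unfolding ae_eq_def using I by (auto simp: AE_restrict_space_iff zero_ext_def)
    then show "R (cls (h k)) (cls (\<phi> k))"
      using \<phi>[of k] ext[OF h[of k]] unfolding R_def cls_def h_def
      by (intro exI[of _ "\<phi> k"] exI[of _ "\<psi> k"] exI[of _ "zero_ext I (h k)", unfolded h_def] conjI refl)
  qed
  have orth_h: "L2_inner I (h j) (h k) = 0" if "j \<noteq> k" for j k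
  proof -
    have "L2_inner I (\<psi> j) (\<phi> k) = 0"
      using orth(2)[of k j] that by (subst L2_inner_commute) simp
    then show ?thesis unfolding h_def using that HL2[OF \<phi>]
      by (simp add: L2_inner_diff_left L2_inner_diff_right L2_diff L2_scale L2_inner_scale_left
          L2_inner_scale_right orth)
  qed
  have C0: "0 \<le> C + \<bar>\<mu>\<bar>"
  proof -
    have "0 \<le> C * L2_norm I (\<phi> 0)" using C[of 0] order_trans[of 0 "L2_norm I (\<psi> 0)"] by (simp add: L2_norm_def)
    then show ?thesis using c(1) c(2)[of 0] by (simp add: zero_le_mult_iff)
  qed
  have norm_h: "norm (cls (h k)) \<le> (C + \<bar>\<mu>\<bar>) * norm (cls (\<phi> k))" for k
  proof -
    have "cls (h k) = cls (\<psi> k) - \<mu> *\<^sub>R cls (\<phi> k)"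
      using cls_lin[OF HL2(2)[OF \<phi>] HL2(1)[OF \<phi>], of 1 k "- \<mu>" k] by (simp add: h_def)
    then have "norm (cls (h k)) \<le> norm (cls (\<psi> k)) + \<bar>\<mu>\<bar> * norm (cls (\<phi> k))"
      using norm_triangle_ineq4[of "cls (\<psi> k)" "\<mu> *\<^sub>R cls (\<phi> k)"] by simp
    then show ?thesis using C[of k] HL2[OF \<phi>] by (simp add: norm_cls distrib_right)
  qed
  \<comment> \<open>The summand 1 keeps the denominator of \<open>\<delta>\<close> positive even
    when \<open>C + \<bar>\<mu>\<bar>\<close> is 0.\<close>
  show False
  proof (rule no_singular_sequence[OF A A_sym isol fin, where h = "\<lambda>k. cls (h k)" and \<delta> = "1 / (C + \<bar>\<mu>\<bar> + 1)"])
    show "0 < 1 / (C + \<bar>\<mu>\<bar> + 1)" using C0 by simp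
    show "1 / (C + \<bar>\<mu>\<bar> + 1) * norm (cls (h k)) \<le> norm (A (cls (h k)))" for k
    proof -
      have "norm (cls (h k)) \<le> (C + \<bar>\<mu>\<bar> + 1) * norm (cls (\<phi> k))"
        using norm_h[of k] norm_ge_zero[of "cls (\<phi> k)"] unfolding distrib_right mult_1_left by linarith
      moreover have "0 < C + \<bar>\<mu>\<bar> + 1" using C0 by simp
      ultimately show ?thesis by (simp add: Ah pos_divide_le_eq mult.commute)
    qed
    show "cls (h k) \<noteq> 0" for k
    proof
      assume "cls (h k) = 0"
      then have "cls (\<phi> k) = 0" using Ah[of k] linear_0[OF bounded_linear.linear[OF A]] by simp
      then show False using norm_cls[of "\<phi> k"] HL2[OF \<phi>] c(1) c(2)[of k] by simp
    qed
    show "inner (cls (h j)) (cls (h k)) = 0" if "j \<noteq> k" for j k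
      using inner_cls2[OF h h] orth_h[OF that] by simp
    show "inner (A (cls (h j))) (A (cls (h k))) = 0" if "j \<noteq> k" for j k
      unfolding Ah using inner_cls2[OF HL2(1)[OF \<phi>] HL2(1)[OF \<phi>]] orth(1)[OF that] by simp
  qed
qed


section \<open>Integration by parts and the equation \<open>w'' = q w\<close>\<close>

lemma absolutely_integrable_mult_continuous:
  fixes f G :: "real \<Rightarrow> 'a::{euclidean_space, real_normed_algebra}"
  assumes "f absolutely_integrable_on {c..d}" "continuous_on {c..d} G"
  shows "(\<lambda>x. f x * G x) absolutely_integrable_on {c..d}"
proof -
  have "(\<lambda>x. (\<lambda>u v. v * u) (G x) (f x)) absolutely_integrable_on {c..d}"
  proof (rule absolutely_integrable_bounded_measurable_product[where h = "\<lambda>u v. v * u"])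
    show "bilinear (\<lambda>u v :: 'a. v * u)"
      unfolding bilinear_def by (auto intro!: linearI simp: algebra_simps)
    show "G \<in> borel_measurable (lebesgue_on {c..d})"
      using assms(2) by (rule continuous_imp_measurable_on_sets_lebesgue) simp
    show "bounded (G ` {c..d})"
      using assms(2) by (intro compact_imp_bounded compact_continuous_image) auto
  qed (use assms in auto)
  then show ?thesis by simp
qed

lemma integral_diff_subinterval:
  fixes f :: "real \<Rightarrow> 'a::banach"
  assumes "f integrable_on {c..d}" "c \<le> x" "x \<le> y" "y \<le> d"
  shows "integral {c..y} f - integral {c..x} f = integral {x..y} f"
  using Henstock_Kurzweil_Integration.integral_combine[of c x y f]
    integrable_subinterval_real[OF assms(1), of c y] assms by (simp add: algebra_simps)

text \<open>The defect of the product rule is \<open>O(\<bar>y - x\<bar> \<integral>\<^sub>x\<^sup>y \<bar>f\<bar>)\<close>, hence has derivative zero everywhere,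
  although \<open>F\<close> is differentiable only almost everywhere.\<close>

lemma integration_by_parts_AC:
  fixes f F G g :: "real \<Rightarrow> complex"
  assumes cd: "c \<le> d" and f: "f absolutely_integrable_on {c..d}"
    and F: "\<And>x. x \<in> {c..d} \<Longrightarrow> F x = F c + integral {c..x} f"
    and G: "\<And>x. x \<in> {c..d} \<Longrightarrow> (G has_vector_derivative g x) (at x within {c..d})"
    and g: "continuous_on {c..d} g"
  shows "integral {c..d} (\<lambda>x. f x * G x) = F d * G d - F c * G c - integral {c..d} (\<lambda>x. F x * g x)"
proof -
  have Gc: "continuous_on {c..d} G"
    unfolding continuous_on_eq_continuous_within using has_vector_derivative_continuous[OF G] by blast
  have fi: "f integrable_on {c..d}" using f by (rule set_lebesgue_integral_eq_integral(1))
  have Fc: "continuous_on {c..d} F"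
  proof (rule continuous_on_eq)
    show "continuous_on {c..d} (\<lambda>x. F c + integral {c..x} f)"
      by (intro continuous_intros indefinite_integral_continuous_1 fi)
  qed (rule F[symmetric])
  have ni: "(\<lambda>x. norm (f x)) integrable_on {c..d}" using f by (simp add: absolutely_integrable_on_def)
  \<comment> \<open>The continuous modulus that controls the increments of \<open>F\<close>; its
    continuity is what finally makes the defect \<open>\<Phi>\<close> differentiable with derivative
    zero.\<close>
  define N where "N x = integral {c..x} (\<lambda>x. norm (f x))" for x
  have Nc: "continuous_on {c..d} N"
    unfolding N_def by (intro indefinite_integral_continuous_1 ni)
  have "bounded (g ` {c..d})" using g by (intro compact_imp_bounded compact_continuous_image) auto
  then obtain B where B: "B > 0" "\<And>x. x \<in> {c..d} \<Longrightarrow> norm (g x) \<le> B"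
    unfolding bounded_pos by auto
  define h where "h t = f t * G t + F t * g t" for t
  have fG: "(\<lambda>t. f t * G t) integrable_on {c..d}"
    using absolutely_integrable_mult_continuous[OF f Gc] by (rule set_lebesgue_integral_eq_integral(1))
  have Fg: "(\<lambda>t. F t * g t) integrable_on {c..d}"
    by (intro integrable_continuous_real continuous_intros Fc g)
  have hi: "h integrable_on {c..d}" unfolding h_def by (intro Henstock_Kurzweil_Integration.integrable_add fG Fg)
  define \<Phi> where "\<Phi> x = integral {c..x} h - F x * G x" for x
  have est: "norm (\<Phi> y - \<Phi> x) \<le> 2 * B * (y - x) * (N y - N x)" if xy: "c \<le> x" "x \<le> y" "y \<le> d" for x y
  proof -
    have sub: "{x..y} \<subseteq> {c..d}" using xy by auto
    note int = integrable_subinterval_real[OF _ sub]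
    have Nxy: "N y - N x = integral {x..y} (\<lambda>t. norm (f t))"
      unfolding N_def by (rule integral_diff_subinterval[OF ni xy])
    have Fxy: "F t - F x = integral {x..t} f" if "t \<in> {x..y}" for t
      using F[of t] F[of x] integral_diff_subinterval[OF fi, of x t] that xy by auto
    have Gxy: "(g has_integral (G y - G t)) {t..y}" if "t \<in> {x..y}" for t
      using that xy by (intro fundamental_theorem_of_calculus has_vector_derivative_within_subset[OF G]) auto
    have Gb: "norm (G t - G y) \<le> B * (y - x)" if t: "t \<in> {x..y}" for t
    proof -
      have "norm (G y - G t) \<le> B * measure lborel {t..y}"
        using Gxy[OF t] t xy B by (intro has_integral_bound_real[of B "{}" g]) auto
      also have "\<dots> \<le> B * (y - x)" using t B(1) by (intro mult_left_mono) auto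
      finally show ?thesis by (simp add: norm_minus_commute)
    qed
    have Fb: "norm (F t - F x) \<le> N y - N x" if t: "t \<in> {x..y}" for t
    proof -
      have "norm (integral {x..t} f) \<le> integral {x..t} (\<lambda>t. norm (f t))"
        using t xy by (intro integral_norm_bound_integral integrable_subinterval_real[OF fi]
            integrable_subinterval_real[OF ni]) auto
      also have "\<dots> \<le> integral {x..y} (\<lambda>t. norm (f t))"
        using t xy by (intro integral_subset_le integrable_subinterval_real[OF ni]) auto
      finally show ?thesis using Fxy[OF t] Nxy by simp
    qed
    have i1: "(\<lambda>t. f t * (G t - G y)) integrable_on {x..y}"
      unfolding right_diff_distrib
      by (intro Henstock_Kurzweil_Integration.integrable_diff int[OF fG] integrable_on_mult_left int[OF fi])
    have i2: "(\<lambda>t. (F t - F x) * g t) integrable_on {x..y}"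
      by (intro integrable_continuous_real continuous_intros continuous_on_subset[OF Fc sub] continuous_on_subset[OF g sub])
    have "integral {x..y} h = integral {x..y} (\<lambda>t. (f t * (G t - G y) + (F t - F x) * g t) + (f t * G y + F x * g t))"
      unfolding h_def by (intro Henstock_Kurzweil_Integration.integral_cong) (simp add: algebra_simps)
    also have "\<dots> = (integral {x..y} (\<lambda>t. f t * (G t - G y)) + integral {x..y} (\<lambda>t. (F t - F x) * g t))
        + (integral {x..y} (\<lambda>t. f t * G y) + integral {x..y} (\<lambda>t. F x * g t))"
      using i1 i2 integrable_on_mult_left[OF int[OF fi], of "G y"] Gxy[of x] xy
      by (subst Henstock_Kurzweil_Integration.integral_add;
          (intro Henstock_Kurzweil_Integration.integrable_add integrable_on_mult_right)?)
         (auto simp: Henstock_Kurzweil_Integration.integral_add integrable_on_mult_right has_integral_integrable)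
    also have "integral {x..y} (\<lambda>t. f t * G y) = (F y - F x) * G y"
      using Fxy[of y] xy by simp
    also have "integral {x..y} (\<lambda>t. F x * g t) = F x * (G y - G x)"
      using integral_unique[OF Gxy[of x]] xy by simp
    finally have \<Phi>_diff: "\<Phi> y - \<Phi> x = integral {x..y} (\<lambda>t. f t * (G t - G y)) + integral {x..y} (\<lambda>t. (F t - F x) * g t)"
      using integral_diff_subinterval[OF hi xy] by (simp add: \<Phi>_def algebra_simps)
    have "norm (integral {x..y} (\<lambda>t. f t * (G t - G y))) \<le> integral {x..y} (\<lambda>t. norm (f t) * (B * (y - x)))"
      using Gb by (intro integral_norm_bound_integral i1 integrable_on_mult_left int[OF ni])
        (auto simp: norm_mult intro!: mult_left_mono)
    moreover have "norm (integral {x..y} (\<lambda>t. (F t - F x) * g t)) \<le> integral {x..y} (\<lambda>t. (N y - N x) * B)"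
      using Fb B sub by (intro integral_norm_bound_integral i2 integrable_const_ivl)
        (auto simp: norm_mult intro!: mult_mono order_trans[OF norm_ge_zero Fb])
    moreover have "integral {x..y} (\<lambda>t. norm (f t) * (B * (y - x))) = (N y - N x) * (B * (y - x))"
      by (simp add: Nxy)
    moreover have "integral {x..y} (\<lambda>t. (N y - N x) * B) = (y - x) * ((N y - N x) * B)" using xy by simp
    ultimately have "norm (\<Phi> y - \<Phi> x) \<le> (N y - N x) * (B * (y - x)) + (y - x) * ((N y - N x) * B)"
      using norm_triangle_ineq[of "integral {x..y} (\<lambda>t. f t * (G t - G y))" "integral {x..y} (\<lambda>t. (F t - F x) * g t)"]
      unfolding \<Phi>_diff by linarith
    then show ?thesis by (simp add: algebra_simps)
  qed
  have est': "norm (\<Phi> y - \<Phi> x) \<le> 2 * B * \<bar>y - x\<bar> * \<bar>N y - N x\<bar>" if "x \<in> {c..d}" "y \<in> {c..d}" for x y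
  proof (cases "x \<le> y")
    case True
    have "2 * B * (y - x) * (N y - N x) \<le> 2 * B * (y - x) * \<bar>N y - N x\<bar>"
      using True B by (intro mult_left_mono) auto
    with est[of x y] True that show ?thesis by simp
  next
    case False
    have "2 * B * (x - y) * (N x - N y) \<le> 2 * B * (x - y) * \<bar>N x - N y\<bar>"
      using False B by (intro mult_left_mono) auto
    with est[of y x] False that show ?thesis by (simp add: norm_minus_commute abs_minus_commute)
  qed
  have "(\<Phi> has_derivative (\<lambda>h. 0)) (at x within {c..d})" if x: "x \<in> {c..d}" for x
    unfolding has_derivative_within
  proof (intro conjI bounded_linear_zero)
    have "((\<lambda>y. 2 * B * \<bar>N y - N x\<bar>) \<longlongrightarrow> 2 * B * \<bar>N x - N x\<bar>) (at x within {c..d})"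
      using Nc x by (intro tendsto_intros) (auto simp: continuous_on)
    then have lim: "((\<lambda>y. 2 * B * \<bar>N y - N x\<bar>) \<longlongrightarrow> 0) (at x within {c..d})" by simp
    show "((\<lambda>y. (1 / norm (y - x)) *\<^sub>R (\<Phi> y - (\<Phi> x + 0))) \<longlongrightarrow> 0) (at x within {c..d})"
    proof (rule Lim_null_comparison[OF _ lim])
      show "\<forall>\<^sub>F y in at x within {c..d}. norm ((1 / norm (y - x)) *\<^sub>R (\<Phi> y - (\<Phi> x + 0))) \<le> 2 * B * \<bar>N y - N x\<bar>"
        unfolding eventually_at_filter
      proof (intro always_eventually allI impI)
        fix y assume "y \<noteq> x" "y \<in> {c..d}"
        then show "norm ((1 / norm (y - x)) *\<^sub>R (\<Phi> y - (\<Phi> x + 0))) \<le> 2 * B * \<bar>N y - N x\<bar>"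
          using est'[OF x, of y] by (simp add: pos_divide_le_eq mult_ac)
      qed
    qed
  qed
  then obtain k where k: "\<And>x. x \<in> {c..d} \<Longrightarrow> \<Phi> x = k"
    using has_derivative_zero_constant[of "{c..d}" \<Phi>] by auto
  have "\<Phi> d = \<Phi> c" using k[of c] k[of d] cd by simp
  then have "integral {c..d} h = F d * G d - F c * G c" by (simp add: \<Phi>_def algebra_simps)
  moreover have "integral {c..d} h = integral {c..d} (\<lambda>t. f t * G t) + integral {c..d} (\<lambda>t. F t * g t)"
    unfolding h_def by (intro Henstock_Kurzweil_Integration.integral_add fG Fg)
  ultimately show ?thesis by (simp add: algebra_simps)
qed

text \<open>Banach's fixed point theorem for
  \<open>f \<mapsto> 1 + \<integral>\<integral> q f\<close>, the initial value problem
  \<open>w c = 1\<close>, \<open>w' c = 0\<close> in integrated form. The double integral has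
  operator norm at most \<open>(d - c) * integral {c..d} \<bar>q\<bar>\<close>, so
  \<open>small\<close> makes it a contraction with factor 1/4. Here \<open>v\<close> is
  \<open>w'\<close>.\<close>

lemma integral_equation_solution:
  fixes q :: "real \<Rightarrow> real"
  assumes cd: "c \<le> d" and q: "q absolutely_integrable_on {c..d}"
    and small: "(d - c) * integral {c..d} (\<lambda>x. \<bar>q x\<bar>) \<le> 1 / 4"
  obtains w v where "continuous_on {c..d} v"
    "\<And>x. x \<in> {c..d} \<Longrightarrow> v x = integral {c..x} (\<lambda>t. q t * w t)"
    "\<And>x. x \<in> {c..d} \<Longrightarrow> (w has_vector_derivative v x) (at x within {c..d})"
    "\<And>x. x \<in> {c..d} \<Longrightarrow> \<bar>w x - 1\<bar> \<le> 1 / 3"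
    "\<And>x. x \<in> {c..d} \<Longrightarrow> \<bar>v x\<bar> \<le> 4 / 3 * integral {c..d} (\<lambda>x. \<bar>q x\<bar>)"
proof -
  define \<kappa> where "\<kappa> = integral {c..d} (\<lambda>x. \<bar>q x\<bar>)"
  have qa: "(\<lambda>x. \<bar>q x\<bar>) integrable_on {c..d}"
    using q unfolding absolutely_integrable_on_def by simp
  have k0: "0 \<le> \<kappa>" unfolding \<kappa>_def by (rule Henstock_Kurzweil_Integration.integral_nonneg[OF qa]) simp
  define V where "V f s = integral {c..s} (\<lambda>t. q t * f t)" for f s
  have qf: "(\<lambda>t. q t * f t) integrable_on {c..d}" if "continuous_on {c..d} f" for f
    using absolutely_integrable_mult_continuous[OF q that] by (rule set_lebesgue_integral_eq_integral(1))
  have Vc: "continuous_on {c..d} (V f)" if "continuous_on {c..d} f" for f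
    unfolding V_def by (intro indefinite_integral_continuous_1 qf that)
  have Vb: "\<bar>V f s\<bar> \<le> \<kappa> * B"
    if f: "continuous_on {c..d} f" "\<And>t. t \<in> {c..d} \<Longrightarrow> \<bar>f t\<bar> \<le> B" and s: "s \<in> {c..d}" for f s B
  proof -
    have sub: "{c..s} \<subseteq> {c..d}" using s by auto
    have B0: "0 \<le> B" using f(2)[OF s] by linarith
    have "norm (V f s) \<le> integral {c..s} (\<lambda>t. \<bar>q t\<bar> * B)"
      unfolding V_def using f(2) sub
      by (intro integral_norm_bound_integral integrable_subinterval_real[OF qf[OF f(1)] sub]
          integrable_on_mult_left integrable_subinterval_real[OF qa sub])
         (auto simp: abs_mult intro!: mult_left_mono)
    also have "\<dots> = integral {c..s} (\<lambda>t. \<bar>q t\<bar>) * B" by simp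
    also have "\<dots> \<le> \<kappa> * B"
      unfolding \<kappa>_def using B0 sub
      by (intro mult_right_mono integral_subset_le integrable_subinterval_real[OF qa sub] qa) auto
    finally show ?thesis by simp
  qed
  have Wb: "\<bar>integral {c..x} (V f)\<bar> \<le> 1 / 4 * B"
    if f: "continuous_on {c..d} f" "\<And>t. t \<in> {c..d} \<Longrightarrow> \<bar>f t\<bar> \<le> B" and x: "x \<in> {c..d}" for f x B
  proof -
    have sub: "{c..x} \<subseteq> {c..d}" using x by auto
    have B0: "0 \<le> B" using f(2)[OF x] by linarith
    have "norm (integral {c..x} (V f)) \<le> (\<kappa> * B) * (x - c)"
      using x Vb[OF f] sub by (intro integral_bound continuous_on_subset[OF Vc[OF f(1)] sub]) auto
    also have "\<dots> \<le> (\<kappa> * B) * (d - c)" using x k0 B0 by (intro mult_left_mono) auto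
    also have "\<dots> = ((d - c) * \<kappa>) * B" by simp
    also have "\<dots> \<le> 1 / 4 * B" using small B0 unfolding \<kappa>_def by (intro mult_right_mono)
    finally show ?thesis by simp
  qed
  \<comment> \<open>Clamping to \<open>[c, d]\<close>: bounded continuous functions live on the
    whole line, so the iterates are continued by constants outside the interval.\<close>
  define p where "p x = max c (min d x)" for x
  have p: "p x \<in> {c..d}" for x using cd by (auto simp: p_def)
  have pc: "continuous_on UNIV p" unfolding p_def by (intro continuous_intros)
  define T where "T f = Bcontfun (\<lambda>x. 1 + integral {c..p x} (V (apply_bcontfun f)))" for f :: "real \<Rightarrow>\<^sub>C real"
  have fc: "continuous_on {c..d} (apply_bcontfun f)" for f :: "real \<Rightarrow>\<^sub>C real" by simp
  have T: "apply_bcontfun (T f) x = 1 + integral {c..p x} (V (apply_bcontfun f))" for f x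
  proof -
    have c1: "continuous_on {c..d} (\<lambda>x. 1 + integral {c..x} (V (apply_bcontfun f)))"
      by (intro continuous_intros indefinite_integral_continuous_1 integrable_continuous_real Vc fc)
    have "continuous_on UNIV (\<lambda>x. 1 + integral {c..p x} (V (apply_bcontfun f)))"
      by (rule continuous_on_compose2[OF c1 pc]) (rule image_subsetI[OF p])
    moreover have "bounded (range (\<lambda>x. 1 + integral {c..p x} (V (apply_bcontfun f))))"
    proof (rule bounded_subset)
      show "bounded ((\<lambda>x. 1 + integral {c..x} (V (apply_bcontfun f))) ` {c..d})"
        by (intro compact_imp_bounded compact_continuous_image c1) auto
    qed (use p in auto)
    ultimately show ?thesis unfolding T_def by (subst Bcontfun_inverse) (auto simp: bcontfun_def)
  qed
  have "dist (T f) (T g) \<le> 1 / 4 * dist f g" for f g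
  proof (rule dist_bound)
    fix x
    have Vdiff: "V (apply_bcontfun f) s - V (apply_bcontfun g) s = V (\<lambda>t. apply_bcontfun f t - apply_bcontfun g t) s"
      if "s \<in> {c..d}" for s
      unfolding V_def right_diff_distrib
      by (rule Henstock_Kurzweil_Integration.integral_diff[symmetric];
          rule integrable_subinterval_real[OF qf[OF fc]]) (use that in auto)
    have sub: "{c..p x} \<subseteq> {c..d}" using p[of x] by auto
    have Vi: "V (apply_bcontfun f) integrable_on {c..p x}" for f
      by (intro integrable_continuous_real continuous_on_subset[OF Vc[OF fc] sub])
    have "apply_bcontfun (T f) x - apply_bcontfun (T g) x
        = integral {c..p x} (\<lambda>s. V (apply_bcontfun f) s - V (apply_bcontfun g) s)"
      unfolding T using Henstock_Kurzweil_Integration.integral_diff[OF Vi[of f] Vi[of g]] by simp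
    also have "\<dots> = integral {c..p x} (V (\<lambda>t. apply_bcontfun f t - apply_bcontfun g t))"
      using sub by (intro Henstock_Kurzweil_Integration.integral_cong Vdiff) auto
    finally have "dist (apply_bcontfun (T f) x) (apply_bcontfun (T g) x)
        = \<bar>integral {c..p x} (V (\<lambda>t. apply_bcontfun f t - apply_bcontfun g t))\<bar>"
      by (simp only: dist_real_def)
    also have "\<dots> \<le> 1 / 4 * dist f g"
    proof (rule Wb[OF _ _ p])
      show "continuous_on {c..d} (\<lambda>t. apply_bcontfun f t - apply_bcontfun g t)"
        by (intro continuous_on_diff fc)
      show "\<bar>apply_bcontfun f t - apply_bcontfun g t\<bar> \<le> dist f g" for t
        using dist_bounded[of f t g] by (simp only: dist_real_def)
    qed
    finally show "dist (apply_bcontfun (T f) x) (apply_bcontfun (T g) x) \<le> 1 / 4 * dist f g" .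
  qed
  then obtain w where w: "T w = w"
    using banach_fix_type[of "1 / 4" T] by auto
  define W where "W = apply_bcontfun w"
  have W_eq: "W x = 1 + integral {c..p x} (V W)" for x
    using T[of w x] by (simp add: w W_def)
  have Wc: "continuous_on {c..d} W" unfolding W_def by simp
  have W_eq': "W x = 1 + integral {c..x} (V W)" if "x \<in> {c..d}" for x
  proof -
    have "p x = x" using that by (auto simp: p_def)
    then show ?thesis using W_eq[of x] by simp
  qed
  \<comment> \<open>The uniform distance from \<open>w\<close> to 1. The fixed point equation gives
    \<open>D \<le> (1 + D) / 4\<close>, whence the constant 1/3.\<close>
  define D where "D = dist w (const_bcontfun 1)"
  have WD: "\<bar>W x - 1\<bar> \<le> D" for x
    using dist_bounded[of w x "const_bcontfun 1"] by (simp add: D_def W_def dist_real_def const_bcontfun.rep_eq)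
  have "D \<le> 1 / 4 * (1 + D)" unfolding D_def
  proof (rule dist_bound)
    fix x
    have "\<bar>integral {c..p x} (V W)\<bar> \<le> 1 / 4 * (1 + D)"
    proof (rule Wb[OF Wc _ p])
      show "\<bar>W t\<bar> \<le> 1 + D" for t using WD[of t] by linarith
    qed
    then show "dist (apply_bcontfun w x) (apply_bcontfun (const_bcontfun 1) x) \<le> 1 / 4 * (1 + dist w (const_bcontfun 1))"
      using W_eq[of x] by (simp add: dist_real_def const_bcontfun.rep_eq W_def[symmetric] D_def[symmetric])
  qed
  then have D: "D \<le> 1 / 3" by simp
  have W1: "\<bar>W x - 1\<bar> \<le> 1 / 3" for x using WD[of x] D by linarith
  show ?thesis
  proof (rule that[of "V W" W])
    show "continuous_on {c..d} (V W)" by (rule Vc[OF Wc])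
    show "V W x = integral {c..x} (\<lambda>t. q t * W t)" for x by (rule V_def)
    show "(W has_vector_derivative V W x) (at x within {c..d})" if x: "x \<in> {c..d}" for x
    proof (rule has_vector_derivative_transform[OF x])
      show "((\<lambda>x. 1 + integral {c..x} (V W)) has_vector_derivative V W x) (at x within {c..d})"
        using integral_has_vector_derivative[OF Vc[OF Wc] x] by (auto intro!: derivative_eq_intros)
    qed (rule W_eq')
    show "\<bar>W x - 1\<bar> \<le> 1 / 3" for x by (rule W1)
    have W43: "\<bar>W x\<bar> \<le> 4 / 3" for x using W1[of x] by linarith
    show "\<bar>V W x\<bar> \<le> 4 / 3 * integral {c..d} (\<lambda>x. \<bar>q x\<bar>)" if "x \<in> {c..d}" for x
      using Vb[OF Wc W43 that] by (simp add: \<kappa>_def mult.commute)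
  qed
qed


section \<open>The maximal operator off the support of \<open>\<nu>\<close>\<close>

text \<open>Each point off the support has an open null neighbourhood, and by compactness finitely
  many of them cover the interval.\<close>

lemma emeasure_pos_var_off_support:
  assumes \<nu>: "signed_borel_measure I \<nu>" and sub: "{c..d} \<subseteq> I - signed_support I \<nu>"
  shows "{c..d} \<in> null_sets (pos_var I \<nu>)"
proof -
  have "\<exists>U. open U \<and> x \<in> U \<and> (\<forall>B\<in>rc_borel I. B \<subseteq> U \<longrightarrow> \<nu> B = 0)" if "x \<in> {c..d}" for x
  proof -
    have "x \<in> I" "x \<notin> signed_support I \<nu>" using sub that by auto
    then obtain U where "open U" "x \<in> U" "\<not> (\<exists>B\<in>rc_borel I. B \<subseteq> U \<and> \<nu> B \<noteq> 0)"
      by (auto simp: signed_support_def)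
    then show ?thesis by (intro exI[of _ U]) simp
  qed
  then have "\<exists>U. \<forall>x\<in>{c..d}. open (U x) \<and> x \<in> U x \<and> (\<forall>B\<in>rc_borel I. B \<subseteq> U x \<longrightarrow> \<nu> B = 0)"
    by (rule bchoice[OF ballI])
  then obtain U where U: "\<And>x. x \<in> {c..d} \<Longrightarrow> open (U x)" "\<And>x. x \<in> {c..d} \<Longrightarrow> x \<in> U x"
    "\<And>x B. x \<in> {c..d} \<Longrightarrow> B \<in> rc_borel I \<Longrightarrow> B \<subseteq> U x \<Longrightarrow> \<nu> B = 0"
    by blast
  have null: "U x \<in> null_sets (pos_var I \<nu>)" if x: "x \<in> {c..d}" for x
  proof -
    have meas: "U x \<in> sets borel" using U(1)[OF x] by simp
    have "emeasure (pos_var I \<nu>) (U x) = (SUP B \<in> {B \<in> rc_borel I. B \<subseteq> U x}. ennreal (\<nu> B))"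
      by (rule emeasure_pos_var[OF \<nu> meas])
    also have "\<dots> \<le> 0" by (intro SUP_least) (use U(3)[OF x] in auto)
    finally show ?thesis using meas by (auto simp: null_sets_def)
  qed
  obtain T where T: "T \<subseteq> {c..d}" "finite T" "{c..d} \<subseteq> (\<Union>x\<in>T. U x)"
    by (rule compactE_image[of "{c..d}" "{c..d}" U]) (use U(1,2) in auto)
  have "(\<Union>x\<in>T. U x) \<in> null_sets (pos_var I \<nu>)"
    using T null by (intro null_sets.finite_UN) auto
  then show ?thesis by (rule null_sets_subset[OF _ _ T(3)]) simp
qed

lemma signed_support_uminus: "signed_support I (\<lambda>B. - \<nu> B) = signed_support I \<nu>"
  by (simp add: signed_support_def)

lemma emeasure_neg_var_off_support:
  assumes "signed_borel_measure I \<nu>" "{c..d} \<subseteq> I - signed_support I \<nu>"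
  shows "{c..d} \<in> null_sets (neg_var I \<nu>)"
  unfolding neg_var_def
  by (rule emeasure_pos_var_off_support[OF signed_borel_measure_uminus[OF assms(1)]])
     (use assms(2) in \<open>simp only: signed_support_uminus\<close>)

lemma set_integral_null_set:
  fixes f :: "'a \<Rightarrow> 'b::{banach, second_countable_topology}"
  assumes "N \<in> null_sets M" "A \<subseteq> N" shows "(LINT x:A|M. f x) = 0"
proof -
  have "AE x in M. indicator A x *\<^sub>R f x = 0"
    using AE_not_in[OF assms(1)] by eventually_elim (use assms(2) in \<open>auto simp: indicator_def\<close>)
  then show ?thesis unfolding set_lebesgue_integral_def by (rule integral_eq_zero_AE)
qed

lemma dP_integral_off_support:
  assumes \<nu>: "signed_borel_measure I \<nu>" and sub: "{c..d} \<subseteq> I - signed_support I \<nu>"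
    and xy: "c \<le> x" "x \<le> y" "y \<le> d" and h: "set_integrable lborel {c..d} h"
  shows "dP_integral I \<nu> {x..<y} h = integral {x..y} h"
proof -
  have s: "{x..<y} \<subseteq> {c..d}" using xy by auto
  have "dP_integral I \<nu> {x..<y} h = (LINT t:{x..<y}|lborel. h t)"
    unfolding dP_integral_def
    by (simp add: set_integral_null_set[OF emeasure_pos_var_off_support[OF \<nu> sub] s]
        set_integral_null_set[OF emeasure_neg_var_off_support[OF \<nu> sub] s])
  also have "\<dots> = integral {x..<y} h"
    using s by (intro set_borel_integral_eq_integral set_integrable_subset[OF h]) auto
  also have "\<dots> = integral {x..y} h"
    by (rule integral_spike_set; rule negligible_subset[of "{y}"]) auto
  finally show ?thesis .
qed

text \<open>The variation function \<open>Vr\<close> is monotone and dominates the increments of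
  \<open>f\<close>, so \<open>f\<close> is continuous wherever \<open>Vr\<close> is, and a monotone
  function has only countably many discontinuities.\<close>

lemma bounded_variation_countable_discont:
  assumes bv: "bounded_variation c d f"
  shows "countable {x \<in> {c..d}. \<not> continuous (at x within {c..d}) f}"
proof -
  obtain V where V: "\<And>(n::nat) t. mono_on {..n} t \<Longrightarrow> t ` {..n} \<subseteq> {c..d} \<Longrightarrow>
      (\<Sum>i<n. cmod (f (t (Suc i)) - f (t i))) \<le> V"
    using bv unfolding bounded_variation_def by blast
  define S where "S x = {(\<Sum>i<n. cmod (f (t (Suc i)) - f (t i))) |(n::nat) t.
      mono_on {..n} t \<and> t ` {..n} \<subseteq> {c..x}}" for x
  define Vr where "Vr x = Sup (S x)" for x
  have S_bdd: "bdd_above (S x)" if "x \<le> d" for x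
  proof (rule bdd_aboveI[of _ V])
    fix s assume "s \<in> S x"
    then obtain n t where "s = (\<Sum>i<n. cmod (f (t (Suc i)) - f (t i)))" "mono_on {..n} t" "t ` {..n} \<subseteq> {c..x}"
      unfolding S_def by blast
    moreover from this(3) that have "t ` {..n} \<subseteq> {c..d}" by fastforce
    ultimately show "s \<le> V" using V by blast
  qed
  have S_ne: "S x \<noteq> {}" if "c \<le> x" for x
  proof -
    have "(\<Sum>i<0::nat. cmod (f ((\<lambda>_. c) (Suc i)) - f ((\<lambda>_. c) i))) \<in> S x"
      unfolding S_def using that
      by (intro CollectI exI[of _ "0::nat"] exI[of _ "\<lambda>_. c"]) (auto simp: mono_on_def)
    then show ?thesis by blast
  qed
  have step: "s + cmod (f y - f x) \<le> Vr y" if s: "s \<in> S x" and xy: "c \<le> x" "x \<le> y" "y \<le> d" for s x y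
  proof -
    obtain n t where t: "s = (\<Sum>i<n. cmod (f (t (Suc i)) - f (t i)))" "mono_on {..n} t" "t ` {..n} \<subseteq> {c..x}"
      using s unfolding S_def by blast
    \<comment> \<open>The partition of \<open>[c, x]\<close> continued by the points
      \<open>x\<close> and \<open>y\<close>; the extra increment from \<open>t n\<close> to
      \<open>x\<close> only adds a nonnegative term.\<close>
    define t' where "t' i = (if i \<le> n then t i else if i = Suc n then x else y)" for i
    have tx: "t i \<in> {c..x}" if "i \<le> n" for i using t(3) that by auto
    have "mono_on {..Suc (Suc n)} t'"
    proof (rule mono_onI)
      fix i j assume "i \<in> {..Suc (Suc n)}" "j \<in> {..Suc (Suc n)}" "i \<le> j"
      then show "t' i \<le> t' j"
        using mono_onD[OF t(2), of i j] tx[of i] xy by (auto simp: t'_def)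
    qed
    moreover have "t' ` {..Suc (Suc n)} \<subseteq> {c..y}"
    proof (rule image_subsetI)
      fix i assume "i \<in> {..Suc (Suc n)}"
      then show "t' i \<in> {c..y}" using tx[of i] xy by (auto simp: t'_def)
    qed
    ultimately have "(\<Sum>i<Suc (Suc n). cmod (f (t' (Suc i)) - f (t' i))) \<in> S y"
      unfolding S_def by (intro CollectI exI[of _ "Suc (Suc n)"] exI[of _ t']) simp
    then have "(\<Sum>i<Suc (Suc n). cmod (f (t' (Suc i)) - f (t' i))) \<le> Vr y"
      unfolding Vr_def using S_bdd[OF xy(3)] by (rule cSup_upper)
    moreover have "(\<Sum>i<n. cmod (f (t' (Suc i)) - f (t' i))) = s"
      unfolding t(1) by (intro sum.cong) (auto simp: t'_def)
    moreover have "cmod (f (t' (Suc (Suc n))) - f (t' (Suc n))) = cmod (f y - f x)" by (simp add: t'_def)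
    ultimately show ?thesis
      using norm_ge_zero[of "f (t' (Suc n)) - f (t' n)"] unfolding sum.lessThan_Suc by linarith
  qed
  have Vr: "cmod (f y - f x) \<le> Vr y - Vr x" if xy: "c \<le> x" "x \<le> y" "y \<le> d" for x y
  proof -
    have "Vr x \<le> Vr y - cmod (f y - f x)"
      unfolding Vr_def[of x] using step[OF _ xy] S_ne[OF xy(1)] by (intro cSup_least) (auto simp: algebra_simps)
    then show ?thesis by simp
  qed
  have "mono_on {c..d} Vr"
  proof (rule mono_onI)
    fix x y assume "x \<in> {c..d}" "y \<in> {c..d}" "x \<le> y"
    then show "Vr x \<le> Vr y" using order_trans[OF norm_ge_zero Vr[of x y]] by simp
  qed
  then have ctble: "countable {x \<in> {c..d}. \<not> continuous (at x within {c..d}) Vr}"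
    by (rule mono_on_ctble_discont)
  have "continuous (at x within {c..d}) f" if x: "x \<in> {c..d}" and cV: "continuous (at x within {c..d}) Vr" for x
  proof -
    have "((\<lambda>y. \<bar>Vr y - Vr x\<bar>) \<longlongrightarrow> \<bar>Vr x - Vr x\<bar>) (at x within {c..d})"
      using cV unfolding continuous_within by (intro tendsto_intros)
    then have lim: "((\<lambda>y. \<bar>Vr y - Vr x\<bar>) \<longlongrightarrow> 0) (at x within {c..d})" by simp
    have "((\<lambda>y. f y - f x) \<longlongrightarrow> 0) (at x within {c..d})"
    proof (rule Lim_null_comparison[OF _ lim])
      show "\<forall>\<^sub>F y in at x within {c..d}. norm (f y - f x) \<le> \<bar>Vr y - Vr x\<bar>"
        unfolding eventually_at_filter
      proof (intro always_eventually allI impI)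
        fix y assume y: "y \<in> {c..d}"
        show "norm (f y - f x) \<le> \<bar>Vr y - Vr x\<bar>"
        proof (cases "x \<le> y")
          case True
          then show ?thesis using Vr[of x y] x y by simp
        next
          case False
          then show ?thesis using Vr[of y x] x y by (simp add: norm_minus_commute)
        qed
      qed
    qed
    then show ?thesis unfolding continuous_within by (simp add: LIM_zero_iff)
  qed
  then show ?thesis by (intro countable_subset[OF _ ctble]) blast
qed

text \<open>Off the support \<open>dP\<close> is \<open>dx\<close>, so the left limits of
  \<open>u\<close> form a primitive of the continuous function \<open>u1\<close>. A function of
  bounded variation agrees with its left limits outside a countable set, which makes
  \<open>u\<close> continuously differentiable up to a null set.\<close>

lemma maximal_operator_regularity:
  assumes \<nu>: "signed_borel_measure I \<nu>" and sub: "{c..d} \<subseteq> I - signed_support I \<nu>" and cd: "c < d"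
    and u: "dP_abs_cont I \<nu> u u1" and u1: "AC_loc_deriv I u1 u1'"
  obtains U where "\<And>x. x \<in> {c..d} \<Longrightarrow> (U has_vector_derivative u1 x) (at x within {c..d})"
    "AE x in lebesgue. x \<in> {c..d} \<longrightarrow> u x = U x"
    "u1' absolutely_integrable_on {c..d}"
    "\<And>x. x \<in> {c..d} \<Longrightarrow> u1 x = u1 c + integral {c..x} u1'"
proof -
  have cdI: "{c..d} \<subseteq> I" using sub by blast
  have u1'_int: "u1' absolutely_integrable_on {c..d}"
    using u1 cdI unfolding AC_loc_deriv_def loc_integrable_def by blast
  have u1_eq: "u1 x = u1 c + integral {c..x} u1'" if x: "x \<in> {c..d}" for x
  proof (cases "c = x")
    case False
    then have "c \<in> I" "x \<in> I" "c < x" using x cdI cd by auto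
    then have "u1 x - u1 c = (LINT t:{c..x}|lebesgue. u1' t)"
      using u1 unfolding AC_loc_deriv_def by blast
    also have "\<dots> = integral {c..x} u1'"
      using x by (intro set_lebesgue_integral_eq_integral absolutely_integrable_on_subinterval[OF u1'_int]) auto
    finally show ?thesis by (simp add: algebra_simps)
  qed simp
  have u1c: "continuous_on {c..d} u1"
  proof (rule continuous_on_eq)
    show "continuous_on {c..d} (\<lambda>x. u1 c + integral {c..x} u1')"
      by (intro continuous_intros indefinite_integral_continuous_1 set_lebesgue_integral_eq_integral(1)[OF u1'_int])
  qed (rule u1_eq[symmetric])
  have u1_int: "set_integrable lborel {c..d} u1"
    using u cdI unfolding dP_abs_cont_def dP_loc_integrable_def loc_integrable_def by blast
  define U where "U x = Lim (at_left x) u" for x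
  have U_eq: "U c + integral {c..x} u1 = U x" if x: "x \<in> {c..d}" for x
  proof (cases "c = x")
    case False
    then have "c \<in> I" "x \<in> I" "c < x" using x cdI cd by auto
    then have "U x - U c = dP_integral I \<nu> {c..<x} u1"
      using u unfolding dP_abs_cont_def U_def by blast
    also have "\<dots> = integral {c..x} u1"
      using x by (intro dP_integral_off_support[OF \<nu> sub] u1_int) auto
    finally show ?thesis by (simp add: algebra_simps)
  qed simp
  have U_deriv: "(U has_vector_derivative u1 x) (at x within {c..d})" if x: "x \<in> {c..d}" for x
  proof (rule has_vector_derivative_transform[OF x])
    show "((\<lambda>x. U c + integral {c..x} u1) has_vector_derivative u1 x) (at x within {c..d})"
      using integral_has_vector_derivative[OF u1c x] by (auto intro!: derivative_eq_intros)
  qed (rule U_eq[symmetric])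
  have "bounded_variation c d u"
    using u cdI unfolding dP_abs_cont_def loc_bounded_variation_def by blast
  \<comment> \<open>At \<open>c\<close> the left limit sees only points outside
    \<open>[c, d]\<close>, so continuity within the interval says nothing about it; \<open>c\<close>
    joins the exceptional set.\<close>
  then have cnt: "countable (insert c {x \<in> {c..d}. \<not> continuous (at x within {c..d}) u})"
    using bounded_variation_countable_discont by blast
  have "insert c {x \<in> {c..d}. \<not> continuous (at x within {c..d}) u} \<in> null_sets lebesgue"
    using countable_imp_null_set_lborel[OF cnt] by (rule null_sets_completionI)
  from AE_not_in[OF this] have "AE x in lebesgue. x \<in> {c..d} \<longrightarrow> u x = U x"
  proof eventually_elim
    case (elim x)
    show ?case
    proof
      assume x: "x \<in> {c..d}"
      with elim have "continuous (at x within {c..d}) u" and cx: "c < x" by auto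
      then have "(u \<longlongrightarrow> u x) (at x within {c..d})" unfolding continuous_within by simp
      then have "(u \<longlongrightarrow> u x) (at x within {c..x})"
        by (rule tendsto_within_subset) (use x in auto)
      then have "(u \<longlongrightarrow> u x) (at_left x)" using at_within_Icc_at_left[OF cx] by simp
      then show "u x = U x" unfolding U_def by (rule tendsto_Lim[OF trivial_limit_at_left_real, symmetric])
    qed
  qed
  from that[OF U_deriv this u1'_int u1_eq] show ?thesis .
qed


section \<open>Test functions\<close>

text \<open>The term \<open>q U \<eta> w\<close> is read as \<open>v'\<close> times
  \<open>U \<eta>\<close> and integrated by parts, as is \<open>u1'\<close> times
  \<open>\<eta> w\<close>; this removes both merely integrable factors. The terms
  \<open>u1 \<eta> v\<close> cancel, and the conditions at \<open>c\<close> and \<open>d\<close>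
  remove all boundary terms.\<close>

lemma pairing_identity:
  fixes U u1 u1' q w v \<eta> \<eta>1 \<eta>2 :: "real \<Rightarrow> complex"
  assumes cd: "c \<le> d"
    and U: "\<And>x. x \<in> {c..d} \<Longrightarrow> (U has_vector_derivative u1 x) (at x within {c..d})"
    and u1': "u1' absolutely_integrable_on {c..d}"
    and u1: "\<And>x. x \<in> {c..d} \<Longrightarrow> u1 x = u1 c + integral {c..x} u1'"
    and q: "q absolutely_integrable_on {c..d}"
    and w: "\<And>x. x \<in> {c..d} \<Longrightarrow> (w has_vector_derivative v x) (at x within {c..d})"
    and v: "\<And>x. x \<in> {c..d} \<Longrightarrow> v x = integral {c..x} (\<lambda>t. q t * w t)"
    and \<eta>: "\<And>x. x \<in> {c..d} \<Longrightarrow> (\<eta> has_vector_derivative \<eta>1 x) (at x within {c..d})"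
    and \<eta>1: "\<And>x. x \<in> {c..d} \<Longrightarrow> (\<eta>1 has_vector_derivative \<eta>2 x) (at x within {c..d})"
    and \<eta>2: "continuous_on {c..d} \<eta>2"
    and bc: "\<eta> c = 0" "\<eta> d = 0" "\<eta>1 c = 0" "\<eta>1 d = 0"
  shows "integral {c..d} (\<lambda>x. (- u1' x + q x * U x) * (\<eta> x * w x))
       = integral {c..d} (\<lambda>x. U x * (- \<eta>2 x * w x - 2 * \<eta>1 x * v x))"
proof -
  have cont: "continuous_on {c..d} f" if "\<And>x. x \<in> {c..d} \<Longrightarrow> (f has_vector_derivative f' x) (at x within {c..d})"
    for f f' :: "real \<Rightarrow> complex"
    unfolding continuous_on_eq_continuous_within using has_vector_derivative_continuous[OF that] by blast
  have wc: "continuous_on {c..d} w" and Uc: "continuous_on {c..d} U" and \<eta>c: "continuous_on {c..d} \<eta>"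
    and \<eta>1c: "continuous_on {c..d} \<eta>1"
    using cont[OF w] cont[OF U] cont[OF \<eta>] cont[OF \<eta>1] by auto
  have qw: "(\<lambda>t. q t * w t) absolutely_integrable_on {c..d}"
    by (rule absolutely_integrable_mult_continuous[OF q wc])
  have vc: "continuous_on {c..d} v"
  proof (rule continuous_on_eq)
    show "continuous_on {c..d} (\<lambda>x. integral {c..x} (\<lambda>t. q t * w t))"
      by (intro indefinite_integral_continuous_1 set_lebesgue_integral_eq_integral(1)[OF qw])
  qed (rule v[symmetric])
  have u1c: "continuous_on {c..d} u1"
  proof (rule continuous_on_eq)
    show "continuous_on {c..d} (\<lambda>x. u1 c + integral {c..x} u1')"
      by (intro continuous_intros indefinite_integral_continuous_1 set_lebesgue_integral_eq_integral(1)[OF u1'])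
  qed (rule u1[symmetric])
  have v': "v x = v c + integral {c..x} (\<lambda>t. q t * w t)" if "x \<in> {c..d}" for x
    using v[OF that] v[of c] cd by simp
  have 1: "integral {c..d} (\<lambda>x. u1' x * (\<eta> x * w x)) = - integral {c..d} (\<lambda>x. u1 x * (\<eta> x * v x + \<eta>1 x * w x))"
    by (subst integration_by_parts_AC[OF cd u1' u1 has_vector_derivative_mult[OF \<eta> w]])
       (auto simp: bc intro!: continuous_intros \<eta>c vc \<eta>1c wc)
  have 2: "integral {c..d} (\<lambda>x. (q x * w x) * (U x * \<eta> x)) = - integral {c..d} (\<lambda>x. v x * (U x * \<eta>1 x + u1 x * \<eta> x))"
    by (subst integration_by_parts_AC[OF cd qw v' has_vector_derivative_mult[OF U \<eta>]])
       (auto simp: bc intro!: continuous_intros \<eta>c u1c \<eta>1c Uc)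
  \<comment> \<open>The total derivative of \<open>U * (\<eta>1 * w)\<close>. Subtracting it
    eliminates the remaining \<open>u1\<close> and doubles the term with
    \<open>\<eta>1 v\<close>.\<close>
  have 3: "((\<lambda>x. U x * (\<eta>1 x * v x + \<eta>2 x * w x) + u1 x * (\<eta>1 x * w x)) has_integral 0) {c..d}"
    using fundamental_theorem_of_calculus[OF cd has_vector_derivative_mult[OF U has_vector_derivative_mult[OF \<eta>1 w]]]
    by (simp add: bc)
  have i1: "(\<lambda>x. u1' x * (\<eta> x * w x)) integrable_on {c..d}"
    by (intro set_lebesgue_integral_eq_integral(1) absolutely_integrable_mult_continuous u1' continuous_intros \<eta>c wc)
  have i2: "(\<lambda>x. (q x * w x) * (U x * \<eta> x)) integrable_on {c..d}"
    by (intro set_lebesgue_integral_eq_integral(1) absolutely_integrable_mult_continuous qw continuous_intros \<eta>c Uc)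
  have i3: "(\<lambda>x. u1 x * (\<eta> x * v x + \<eta>1 x * w x)) integrable_on {c..d}"
    by (intro integrable_continuous_real continuous_intros u1c \<eta>c vc \<eta>1c wc)
  have i4: "(\<lambda>x. v x * (U x * \<eta>1 x + u1 x * \<eta> x)) integrable_on {c..d}"
    by (intro integrable_continuous_real continuous_intros u1c \<eta>c vc \<eta>1c Uc)
  have "integral {c..d} (\<lambda>x. (- u1' x + q x * U x) * (\<eta> x * w x))
      = integral {c..d} (\<lambda>x. (q x * w x) * (U x * \<eta> x) - u1' x * (\<eta> x * w x))"
    by (intro Henstock_Kurzweil_Integration.integral_cong) (simp add: algebra_simps)
  also have "\<dots> = integral {c..d} (\<lambda>x. u1 x * (\<eta> x * v x + \<eta>1 x * w x)) - integral {c..d} (\<lambda>x. v x * (U x * \<eta>1 x + u1 x * \<eta> x))"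
    by (simp add: Henstock_Kurzweil_Integration.integral_diff[OF i2 i1] 1 2)
  also have "\<dots> = integral {c..d} (\<lambda>x. u1 x * (\<eta> x * v x + \<eta>1 x * w x) - v x * (U x * \<eta>1 x + u1 x * \<eta> x))"
    by (rule Henstock_Kurzweil_Integration.integral_diff[OF i3 i4, symmetric])
  also have "\<dots> = integral {c..d} (\<lambda>x. u1 x * (\<eta> x * v x + \<eta>1 x * w x) - v x * (U x * \<eta>1 x + u1 x * \<eta> x)
       - (U x * (\<eta>1 x * v x + \<eta>2 x * w x) + u1 x * (\<eta>1 x * w x)))"
    using Henstock_Kurzweil_Integration.integral_diff[OF Henstock_Kurzweil_Integration.integrable_diff[OF i3 i4] has_integral_integrable[OF 3]]
    by (simp only: integral_unique[OF 3] diff_0_right)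
  also have "\<dots> = integral {c..d} (\<lambda>x. U x * (- \<eta>2 x * w x - 2 * \<eta>1 x * v x))"
    by (intro Henstock_Kurzweil_Integration.integral_cong) (simp add: algebra_simps)
  finally show ?thesis .
qed

section \<open>Functions on a subinterval as elements of \<open>L2 I\<close>\<close>

lemma L2_inner_zero_ext_subset:
  assumes "I \<in> sets lebesgue" "J \<in> sets lebesgue" "J \<subseteq> I"
  shows "L2_inner I f (zero_ext J g) = L2_inner J f g"
proof -
  have "L2_inner I f (zero_ext J g) = L2_inner J (zero_ext I f) g"
    by (rule trans[OF L2_inner_zero_ext_left[OF assms(1), symmetric] L2_inner_zero_ext_right[OF assms(2)]])
  also have "\<dots> = L2_inner J f g"
    unfolding L2_inner_def using assms
    by (intro Bochner_Integration.integral_cong) (auto simp: zero_ext_def)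
  finally show ?thesis .
qed

lemma L2_norm_zero_ext_subset:
  assumes "I \<in> sets lebesgue" "J \<in> sets lebesgue" "J \<subseteq> I"
  shows "L2_norm I (zero_ext J f) = L2_norm J f"
proof -
  have "zero_ext I (zero_ext J f) = zero_ext J f"
    by (rule ext) (use assms(3) in \<open>auto simp: zero_ext_def\<close>)
  then show ?thesis
    using L2_norm_zero_ext[OF assms(1), of "zero_ext J f"] L2_norm_zero_ext[OF assms(2), of f] by simp
qed

lemma L2_zero_ext_subset:
  assumes "I \<in> sets lebesgue" "J \<in> sets lebesgue" "f \<in> L2 J"
  shows "zero_ext J f \<in> L2 I"
  using L2_zero_ext[OF assms(2), of f] L2_subset[OF assms(1)] assms(3) by blast

lemma L2_restrict:
  assumes I: "I \<in> sets lebesgue" "J \<in> sets lebesgue" "J \<subseteq> I" and f: "f \<in> L2 I"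
  shows "f \<in> L2 J"
proof -
  have "zero_ext I f \<in> L2 J" using L2_zero_ext[OF I(1)] L2_subset[OF I(2)] f by blast
  moreover have "(zero_ext I f \<in> L2 J) = (f \<in> L2 J)"
    unfolding L2_def mem_Collect_eq using I
    by (intro arg_cong2[of _ _ _ _ "(\<and>)"] measurable_cong Bochner_Integration.integrable_cong)
       (auto simp: zero_ext_def)
  ultimately show ?thesis by simp
qed

lemma continuous_L2:
  assumes "continuous_on {c..d::real} f" shows "f \<in> L2 {c..d}"
proof -
  have "f \<in> borel_measurable (lebesgue_on {c..d})"
    using assms by (rule continuous_imp_measurable_on_sets_lebesgue) simp
  moreover have "integrable (lebesgue_on {c..d}) (\<lambda>x. (cmod (f x))\<^sup>2)"
    using assms by (intro continuous_imp_integrable_real continuous_intros)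
  ultimately show ?thesis by (simp add: L2_def)
qed

lemma L2_norm_continuous:
  assumes "continuous_on {c..d::real} f" shows "(L2_norm {c..d} f)\<^sup>2 = integral {c..d} (\<lambda>x. (cmod (f x))\<^sup>2)"
proof -
  have "(L2_norm {c..d} f)\<^sup>2 = (LINT x|lebesgue_on {c..d}. (cmod (f x))\<^sup>2)"
    unfolding L2_norm_def by simp
  also have "\<dots> = integral {c..d} (\<lambda>x. (cmod (f x))\<^sup>2)"
    using assms by (intro lebesgue_integral_eq_integral continuous_imp_integrable_real continuous_intros) auto
  finally show ?thesis .
qed

lemma ae_eq_restrict:
  assumes "I \<in> sets lebesgue" "J \<in> sets lebesgue" "J \<subseteq> I" "ae_eq I f g" shows "ae_eq J f g"
proof -
  have "AE x in lebesgue. x \<in> I \<longrightarrow> f x = g x"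
    using assms by (simp add: ae_eq_def AE_restrict_space_iff)
  then have "AE x in lebesgue. x \<in> J \<longrightarrow> f x = g x"
    by eventually_elim (use assms(3) in blast)
  then show ?thesis using assms by (simp add: ae_eq_def AE_restrict_space_iff)
qed

text \<open>Every element of \<open>H\<close> lies in the maximal operator and is therefore regular
  on \<open>[c, d]\<close>, so \<open>pair\<close> puts the extended functions into the adjoint of
  \<open>H\<close>, which is \<open>H\<close> itself. Invariance under \<open>cnj\<close> reconciles
  the bilinear identity \<open>pair\<close> with an inner product that conjugates its second
  argument.\<close>

lemma test_pair_in_operator:
  fixes \<phi> \<psi> :: "real \<Rightarrow> complex"
  assumes I: "I \<in> sets lebesgue" and \<nu>: "signed_borel_measure I \<nu>"
    and sub: "{c..d} \<subseteq> I - signed_support I \<nu>" and cd: "c < d"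
    and H: "self_adjoint_realization I \<nu> q H" and q: "q absolutely_integrable_on {c..d}"
    and \<phi>: "continuous_on {c..d} \<phi>" "\<And>x. cnj (\<phi> x) = \<phi> x" and \<psi>: "continuous_on {c..d} \<psi>" "\<And>x. cnj (\<psi> x) = \<psi> x"
    and pair: "\<And>U u1 u1'. (\<And>x. x \<in> {c..d} \<Longrightarrow> (U has_vector_derivative u1 x) (at x within {c..d})) \<Longrightarrow>
        u1' absolutely_integrable_on {c..d} \<Longrightarrow> (\<And>x. x \<in> {c..d} \<Longrightarrow> u1 x = u1 c + integral {c..x} u1') \<Longrightarrow>
        integral {c..d} (\<lambda>x. (- u1' x + complex_of_real (q x) * U x) * \<phi> x) = integral {c..d} (\<lambda>x. U x * \<psi> x)"
  shows "(zero_ext {c..d} \<phi>, zero_ext {c..d} \<psi>) \<in> H"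
proof -
  have J: "{c..d} \<in> sets lebesgue" and JI: "{c..d} \<subseteq> I" using sub by auto
  have sa: "adjoint_graph I H = H" and Hmax: "H \<subseteq> maximal_operator I \<nu> q"
    using H by (auto simp: self_adjoint_realization_def self_adjoint_def)
  have "L2_inner I F (zero_ext {c..d} \<phi>) = L2_inner I f (zero_ext {c..d} \<psi>)" if fF: "(f, F) \<in> H" for f F
  proof -
    have "(f, F) \<in> maximal_operator I \<nu> q" using fF Hmax by blast
    then obtain u u1 u1' where L: "f \<in> L2 I" "F \<in> L2 I" and u: "ae_eq I f u" "dP_abs_cont I \<nu> u u1"
      "AC_loc_deriv I u1 u1'" "ae_eq I F (\<lambda>x. - u1' x + complex_of_real (q x) * u x)"
      unfolding maximal_operator_def by blast
    obtain U where U: "\<And>x. x \<in> {c..d} \<Longrightarrow> (U has_vector_derivative u1 x) (at x within {c..d})"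
      and uU: "AE x in lebesgue. x \<in> {c..d} \<longrightarrow> u x = U x"
      and u1': "u1' absolutely_integrable_on {c..d}"
      and u1: "\<And>x. x \<in> {c..d} \<Longrightarrow> u1 x = u1 c + integral {c..x} u1'"
      by (rule maximal_operator_regularity[OF \<nu> sub cd u(2,3)]) (rule that)
    have Uc: "continuous_on {c..d} U"
      unfolding continuous_on_eq_continuous_within using has_vector_derivative_continuous[OF U] by blast
    have uU': "ae_eq {c..d} u U" using uU by (simp add: ae_eq_def AE_restrict_space_iff)
    have fU: "ae_eq {c..d} f U"
      using ae_eq_trans[OF ae_eq_restrict[OF I J JI u(1)] uU'] .
    have FU: "ae_eq {c..d} F (\<lambda>x. - u1' x + complex_of_real (q x) * U x)"
      using ae_eq_restrict[OF I J JI u(4)] uU' unfolding ae_eq_def by eventually_elim simp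
    have qc: "(\<lambda>x. complex_of_real (q x)) absolutely_integrable_on {c..d}"
      using absolutely_integrable_linear[OF q bounded_linear_of_real] by (simp add: o_def)
    have "(\<lambda>x. - u1' x) absolutely_integrable_on {c..d}"
      using absolutely_integrable_mult_continuous[OF u1', of "\<lambda>_. - 1"] by simp
    then have "(\<lambda>x. (- u1' x + complex_of_real (q x) * U x) * \<phi> x) absolutely_integrable_on {c..d}"
      by (rule absolutely_integrable_mult_continuous[OF set_integral_add(1)[OF _ absolutely_integrable_mult_continuous[OF qc Uc]] \<phi>(1)])
    then have int1: "integrable (lebesgue_on {c..d}) (\<lambda>x. (- u1' x + complex_of_real (q x) * U x) * \<phi> x)"
      by (simp add: integrable_restrict_space set_integrable_def)
    have int2: "integrable (lebesgue_on {c..d}) (\<lambda>x. U x * \<psi> x)"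
      by (intro continuous_imp_integrable_real continuous_intros Uc \<psi>)
    have "L2_inner I F (zero_ext {c..d} \<phi>) = L2_inner {c..d} F \<phi>"
      by (rule L2_inner_zero_ext_subset[OF I J JI])
    also have "\<dots> = (LINT x|lebesgue_on {c..d}. (- u1' x + complex_of_real (q x) * U x) * \<phi> x)"
      unfolding L2_inner_def
    proof (rule integral_cong_AE)
      show "(\<lambda>x. F x * cnj (\<phi> x)) \<in> borel_measurable (lebesgue_on {c..d})"
        by (intro L2_mult_measurable L2_restrict[OF I J JI L(2)] continuous_L2 \<phi>)
      show "AE x in lebesgue_on {c..d}. F x * cnj (\<phi> x) = (- u1' x + complex_of_real (q x) * U x) * \<phi> x"
        using FU unfolding ae_eq_def by eventually_elim (simp add: \<phi>)
    qed (use int1 in auto)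
    also have "\<dots> = integral {c..d} (\<lambda>x. (- u1' x + complex_of_real (q x) * U x) * \<phi> x)"
      by (rule lebesgue_integral_eq_integral[OF int1 J])
    also have "\<dots> = integral {c..d} (\<lambda>x. U x * \<psi> x)" by (rule pair[OF U u1' u1])
    also have "\<dots> = (LINT x|lebesgue_on {c..d}. U x * \<psi> x)"
      by (rule lebesgue_integral_eq_integral[OF int2 J, symmetric])
    also have "\<dots> = L2_inner {c..d} f \<psi>"
      unfolding L2_inner_def
    proof (rule integral_cong_AE)
      show "(\<lambda>x. f x * cnj (\<psi> x)) \<in> borel_measurable (lebesgue_on {c..d})"
        by (intro L2_mult_measurable L2_restrict[OF I J JI L(1)] continuous_L2 \<psi>)
      show "AE x in lebesgue_on {c..d}. U x * \<psi> x = f x * cnj (\<psi> x)"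
        using fU unfolding ae_eq_def by eventually_elim (simp add: \<psi>)
    qed (use int2 in auto)
    also have "\<dots> = L2_inner I f (zero_ext {c..d} \<psi>)"
      by (rule L2_inner_zero_ext_subset[OF I J JI, symmetric])
    finally show ?thesis .
  qed
  then have "(zero_ext {c..d} \<phi>, zero_ext {c..d} \<psi>) \<in> adjoint_graph I H"
    unfolding adjoint_graph_def using L2_zero_ext_subset[OF I J] continuous_L2 \<phi> \<psi> by auto
  then show ?thesis using sa by simp
qed

text \<open>The two expressions are the first and second derivative of the cutoff
  \<open>((x - c) * (d - x))\<^sup>2\<close>. With \<open>s = x - c\<close> and
  \<open>t = d - x\<close> the bounds are homogeneous in \<open>s, t \<ge> 0\<close> and follow from
  \<open>s t \<le> (s + t)\<^sup>2\<close> and \<open>\<bar>t - s\<bar> \<le> s + t\<close>.\<close>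

lemma cutoff_bounds:
  fixes c d x :: real
  assumes x: "x \<in> {c..d}"
  shows "\<bar>2 * (x - c) * (d - x) * (c + d - 2 * x)\<bar> \<le> 2 * (d - c) ^ 3"
    and "\<bar>2 * (c + d - 2 * x)\<^sup>2 - 4 * (x - c) * (d - x)\<bar> \<le> 6 * (d - c)\<^sup>2"
proof -
  define s where "s = x - c" define t where "t = d - x"
  have st: "0 \<le> s" "0 \<le> t" using x by (auto simp: s_def t_def)
  have eq: "x - c = s" "d - x = t" "c + d - 2 * x = t - s" "d - c = s + t" by (auto simp: s_def t_def)
  have 1: "s * t \<le> (s + t)\<^sup>2" using st mult_nonneg_nonneg[OF st] by (simp add: power2_sum)
  have 2: "(t - s)\<^sup>2 \<le> (s + t)\<^sup>2" using mult_nonneg_nonneg[OF st] by (simp add: power2_sum power2_diff)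
  have "\<bar>2 * s * t * (t - s)\<bar> = 2 * (s * t) * \<bar>t - s\<bar>" using st by (simp add: abs_mult)
  also have "\<dots> \<le> 2 * (s + t)\<^sup>2 * (s + t)" using 1 st by (intro mult_mono) auto
  also have "\<dots> = 2 * (s + t) ^ 3" by (simp add: power3_eq_cube power2_eq_square)
  finally show "\<bar>2 * (x - c) * (d - x) * (c + d - 2 * x)\<bar> \<le> 2 * (d - c) ^ 3" unfolding eq .
  have "\<bar>2 * (t - s)\<^sup>2 - 4 * (s * t)\<bar> \<le> 6 * (s + t)\<^sup>2"
    using 1 2 mult_nonneg_nonneg[OF st] zero_le_power2[of "t - s"] by (simp only: abs_le_iff) linarith
  then show "\<bar>2 * (c + d - 2 * x)\<^sup>2 - 4 * (x - c) * (d - x)\<bar> \<le> 6 * (d - c)\<^sup>2"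
    unfolding eq by (simp only: mult.assoc)
qed

text \<open>For a solution \<open>w\<close> of \<open>w'' = q w\<close> and a cutoff \<open>\<eta>\<close>, the function \<open>\<eta> w\<close> satisfies
  \<open>- (\<eta> w)'' + q \<eta> w = - \<eta>'' w - 2 \<eta>' w'\<close>, in which the possibly singular \<open>q\<close> has disappeared.\<close>

lemma test_function_exists:
  assumes I: "I \<in> sets lebesgue" and \<nu>: "signed_borel_measure I \<nu>"
    and sub: "{c..d} \<subseteq> I - signed_support I \<nu>" and cd: "c < d"
    and H: "self_adjoint_realization I \<nu> q H" and q: "q absolutely_integrable_on {c..d}"
    and small: "(d - c) * integral {c..d} (\<lambda>x. \<bar>q x\<bar>) \<le> 1 / 4"
  obtains \<phi> \<psi> where "(\<phi>, \<psi>) \<in> H" "\<And>x. x \<notin> {c..d} \<Longrightarrow> \<phi> x = 0" "\<And>x. x \<notin> {c..d} \<Longrightarrow> \<psi> x = 0"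
    "(d - c) ^ 9 / 294912 \<le> (L2_norm I \<phi>)\<^sup>2" "(L2_norm I \<psi>)\<^sup>2 \<le> 100 * (d - c) ^ 5"
proof -
  have J: "{c..d} \<in> sets lebesgue" and JI: "{c..d} \<subseteq> I" using sub by auto
  obtain w v where vc: "continuous_on {c..d} v"
    and v: "\<And>x. x \<in> {c..d} \<Longrightarrow> v x = integral {c..x} (\<lambda>t. q t * w t)"
    and w: "\<And>x. x \<in> {c..d} \<Longrightarrow> (w has_vector_derivative v x) (at x within {c..d})"
    and wb: "\<And>x. x \<in> {c..d} \<Longrightarrow> \<bar>w x - 1\<bar> \<le> 1 / 3"
    and vb: "\<And>x. x \<in> {c..d} \<Longrightarrow> \<bar>v x\<bar> \<le> 4 / 3 * integral {c..d} (\<lambda>x. \<bar>q x\<bar>)"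
    by (rule integral_equation_solution[OF less_imp_le[OF cd] q small]) (rule that)
  have wc: "continuous_on {c..d} w"
    unfolding continuous_on_eq_continuous_within using has_vector_derivative_continuous[OF w] by blast
  define \<eta> where "\<eta> x = ((x - c) * (d - x))\<^sup>2" for x
  define \<eta>1 where "\<eta>1 x = 2 * (x - c) * (d - x) * (c + d - 2 * x)" for x
  define \<eta>2 where "\<eta>2 x = 2 * (c + d - 2 * x)\<^sup>2 - 4 * (x - c) * (d - x)" for x
  define \<phi> where "\<phi> x = \<eta> x * w x" for x
  define \<psi> where "\<psi> x = - \<eta>2 x * w x - 2 * \<eta>1 x * v x" for x
  have \<eta>': "(\<eta> has_vector_derivative \<eta>1 x) (at x within {c..d})" for x
    unfolding \<eta>_def[abs_def] \<eta>1_def has_real_derivative_iff_has_vector_derivative[symmetric]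
    by (auto intro!: derivative_eq_intros simp: algebra_simps power2_eq_square)
  have \<eta>1': "(\<eta>1 has_vector_derivative \<eta>2 x) (at x within {c..d})" for x
    unfolding \<eta>1_def[abs_def] \<eta>2_def has_real_derivative_iff_has_vector_derivative[symmetric]
    by (auto intro!: derivative_eq_intros simp: algebra_simps power2_eq_square)
  have \<eta>c: "continuous_on {c..d} \<eta>" "continuous_on {c..d} \<eta>1" "continuous_on {c..d} \<eta>2"
    unfolding \<eta>_def[abs_def] \<eta>1_def[abs_def] \<eta>2_def[abs_def] by (intro continuous_intros)+
  have \<phi>c: "continuous_on {c..d} \<phi>" unfolding \<phi>_def[abs_def] by (intro continuous_intros \<eta>c wc)
  have \<psi>c: "continuous_on {c..d} \<psi>" unfolding \<psi>_def[abs_def] by (intro continuous_intros \<eta>c wc vc)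
  have of_real_deriv: "((\<lambda>x. complex_of_real (f x)) has_vector_derivative complex_of_real f') F"
    if "(f has_vector_derivative f') F" for f f' F
    by (rule bounded_linear.has_vector_derivative[OF bounded_linear_of_real that])
  have inH: "(zero_ext {c..d} (\<lambda>x. complex_of_real (\<phi> x)), zero_ext {c..d} (\<lambda>x. complex_of_real (\<psi> x))) \<in> H"
  proof (rule test_pair_in_operator[OF I \<nu> sub cd H q])
    fix U u1 u1' :: "real \<Rightarrow> complex"
    assume U: "\<And>x. x \<in> {c..d} \<Longrightarrow> (U has_vector_derivative u1 x) (at x within {c..d})"
      and u1': "u1' absolutely_integrable_on {c..d}" and u1: "\<And>x. x \<in> {c..d} \<Longrightarrow> u1 x = u1 c + integral {c..x} u1'"
    have qc: "(\<lambda>x. complex_of_real (q x)) absolutely_integrable_on {c..d}"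
      using absolutely_integrable_linear[OF q bounded_linear_of_real] by (simp add: o_def)
    have vcplx: "complex_of_real (v x) = integral {c..x} (\<lambda>t. complex_of_real (q t) * complex_of_real (w t))"
      if x: "x \<in> {c..d}" for x
    proof -
      have "(\<lambda>t. q t * w t) integrable_on {c..d}"
        by (intro set_lebesgue_integral_eq_integral(1) absolutely_integrable_mult_continuous q wc)
      then have "(\<lambda>t. q t * w t) integrable_on {c..x}"
        using x by (elim integrable_subinterval_real) auto
      from integral_linear[OF this bounded_linear_of_real[where 'a = complex]]
      show ?thesis using v[OF x] by (simp add: o_def)
    qed
    have "integral {c..d} (\<lambda>x. (- u1' x + complex_of_real (q x) * U x) * (complex_of_real (\<eta> x) * complex_of_real (w x)))
       = integral {c..d} (\<lambda>x. U x * (- complex_of_real (\<eta>2 x) * complex_of_real (w x) - 2 * complex_of_real (\<eta>1 x) * complex_of_real (v x)))"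
      using cd
      by (intro pairing_identity[OF _ U u1' u1 qc of_real_deriv[OF w] vcplx of_real_deriv[OF \<eta>'] of_real_deriv[OF \<eta>1']])
         (auto intro!: continuous_intros \<eta>c simp: \<eta>_def \<eta>1_def)
    then show "integral {c..d} (\<lambda>x. (- u1' x + complex_of_real (q x) * U x) * complex_of_real (\<phi> x))
        = integral {c..d} (\<lambda>x. U x * complex_of_real (\<psi> x))"
      by (simp add: \<phi>_def \<psi>_def)
  qed (auto intro!: continuous_intros \<phi>c \<psi>c)
  define l where "l = d - c"
  have l: "0 < l" using cd by (simp add: l_def)
  have norm_sq: "(L2_norm I (zero_ext {c..d} (\<lambda>x. complex_of_real (h x))))\<^sup>2 = integral {c..d} (\<lambda>x. (h x)\<^sup>2)"
    if "continuous_on {c..d} h" for h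
  proof -
    have "continuous_on {c..d} (\<lambda>x. complex_of_real (h x))" using that by (intro continuous_intros)
    from L2_norm_continuous[OF this] show ?thesis by (simp add: L2_norm_zero_ext_subset[OF I J JI])
  qed
  \<comment> \<open>On the middle half \<open>\<eta> \<ge> (l / 4) ^ 4 = l ^ 4 / 256\<close> and
    \<open>w \<ge> 2 / 3\<close>, so \<open>\<phi> \<ge> l ^ 4 / 384\<close>; squaring and
    multiplying by the length \<open>l / 2\<close> gives the denominator
    \<open>2 * 384\<^sup>2 = 294912\<close>.\<close>
  have lower: "l ^ 9 / 294912 \<le> integral {c..d} (\<lambda>x. (\<phi> x)\<^sup>2)"
  proof -
    have mid: "{c + l / 4..d - l / 4} \<subseteq> {c..d}" using l by auto
    have "l ^ 9 / 294912 = (l / 2) * (l ^ 4 / 384)\<^sup>2" by (simp add: power2_eq_square) (simp add: eval_nat_numeral)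
    also have "\<dots> = integral {c + l / 4..d - l / 4} (\<lambda>x. (l ^ 4 / 384)\<^sup>2)"
      using l by (simp add: l_def field_simps)
    also have "\<dots> \<le> integral {c + l / 4..d - l / 4} (\<lambda>x. (\<phi> x)\<^sup>2)"
    proof (rule integral_le)
      show "(\<lambda>x. (\<phi> x)\<^sup>2) integrable_on {c + l / 4..d - l / 4}"
        by (intro integrable_continuous_real continuous_on_power continuous_on_subset[OF \<phi>c mid])
      fix x assume x: "x \<in> {c + l / 4..d - l / 4}"
      have "(l / 4) * (l / 4) \<le> (x - c) * (d - x)" using x l by (intro mult_mono) auto
      then have "((l / 4) * (l / 4))\<^sup>2 \<le> \<eta> x" unfolding \<eta>_def using l by (intro power_mono) auto
      then have "l ^ 4 / 256 \<le> \<eta> x" by (simp add: eval_nat_numeral)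
      moreover have "2 / 3 \<le> w x" using wb[OF subsetD[OF mid x]] by linarith
      moreover have "0 \<le> \<eta> x" by (simp add: \<eta>_def)
      ultimately have "(l ^ 4 / 256) * (2 / 3) \<le> \<phi> x"
        unfolding \<phi>_def by (intro mult_mono) simp_all
      then have "l ^ 4 / 384 \<le> \<phi> x" by simp
      then show "(l ^ 4 / 384)\<^sup>2 \<le> (\<phi> x)\<^sup>2" using l by (intro power_mono) auto
    qed (rule integrable_const_ivl)
    also have "\<dots> \<le> integral {c..d} (\<lambda>x. (\<phi> x)\<^sup>2)"
    proof (rule integral_subset_le[OF mid])
      show "(\<lambda>x. (\<phi> x)\<^sup>2) integrable_on {c + l / 4..d - l / 4}"
        by (intro integrable_continuous_real continuous_on_power continuous_on_subset[OF \<phi>c mid])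
      show "(\<lambda>x. (\<phi> x)\<^sup>2) integrable_on {c..d}"
        by (intro integrable_continuous_real continuous_on_power \<phi>c)
    qed simp
    finally show ?thesis .
  qed
  \<comment> \<open>\<open>\<bar>\<eta>2 w\<bar>\<close> contributes at most
    \<open>8 l\<^sup>2\<close>, and \<open>2 \<bar>\<eta>1 v\<bar>\<close> at most
    \<open>4 / 3 l\<^sup>2\<close> because \<open>small\<close> absorbs the integral of
    \<open>\<bar>q\<bar>\<close>; the sum is rounded up to \<open>10 l\<^sup>2\<close>.\<close>
  have upper: "integral {c..d} (\<lambda>x. (\<psi> x)\<^sup>2) \<le> 100 * l ^ 5"
  proof -
    have "integral {c..d} (\<lambda>x. (\<psi> x)\<^sup>2) \<le> integral {c..d} (\<lambda>x. (10 * l\<^sup>2)\<^sup>2)"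
    proof (rule integral_le)
      show "(\<lambda>x. (\<psi> x)\<^sup>2) integrable_on {c..d}"
        by (intro integrable_continuous_real continuous_intros \<psi>c)
      fix x assume x: "x \<in> {c..d}"
      have e1: "\<bar>\<eta>1 x\<bar> \<le> 2 * l ^ 3" and e2: "\<bar>\<eta>2 x\<bar> \<le> 6 * l\<^sup>2"
        unfolding \<eta>1_def \<eta>2_def l_def by (rule cutoff_bounds[OF x])+
      have w43: "\<bar>w x\<bar> \<le> 4 / 3" using wb[OF x] by linarith
      have "\<bar>\<eta>2 x * w x\<bar> \<le> (6 * l\<^sup>2) * (4 / 3)"
        unfolding abs_mult by (rule mult_mono[OF e2 w43]) simp_all
      moreover have "\<bar>\<eta>1 x * v x\<bar> \<le> (2 * l ^ 3) * (4 / 3 * integral {c..d} (\<lambda>x. \<bar>q x\<bar>))"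
        unfolding abs_mult by (rule mult_mono[OF e1 vb[OF x]]) (use l in simp_all)
      moreover have "(2 * l ^ 3) * (4 / 3 * integral {c..d} (\<lambda>x. \<bar>q x\<bar>)) = 8 / 3 * l\<^sup>2 * (l * integral {c..d} (\<lambda>x. \<bar>q x\<bar>))"
        by (simp add: power3_eq_cube power2_eq_square)
      moreover have "8 / 3 * l\<^sup>2 * (l * integral {c..d} (\<lambda>x. \<bar>q x\<bar>)) \<le> 8 / 3 * l\<^sup>2 * (1 / 4)"
        using small unfolding l_def by (intro mult_left_mono) auto
      moreover have "\<bar>\<psi> x\<bar> \<le> \<bar>\<eta>2 x * w x\<bar> + 2 * \<bar>\<eta>1 x * v x\<bar>"
        unfolding \<psi>_def by (simp only: mult_minus_left mult.assoc)
      ultimately have "\<bar>\<psi> x\<bar> \<le> 10 * l\<^sup>2" using zero_le_power2[of l] by linarith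
      from power_mono[OF this abs_ge_zero, of 2] show "(\<psi> x)\<^sup>2 \<le> (10 * l\<^sup>2)\<^sup>2" by simp
    qed (rule integrable_const_ivl)
    also have "\<dots> = l * (10 * l\<^sup>2)\<^sup>2" using l by (simp add: l_def)
    also have "\<dots> = 100 * l ^ 5" by (simp add: eval_nat_numeral)
    finally show ?thesis .
  qed
  show ?thesis
  proof (rule that[OF inH])
    show "(d - c) ^ 9 / 294912 \<le> (L2_norm I (zero_ext {c..d} (\<lambda>x. complex_of_real (\<phi> x))))\<^sup>2"
      unfolding norm_sq[OF \<phi>c] using lower by (simp add: l_def)
    show "(L2_norm I (zero_ext {c..d} (\<lambda>x. complex_of_real (\<psi> x))))\<^sup>2 \<le> 100 * (d - c) ^ 5"
      unfolding norm_sq[OF \<psi>c] using upper by (simp add: l_def)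
  qed (auto simp: zero_ext_def)
qed


section \<open>Components with bounded mean of \<open>q\<close>\<close>

text \<open>Pigeonhole: the interval holds \<open>N\<close> disjoint closed pieces of length
  \<open>l\<close>, one in each block of length \<open>2 l\<close>, and \<open>N\<close> exceeds
  half of \<open>(\<beta> - \<alpha>) / (2 l)\<close>. If every piece carried at least
  \<open>8 M l\<close>, the total would exceed \<open>M * (\<beta> - \<alpha>)\<close>.\<close>

lemma short_interval_small_integral:
  fixes q :: "real \<Rightarrow> real"
  assumes M: "0 < M" and l: "0 < l" "2 * l \<le> \<beta> - \<alpha>"
    and q: "\<And>x y. {x..y} \<subseteq> {\<alpha><..<\<beta>} \<Longrightarrow> set_integrable lebesgue {x..y} q"
    and total: "(\<integral>\<^sup>+x\<in>{\<alpha><..<\<beta>}. ennreal (q x) \<partial>lebesgue) \<le> ennreal (M * (\<beta> - \<alpha>))"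
  obtains c where "{c..c + l} \<subseteq> {\<alpha><..<\<beta>}"
    "(\<integral>\<^sup>+x\<in>{c..c + l}. ennreal (q x) \<partial>lebesgue) \<le> ennreal (8 * M * l)"
proof -
  define y where "y = (\<beta> - \<alpha>) / (2 * l)"
  define N where "N = nat \<lfloor>y\<rfloor>"
  have "1 \<le> y" using l by (simp add: y_def)
  then have "1 \<le> \<lfloor>y\<rfloor>" by (simp add: le_floor_iff)
  then have N: "real N = of_int \<lfloor>y\<rfloor>" by (simp add: N_def)
  have N_le: "real N \<le> y" unfolding N by (rule of_int_floor_le)
  have "1 \<le> real N" using \<open>1 \<le> \<lfloor>y\<rfloor>\<close> unfolding N by simp
  moreover have "y < real N + 1" unfolding N by linarith
  ultimately have N_ge: "y < 2 * real N" by linarith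
  have yl: "y * (2 * l) = \<beta> - \<alpha>" using l by (simp add: y_def)
  \<comment> \<open>Each piece is centred in its block, with a margin \<open>l / 2\<close> on both
    sides: pieces do not touch each other, and the outer ones stay compactly inside the open
    interval.\<close>
  define a where "a i = \<alpha> + 2 * l * real i + l / 2" for i :: nat
  define J where "J i = {a i..a i + l}" for i
  have sub: "J i \<subseteq> {\<alpha><..<\<beta>}" if "i < N" for i
  proof -
    have "real i + 1 \<le> real N" using that by linarith
    then have "(real i + 1) * (2 * l) \<le> y * (2 * l)" using N_le l by (intro mult_right_mono) auto
    then have "2 * l * real i + 2 * l \<le> \<beta> - \<alpha>" unfolding yl by (simp add: algebra_simps)
    moreover have "0 \<le> 2 * l * real i" using l by simp
    ultimately have "\<alpha> < a i" "a i + l < \<beta>" using l unfolding a_def by linarith+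
    then show ?thesis unfolding J_def by auto
  qed
  have less: "a i + l < a j" if "i < j" for i j
  proof -
    have "(real i + 1) * (2 * l) \<le> real j * (2 * l)" using that l by (intro mult_right_mono) auto
    then show ?thesis using l unfolding a_def by (simp add: algebra_simps)
  qed
  have "disjoint_family_on J {..<N}"
    unfolding disjoint_family_on_def
  proof (intro ballI impI)
    fix i j :: nat assume "i \<noteq> j"
    then consider "i < j" | "j < i" by linarith
    then show "J i \<inter> J j = {}"
    proof cases
      case 1
      then show ?thesis using less[OF 1] unfolding J_def by auto
    next
      case 2
      then show ?thesis using less[OF 2] unfolding J_def by auto
    qed
  qed
  then have disj: "(\<Sum>i<N. indicator (J i) x :: ennreal) = indicator (\<Union>i<N. J i) x" for x
    by (intro indicator_UN_disjoint[symmetric]) auto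
  have "\<exists>i<N. (\<integral>\<^sup>+x\<in>J i. ennreal (q x) \<partial>lebesgue) \<le> ennreal (8 * M * l)"
  proof (rule ccontr)
    assume "\<not> ?thesis"
    then have big: "ennreal (8 * M * l) \<le> (\<integral>\<^sup>+x\<in>J i. ennreal (q x) \<partial>lebesgue)" if "i < N" for i
      using that by (auto simp: not_le intro: less_imp_le)
    have meas: "(\<lambda>x. ennreal (q x) * indicator (J i) x) \<in> borel_measurable lebesgue" if "i < N" for i
    proof -
      have "(\<lambda>x. indicator (J i) x *\<^sub>R q x) \<in> borel_measurable lebesgue"
        using q[OF sub[OF that, unfolded J_def]] unfolding J_def set_integrable_def by auto
      then have "(\<lambda>x. ennreal (indicator (J i) x *\<^sub>R q x)) \<in> borel_measurable lebesgue" by simp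
      moreover have "(\<lambda>x. ennreal (indicator (J i) x *\<^sub>R q x)) = (\<lambda>x. ennreal (q x) * indicator (J i) x)"
        by (auto simp: indicator_def)
      ultimately show ?thesis by simp
    qed
    have "ennreal (real N * (8 * M * l)) = (\<Sum>i<N. ennreal (8 * M * l))"
      using M l by (simp add: ennreal_mult ennreal_of_nat_eq_real_of_nat)
    also have "\<dots> \<le> (\<Sum>i<N. \<integral>\<^sup>+x\<in>J i. ennreal (q x) \<partial>lebesgue)"
      using big by (intro sum_mono) auto
    also have "\<dots> = (\<integral>\<^sup>+x. (\<Sum>i<N. ennreal (q x) * indicator (J i) x) \<partial>lebesgue)"
      using meas by (intro nn_integral_sum[symmetric]) auto
    also have "\<dots> \<le> (\<integral>\<^sup>+x\<in>{\<alpha><..<\<beta>}. ennreal (q x) \<partial>lebesgue)"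
    proof (rule nn_integral_mono)
      fix x
      have "(\<Union>i<N. J i) \<subseteq> {\<alpha><..<\<beta>}" using sub by blast
      then have "indicator (\<Union>i<N. J i) x \<le> (indicator {\<alpha><..<\<beta>} x :: ennreal)"
        by (auto simp: indicator_def)
      then show "(\<Sum>i<N. ennreal (q x) * indicator (J i) x) \<le> ennreal (q x) * indicator {\<alpha><..<\<beta>} x"
        unfolding sum_distrib_left[symmetric] disj by (intro mult_left_mono) auto
    qed
    also have "\<dots> \<le> ennreal (M * (\<beta> - \<alpha>))" by (rule total)
    finally have "real N * (8 * M * l) \<le> M * (\<beta> - \<alpha>)"
      using M l by (subst (asm) ennreal_le_iff) auto
    also have "\<dots> = y * (2 * M * l)" by (simp add: yl[symmetric])
    also have "\<dots> < (2 * real N) * (2 * M * l)" using N_ge M l by (intro mult_strict_right_mono) auto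
    finally have "real N * (M * l) * 8 < real N * (M * l) * 4" by (simp add: mult_ac)
    moreover have "0 \<le> real N * (M * l)" using M l by simp
    ultimately show False by linarith
  qed
  then obtain i where "i < N" "(\<integral>\<^sup>+x\<in>J i. ennreal (q x) \<partial>lebesgue) \<le> ennreal (8 * M * l)" by blast
  with sub[of i] show ?thesis using that[of "a i"] unfolding J_def by blast
qed

lemma integral_abs_le_of_nn_integral:
  fixes q :: "real \<Rightarrow> real"
  assumes q: "set_integrable lebesgue {c..d} q" and nonneg: "AE x in lebesgue. x \<in> {c..d} \<longrightarrow> 0 \<le> q x"
    and le: "(\<integral>\<^sup>+x\<in>{c..d}. ennreal (q x) \<partial>lebesgue) \<le> ennreal B" and B: "0 \<le> B"
  shows "integral {c..d} (\<lambda>x. \<bar>q x\<bar>) \<le> B"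
proof -
  have abs: "set_integrable lebesgue {c..d} (\<lambda>x. \<bar>q x\<bar>)" by (rule set_integrable_abs[OF q])
  have "ennreal (integral {c..d} (\<lambda>x. \<bar>q x\<bar>)) = ennreal (LINT x|lebesgue. indicator {c..d} x *\<^sub>R \<bar>q x\<bar>)"
    using set_lebesgue_integral_eq_integral(2)[OF abs] by (simp add: set_lebesgue_integral_def)
  also have "\<dots> = (\<integral>\<^sup>+x. ennreal (indicator {c..d} x *\<^sub>R \<bar>q x\<bar>) \<partial>lebesgue)"
    using abs unfolding set_integrable_def by (intro nn_integral_eq_integral[symmetric]) auto
  also have "\<dots> = (\<integral>\<^sup>+x\<in>{c..d}. ennreal (q x) \<partial>lebesgue)"
  proof (rule nn_integral_cong_AE)
    show "AE x in lebesgue. ennreal (indicator {c..d} x *\<^sub>R \<bar>q x\<bar>) = ennreal (q x) * indicator {c..d} x"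
      using nonneg by eventually_elim (auto simp: indicator_def)
  qed
  also have "\<dots> \<le> ennreal B" by (rule le)
  finally show ?thesis using B by (simp add: ennreal_le_iff)
qed

section \<open>Geometry of the components\<close>

lemma open_connected_bounded_real:
  fixes S :: "real set"
  assumes "open S" "connected S" "S \<noteq> {}" "bdd_above S" "bdd_below S"
  obtains \<alpha> \<beta> where "\<alpha> < \<beta>" "S = {\<alpha><..<\<beta>}"
proof -
  have S: "S = {Inf S<..<Sup S}"
  proof (intro set_eqI iffI)
    fix x assume x: "x \<in> S"
    then obtain e where e: "e > 0" "ball x e \<subseteq> S" using assms(1) open_contains_ball by blast
    have "x - e / 2 \<in> ball x e" "x + e / 2 \<in> ball x e" using e(1) by (auto simp: dist_real_def)
    then have "x - e / 2 \<in> S" "x + e / 2 \<in> S" using e(2) by auto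
    then have "Inf S \<le> x - e / 2" "x + e / 2 \<le> Sup S"
      using cInf_lower[OF _ assms(5)] cSup_upper[OF _ assms(4)] by auto
    then show "x \<in> {Inf S<..<Sup S}" using e(1) by auto
  next
    fix x assume "x \<in> {Inf S<..<Sup S}"
    then have x: "Inf S < x" "x < Sup S" by auto
    obtain y z where "y \<in> S" "y < x" "z \<in> S" "x < z"
      using cInf_lessD[OF assms(3) x(1)] less_cSupD[OF assms(3) x(2)] by auto
    then show "x \<in> S" using connectedD_interval[OF assms(2), of y z x] by simp
  qed
  moreover have "Inf S < Sup S" using assms(3) S by fastforce
  ultimately show ?thesis using that by metis
qed

text \<open>Two connected sets unbounded above both contain all large reals and would meet, so at
  most one index qualifies; likewise below. The limit is unaffected by discarding these
  indices.\<close>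

lemma finite_unbounded_components:
  fixes \<Delta> :: "nat \<Rightarrow> real set"
  assumes conn: "\<And>k. connected (\<Delta> k)" and ne: "\<And>k. \<Delta> k \<noteq> {}"
    and disj: "\<And>j k. j \<noteq> k \<Longrightarrow> \<Delta> j \<inter> \<Delta> k = {}"
  shows "finite {k. \<not> bdd_above (\<Delta> k)}" "finite {k. \<not> bdd_below (\<Delta> k)}"
proof -
  have sub1: "finite A" if "\<And>j k. j \<in> A \<Longrightarrow> k \<in> A \<Longrightarrow> j = k" for A :: "nat set"
  proof (cases "A = {}")
    case False
    then obtain j where "j \<in> A" by blast
    then have "A \<subseteq> {j}" using that by blast
    then show ?thesis by (rule finite_subset) simp
  qed simp
  have up: "x \<in> \<Delta> j" if unb: "\<not> bdd_above (\<Delta> j)" and y: "y \<in> \<Delta> j" "y \<le> x" for j x y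
  proof -
    obtain z where z: "z \<in> \<Delta> j" "x < z" using unb unfolding bdd_above_def by (auto simp: not_le)
    show ?thesis using connectedD_interval[OF conn[of j] y(1) z(1) y(2)] z(2) by simp
  qed
  have down: "x \<in> \<Delta> j" if unb: "\<not> bdd_below (\<Delta> j)" and y: "y \<in> \<Delta> j" "x \<le> y" for j x y
  proof -
    obtain z where z: "z \<in> \<Delta> j" "z < x" using unb unfolding bdd_below_def by (auto simp: not_le)
    show ?thesis using connectedD_interval[OF conn[of j] z(1) y(1) _ y(2)] z(2) by simp
  qed
  show "finite {k. \<not> bdd_above (\<Delta> k)}"
  proof (rule sub1, rule ccontr)
    fix j k assume jk: "j \<in> {k. \<not> bdd_above (\<Delta> k)}" "k \<in> {k. \<not> bdd_above (\<Delta> k)}" "j \<noteq> k"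
    obtain x y where "x \<in> \<Delta> j" "y \<in> \<Delta> k" using ne by blast
    then have "max x y \<in> \<Delta> j" "max x y \<in> \<Delta> k"
      using up[of j x "max x y"] up[of k y "max x y"] jk by auto
    then show False using disj[OF jk(3)] by blast
  qed
  show "finite {k. \<not> bdd_below (\<Delta> k)}"
  proof (rule sub1, rule ccontr)
    fix j k assume jk: "j \<in> {k. \<not> bdd_below (\<Delta> k)}" "k \<in> {k. \<not> bdd_below (\<Delta> k)}" "j \<noteq> k"
    obtain x y where "x \<in> \<Delta> j" "y \<in> \<Delta> k" using ne by blast
    then have "min x y \<in> \<Delta> j" "min x y \<in> \<Delta> k"
      using down[of j x "min x y"] down[of k y "min x y"] jk by auto
    then show False using disj[OF jk(3)] by blast
  qed
qed

lemma open_diff_signed_support: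
  assumes "open I" shows "open (I - signed_support I \<nu>)"
  unfolding open_subopen[of "I - signed_support I \<nu>"]
proof
  fix x assume x: "x \<in> I - signed_support I \<nu>"
  then obtain U where U: "open U" "x \<in> U" "\<forall>B\<in>rc_borel I. B \<subseteq> U \<longrightarrow> \<nu> B = 0"
    by (auto simp: signed_support_def)
  have "U \<inter> I \<subseteq> I - signed_support I \<nu>" using U(1,3) by (auto simp: signed_support_def)
  then show "\<exists>T. open T \<and> x \<in> T \<and> T \<subseteq> I - signed_support I \<nu>"
    using U x assms by (intro exI[of _ "U \<inter> I"]) auto
qed

lemma length_and_mean_bounds:
  fixes X :: ennreal
  assumes D: "0 < D" and M: "1 \<le> M"
    and le: "1 / (ennreal D)\<^sup>2 + 1 / ennreal D * X \<le> ennreal M"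
  shows "1 / M \<le> D" "X \<le> ennreal (M * D)"
proof -
  have inv: "1 / (ennreal D)\<^sup>2 = ennreal (1 / D\<^sup>2)" "1 / ennreal D = ennreal (1 / D)"
    using D by (simp_all add: ennreal_power divide_ennreal flip: ennreal_1)
  have "ennreal (1 / D\<^sup>2) \<le> ennreal M" using order_trans[OF add_increasing2[OF zero_le order_refl] le] inv by simp
  then have "1 / D\<^sup>2 \<le> M" using M by (simp add: ennreal_le_iff)
  show "1 / M \<le> D"
  proof (rule ccontr)
    \<comment> \<open>From \<open>1 / D\<^sup>2 \<le> M\<close> one has
      \<open>D \<ge> 1 / sqrt M\<close>; the weaker \<open>1 / M\<close>, valid since
      \<open>M \<ge> 1\<close>, avoids the root.\<close>
    assume "\<not> 1 / M \<le> D"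
    then have "D * M < 1" using M by (simp add: not_le pos_less_divide_eq)
    have "1 \<le> M * D\<^sup>2" using \<open>1 / D\<^sup>2 \<le> M\<close> D by (simp add: pos_divide_le_eq)
    also have "\<dots> = (D * M) * D" by (simp add: power2_eq_square)
    also have "\<dots> < 1 * D" using \<open>D * M < 1\<close> D by (intro mult_strict_right_mono)
    also have "\<dots> \<le> D * M" using D M by simp
    finally show False using \<open>D * M < 1\<close> by simp
  qed
  have "ennreal (1 / D) * X \<le> ennreal M" using order_trans[OF add_increasing[OF zero_le order_refl] le] inv by simp
  then have "ennreal D * (ennreal (1 / D) * X) \<le> ennreal D * ennreal M" by (intro mult_left_mono) auto
  moreover have "ennreal D * (ennreal (1 / D) * X) = X"
    using D by (simp add: mult.assoc[symmetric] ennreal_mult[symmetric])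
  moreover have "ennreal D * ennreal M = ennreal (M * D)"
    using D M by (simp add: ennreal_mult[symmetric] mult.commute)
  ultimately show "X \<le> ennreal (M * D)" by simp
qed

theorem proposition8p13:
  fixes a b :: ereal and I :: "real set" and \<nu> :: "real set \<Rightarrow> real" and q :: "real \<Rightarrow> real"
    and \<Delta> :: "nat \<Rightarrow> real set" and d :: "nat \<Rightarrow> ennreal" and H :: graph
  assumes "a < b" and "I = einterval a b"
    and "signed_borel_measure I \<nu>" and "singular_lborel I \<nu>"
    and "loc_integrable lebesgue I q" and "AE x in lebesgue_on I. 0 \<le> q x"
    and "bij_betw \<Delta> UNIV (components (I - signed_support I \<nu>))"
    and "\<And>k. d k = emeasure lebesgue (\<Delta> k)"
    and "self_adjoint_realization I \<nu> q H"
    and "lower_semibounded I H" and "discrete_spectrum I H"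
  shows "(\<lambda>k. 1 / (d k)\<^sup>2 + 1 / d k * (\<integral>\<^sup>+x\<in>\<Delta> k. ennreal (q x) \<partial>lebesgue)) \<longlonglongrightarrow> \<infinity>"
proof -
  have oI: "open I" by (simp add: assms(2))
  then have I: "I \<in> sets lebesgue" by auto
  have comp: "\<Delta> k \<in> components (I - signed_support I \<nu>)" for k
    using assms(7) by (auto simp: bij_betw_def)
  have \<Delta>_open: "open (\<Delta> k)" for k
    using open_components[OF open_diff_signed_support[OF oI] comp] .
  have \<Delta>_conn: "connected (\<Delta> k)" and \<Delta>_ne: "\<Delta> k \<noteq> {}" and \<Delta>_sub: "\<Delta> k \<subseteq> I - signed_support I \<nu>" for k
    using in_components_connected[OF comp] in_components_nonempty[OF comp] in_components_subset[OF comp] by auto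
  have \<Delta>_disj: "\<Delta> j \<inter> \<Delta> k = {}" if "j \<noteq> k" for j k
  proof -
    have "\<Delta> j \<noteq> \<Delta> k" using assms(7) that by (auto simp: bij_betw_def inj_def)
    then show ?thesis using components_nonoverlap[OF comp[of j] comp[of k]] by simp
  qed
  have q_nonneg: "AE x in lebesgue. x \<in> I \<longrightarrow> 0 \<le> q x"
    using assms(6) I by (simp add: AE_restrict_space_iff)
  define Q where "Q k = 1 / (d k)\<^sup>2 + 1 / d k * (\<integral>\<^sup>+x\<in>\<Delta> k. ennreal (q x) \<partial>lebesgue)" for k
  \<comment> \<open>Divergence to infinity in \<open>ennreal\<close> means that every real level
    \<open>K\<close> is exceeded by all but finitely many \<open>k\<close>.\<close>
  have "finite {k. \<not> ennreal K < Q k}" for K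
  proof (rule ccontr)
    assume inf: "infinite {k. \<not> ennreal K < Q k}"
    \<comment> \<open>\<open>K\<close> may be small or negative; the length and mean bounds require
      a level of at least 1.\<close>
    define M where "M = max K 1"
    have M: "1 \<le> M" by (simp add: M_def)
    \<comment> \<open>This choice gives \<open>2 * l \<le> 1 / M\<close>, so that the pieces fit
      into each component, and \<open>l * (8 * M * l) = 1 / (8 * M)\<close>, below the 1/4 required
      for the solution \<open>w\<close>.\<close>
    define l where "l = 1 / (8 * M)"
    have l: "0 < l" using M by (simp add: l_def)
    define S where "S = {k. \<not> ennreal K < Q k} - ({k. \<not> bdd_above (\<Delta> k)} \<union> {k. \<not> bdd_below (\<Delta> k)})"
    have "infinite S" unfolding S_def
      using finite_unbounded_components[OF \<Delta>_conn \<Delta>_ne \<Delta>_disj] inf by (intro Diff_infinite_finite) auto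
    then obtain r :: "nat \<Rightarrow> nat" where r: "inj r" "range r \<subseteq> S"
      using infinite_countable_subset by blast
    have "\<exists>\<phi> \<psi>. (\<phi>, \<psi>) \<in> H \<and> (\<forall>x. x \<notin> \<Delta> k \<longrightarrow> \<phi> x = 0 \<and> \<psi> x = 0) \<and>
        l ^ 9 / 294912 \<le> (L2_norm I \<phi>)\<^sup>2 \<and> (L2_norm I \<psi>)\<^sup>2 \<le> 100 * l ^ 5" if k: "k \<in> S" for k
    proof -
      have "bdd_above (\<Delta> k)" "bdd_below (\<Delta> k)" using k by (auto simp: S_def)
      then obtain \<alpha> \<beta> where ab: "\<alpha> < \<beta>" "\<Delta> k = {\<alpha><..<\<beta>}"
        by (rule open_connected_bounded_real[OF \<Delta>_open \<Delta>_conn \<Delta>_ne])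
      have dk: "d k = ennreal (\<beta> - \<alpha>)" unfolding assms(8) ab(2) using ab(1) by simp
      have "Q k \<le> ennreal K" using k by (auto simp: S_def not_less)
      also have "\<dots> \<le> ennreal M" by (intro ennreal_leI) (simp add: M_def)
      finally have QM: "1 / (ennreal (\<beta> - \<alpha>))\<^sup>2 + 1 / ennreal (\<beta> - \<alpha>) * (\<integral>\<^sup>+x\<in>\<Delta> k. ennreal (q x) \<partial>lebesgue) \<le> ennreal M"
        unfolding Q_def dk .
      note bounds = length_and_mean_bounds[OF _ M QM]
      have "1 / M \<le> \<beta> - \<alpha>" using bounds(1) ab(1) by simp
      moreover have "2 * l \<le> 1 / M" using M by (simp add: l_def field_simps)
      ultimately have l2: "2 * l \<le> \<beta> - \<alpha>" by linarith
      have total: "(\<integral>\<^sup>+x\<in>{\<alpha><..<\<beta>}. ennreal (q x) \<partial>lebesgue) \<le> ennreal (M * (\<beta> - \<alpha>))"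
        using bounds(2) ab by simp
      have q_int: "set_integrable lebesgue {x..y} q" if "{x..y} \<subseteq> {\<alpha><..<\<beta>}" for x y
      proof -
        have "{x..y} \<subseteq> I" using that \<Delta>_sub[of k] ab(2) by blast
        then show ?thesis using assms(5) unfolding loc_integrable_def by blast
      qed
      have M0: "0 < M" using M by simp
      obtain c where c: "{c..c + l} \<subseteq> {\<alpha><..<\<beta>}"
        "(\<integral>\<^sup>+x\<in>{c..c + l}. ennreal (q x) \<partial>lebesgue) \<le> ennreal (8 * M * l)"
        by (rule short_interval_small_integral[OF M0 l l2 q_int total])
      have sub: "{c..c + l} \<subseteq> I - signed_support I \<nu>" using c(1) \<Delta>_sub[of k] ab(2) by blast
      have "AE x in lebesgue. x \<in> {c..c + l} \<longrightarrow> 0 \<le> q x"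
        using q_nonneg by eventually_elim (use sub in blast)
      then have "integral {c..c + l} (\<lambda>x. \<bar>q x\<bar>) \<le> 8 * M * l"
        using M l by (intro integral_abs_le_of_nn_integral[OF q_int[OF c(1)] _ c(2)]) auto
      then have "(c + l - c) * integral {c..c + l} (\<lambda>x. \<bar>q x\<bar>) \<le> l * (8 * M * l)"
        using l by (simp add: mult_left_mono)
      also have "\<dots> \<le> 1 / 4" using M by (simp add: l_def field_simps)
      finally have small: "(c + l - c) * integral {c..c + l} (\<lambda>x. \<bar>q x\<bar>) \<le> 1 / 4" .
      have cl: "c < c + l" using l by simp
      obtain \<phi> \<psi> where "(\<phi>, \<psi>) \<in> H" and z: "\<And>x. x \<notin> {c..c + l} \<Longrightarrow> \<phi> x = 0" "\<And>x. x \<notin> {c..c + l} \<Longrightarrow> \<psi> x = 0"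
        and n: "(c + l - c) ^ 9 / 294912 \<le> (L2_norm I \<phi>)\<^sup>2" "(L2_norm I \<psi>)\<^sup>2 \<le> 100 * (c + l - c) ^ 5"
        by (rule test_function_exists[OF I assms(3) sub cl assms(9) q_int[OF c(1)] small]) (rule that)
      moreover have "\<phi> x = 0 \<and> \<psi> x = 0" if "x \<notin> \<Delta> k" for x
        using z[of x] c(1) that ab(2) by blast
      ultimately show ?thesis by (intro exI[of _ \<phi>] exI[of _ \<psi>]) simp
    qed
    then have "\<exists>\<phi> \<psi>. (\<phi>, \<psi>) \<in> H \<and> (\<forall>x. x \<notin> \<Delta> (r n) \<longrightarrow> \<phi> x = 0 \<and> \<psi> x = 0) \<and>
        l ^ 9 / 294912 \<le> (L2_norm I \<phi>)\<^sup>2 \<and> (L2_norm I \<psi>)\<^sup>2 \<le> 100 * l ^ 5" for n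
      using r(2) by blast
    then obtain \<phi> \<psi> where fg: "\<And>n. (\<phi> n, \<psi> n) \<in> H"
      and supp: "\<And>n x. x \<notin> \<Delta> (r n) \<Longrightarrow> \<phi> n x = 0" "\<And>n x. x \<notin> \<Delta> (r n) \<Longrightarrow> \<psi> n x = 0"
      and norms: "\<And>n. l ^ 9 / 294912 \<le> (L2_norm I (\<phi> n))\<^sup>2" "\<And>n. (L2_norm I (\<psi> n))\<^sup>2 \<le> 100 * l ^ 5"
      by metis
    have orth: "L2_inner I f g = 0"
      if "m \<noteq> n" "\<And>x. x \<notin> \<Delta> (r m) \<Longrightarrow> f x = 0" "\<And>x. x \<notin> \<Delta> (r n) \<Longrightarrow> g x = 0" for m n f g
    proof -
      have "r m \<noteq> r n" using r(1) that(1) by (simp add: inj_eq)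
      then have "f x * cnj (g x) = 0" for x
        using \<Delta>_disj[of "r m" "r n"] that(2)[of x] that(3)[of x] by (cases "x \<in> \<Delta> (r m)") auto
      then have "(\<lambda>x. f x * cnj (g x)) = (\<lambda>_. 0)" by (rule ext)
      then show ?thesis by (simp only: L2_inner_def Bochner_Integration.integral_zero)
    qed
    \<comment> \<open>The square root of the quotient of the two norm bounds,
      \<open>100 l ^ 5\<close> over \<open>l ^ 9 / 294912\<close>; it depends on \<open>l\<close>
      alone.\<close>
    define C where "C = sqrt (100 * 294912 / l ^ 4)"
    show False
    proof (rule no_orthogonal_graph_sequence[OF I _ assms(11) fg])
      show "self_adjoint I H" using assms(9) by (simp add: self_adjoint_realization_def)
      show "L2_inner I (\<phi> j) (\<phi> k) = 0" if "j \<noteq> k" for j k by (rule orth[OF that supp(1) supp(1)])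
      show "L2_inner I (\<phi> j) (\<psi> k) = 0" if "j \<noteq> k" for j k by (rule orth[OF that supp(1) supp(2)])
      show "L2_inner I (\<psi> j) (\<psi> k) = 0" if "j \<noteq> k" for j k by (rule orth[OF that supp(2) supp(2)])
      show "0 < sqrt (l ^ 9 / 294912)" using l by simp
      show "sqrt (l ^ 9 / 294912) \<le> L2_norm I (\<phi> k)" for k
        by (rule real_le_lsqrt[OF _ norms(1)]) (use l in \<open>simp_all add: L2_norm_nonneg\<close>)
      show "L2_norm I (\<psi> k) \<le> C * L2_norm I (\<phi> k)" for k
      proof (rule power2_le_imp_le)
        have "(L2_norm I (\<psi> k))\<^sup>2 \<le> 100 * l ^ 5" by (rule norms(2))
        also have "\<dots> = (100 * 294912 / l ^ 4) * (l ^ 9 / 294912)"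
          using l by (simp add: field_simps flip: power_add)
        also have "\<dots> \<le> (100 * 294912 / l ^ 4) * (L2_norm I (\<phi> k))\<^sup>2"
          using l norms(1)[of k] by (intro mult_left_mono) auto
        also have "\<dots> = (C * L2_norm I (\<phi> k))\<^sup>2"
          using l by (simp add: C_def power_mult_distrib)
        finally show "(L2_norm I (\<psi> k))\<^sup>2 \<le> (C * L2_norm I (\<phi> k))\<^sup>2" .
        show "0 \<le> C * L2_norm I (\<phi> k)" using l by (simp add: C_def L2_norm_nonneg)
      qed
    qed
  qed
  then have "\<forall>\<^sub>F k in sequentially. ennreal K < Q k" for K
    unfolding cofinite_eq_sequentially[symmetric] eventually_cofinite .
  then have "Q \<longlonglongrightarrow> top" by (simp add: tendsto_top_iff_ennreal)
  then show ?thesis by (simp add: Q_def[abs_def])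
qed

end
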